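(* The space $(G^s,\langle\cdot,\cdot\rangle)$ is isometric to a subset of the unit pseudosphere in $L_2(S^1;\mathbb R^2)$. More precisely, for any $s>5/2$, the map $\Phi:G^s\to\mathcal U^{s-1}\subset\mathcal S^{s-1}$ defined by $$\Phi(\varphi,\alpha)=\sqrt{\varphi_x}\,\bigl(\cosh(\alpha/2),\sinh(\alpha/2)\bigr)$$ is a diffeomorphism and an isometry.
   Context: $S^1\simeq\mathbb R/\mathbb Z$; $H^s(S^1)$ is the $L_2$-based Sobolev space and $H_0^s(S^1)=\{u\in H^s(S^1):u(0)=0\}$. For $s>5/2$, $\mathrm{Diff}_0^s(S^1)$ is the Banach manifold of orientation-preserving diffeomorphisms $\varphi$ of $S^1$ of Sobolev class $H^s$ with $\varphi(0)=0$. $G^s$ is the semidirect product $\mathrm{Diff}_0^s(S^1)\circledS H^{s-1}(S^1)$ with multiplication $(\varphi,\alpha)(\psi,\beta)=(\varphi\circ\psi,\beta+\alpha\circ\psi)$. It carries the right-invariant (indefinite, nondegenerate) metric (the case $\kappa=-1$) $$\langle U,V\rangle_{(\varphi,\alpha)}=\frac14\int_{S^1}\Bigl(\frac{U_{1x}V_{1x}}{\varphi_x}-U_2V_2\varphi_x\Bigr)dx,$$ for $U=(U_1,U_2)$, $V=(V_1,V_2)$ in $T_{(\varphi,\alpha)}G^s\simeq H_0^s(S^1)\times H^{s-1}(S^1)$. The unit pseudosphere is $\mathcal S=\{(f_1,f_2)\in L_2(S^1;\mathbb R^2):\int_{S^1}(f_1^2-f_2^2)\,dx=1\}$. For each Sobolev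 exponent $r$ used, $\mathcal S^r$ is the set of elements of $\mathcal S$ of class $H^r$, a Banach submanifold of $H^r(S^1;\mathbb R^2)$, equipped with the weak pseudo-Riemannian metric induced by $\langle\!\langle X,Y\rangle\!\rangle=\int_{S^1}(X_1Y_1-X_2Y_2)\,dx$. Finally, $\mathcal U^r$ is the open subset $$\mathcal U^r=\{(f_1,f_2)\in\mathcal S^r: f_1(x)>0\text{ and }f_1^2(x)-f_2^2(x)>0\text{ for all }x\in S^1\},$$ with the manifold structure and metric inherited from $\mathcal S^r$. *)

theory Defs
  imports "HOL-Analysis.Analysis" "HOL-Library.Function_Algebras"
begin

section \<open>Calculus in normed spaces given by a carrier and a norm\<close>

text \<open>
  The Sobolev spaces of the circle depend on a real exponent, so they cannot be types. They are
  subspaces of a function space, each with its own norm.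
\<close>

instantiation "fun" :: (type, real_vector) real_vector
begin

definition scaleR_fun_def: "c *\<^sub>R f = (\<lambda>x. c *\<^sub>R f x)"

instance
  by standard (simp_all add: scaleR_fun_def fun_eq_iff scaleR_add_right scaleR_add_left)

end

record 'a normed_sub =
  vecs :: "'a set"
  nrm :: "'a \<Rightarrow> real"

definition prod_space ::
    "'a normed_sub \<Rightarrow> 'b normed_sub \<Rightarrow> ('a \<times> 'b) normed_sub" where
  "prod_space E F =
     \<lparr>vecs = vecs E \<times> vecs F, nrm = (\<lambda>(u, v). sqrt ((nrm E u)\<^sup>2 + (nrm F v)\<^sup>2))\<rparr>"

text \<open>
  Only the increment \<open>h\<close> is required to lie in \<open>E\<close>, so that open subsets of affine spaces
  \<open>a + E\<close> are covered as well; likewise, maps into an affine space \<open>b + F\<close> are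
  differentiated by means of their increments, which lie in \<open>F\<close>.
\<close>

definition open_in :: "('a::real_vector) normed_sub \<Rightarrow> 'a set \<Rightarrow> bool" where
  "open_in E W \<longleftrightarrow> (\<forall>x\<in>W. \<exists>d>0. \<forall>h\<in>vecs E. nrm E h < d \<longrightarrow> x + h \<in> W)"

definition bounded_linear_map ::
    "('a::real_vector) normed_sub \<Rightarrow> ('b::real_vector) normed_sub \<Rightarrow> ('a \<Rightarrow> 'b) \<Rightarrow> bool" where
  "bounded_linear_map E F L \<longleftrightarrow>
     (\<forall>h\<in>vecs E. L h \<in> vecs F) \<and>
     (\<forall>h\<in>vecs E. \<forall>k\<in>vecs E. \<forall>c. L (h + c *\<^sub>R k) = L h + c *\<^sub>R L k) \<and>
     (\<exists>C. \<forall>h\<in>vecs E. nrm F (L h) \<le> C * nrm E h)"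

definition has_frechet_derivative ::
    "('a::real_vector) normed_sub \<Rightarrow> ('b::real_vector) normed_sub \<Rightarrow> ('a \<Rightarrow> 'b) \<Rightarrow>
      ('a \<Rightarrow> 'b) \<Rightarrow> 'a \<Rightarrow> bool" where
  "has_frechet_derivative E F f L x \<longleftrightarrow>
     bounded_linear_map E F L \<and>
     (\<forall>e>0. \<exists>d>0. \<forall>h\<in>vecs E. nrm E h < d \<longrightarrow>
        f (x + h) - f x \<in> vecs F \<and> nrm F (f (x + h) - f x - L h) \<le> e * nrm E h)"

text \<open>A \<open>k\<close>-linear map takes its arguments as a list of length \<open>k\<close>.\<close>

definition bounded_multilinear_map ::
    "('a::real_vector) normed_sub \<Rightarrow> ('b::real_vector) normed_sub \<Rightarrow> nat \<Rightarrow>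
      ('a list \<Rightarrow> 'b) \<Rightarrow> bool" where
  "bounded_multilinear_map E F k M \<longleftrightarrow>
     (\<forall>hs. length hs = k \<and> set hs \<subseteq> vecs E \<longrightarrow> M hs \<in> vecs F) \<and>
     (\<forall>hs. length hs = k \<and> set hs \<subseteq> vecs E \<longrightarrow>
        (\<forall>i<k. \<forall>a\<in>vecs E. \<forall>b\<in>vecs E. \<forall>c.
           M (hs[i := a + c *\<^sub>R b]) = M (hs[i := a]) + c *\<^sub>R M (hs[i := b]))) \<and>
     (\<exists>C. \<forall>hs. length hs = k \<and> set hs \<subseteq> vecs E \<longrightarrow>
        nrm F (M hs) \<le> C * prod_list (map (nrm E) hs))"

text \<open>
  Smoothness (\<open>C\<^sup>\<infinity>\<close> in the Frechet sense) on an open set: \<open>D x\<close>, restricted to lists of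
  length \<open>k\<close>, is the \<open>k\<close>-th derivative at \<open>x\<close>. The last clause says that the
  \<open>(k+1)\<close>-st derivative is the Frechet derivative of the \<open>k\<close>-th one in the operator norm
  of \<open>k\<close>-linear maps.
\<close>

definition smooth_on_open ::
    "('a::real_vector) normed_sub \<Rightarrow> ('b::real_vector) normed_sub \<Rightarrow> 'a set \<Rightarrow>
      ('a \<Rightarrow> 'b) \<Rightarrow> bool" where
  "smooth_on_open E F W f \<longleftrightarrow> open_in E W \<and>
     (\<exists>D :: 'a \<Rightarrow> 'a list \<Rightarrow> 'b.
        (\<forall>x\<in>W. D x [] = f x) \<and>
        (\<forall>x\<in>W. \<forall>k\<ge>1. bounded_multilinear_map E F k (D x)) \<and>
        (\<forall>x\<in>W. \<forall>k. \<forall>e>0. \<exists>d>0. \<forall>h\<in>vecs E. nrm E h < d \<longrightarrow>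
           (\<forall>hs. length hs = k \<and> set hs \<subseteq> vecs E \<longrightarrow>
              D (x + h) hs - D x hs \<in> vecs F \<and>
              nrm F (D (x + h) hs - D x hs - D x (h # hs))
                \<le> e * nrm E h * prod_list (map (nrm E) hs))))"

text \<open>
  Maps on an embedded submanifold \<open>S\<close> are smooth if they extend locally to smooth maps on open
  subsets of the ambient space. If \<open>S\<close> is itself open, this is the usual smoothness.
  A map into an embedded submanifold is smooth iff it is smooth into the ambient space.
\<close>

definition smooth_map ::
    "('a::real_vector) normed_sub \<Rightarrow> ('b::real_vector) normed_sub \<Rightarrow> 'a set \<Rightarrow>
      ('a \<Rightarrow> 'b) \<Rightarrow> bool" where
  "smooth_map E F S f \<longleftrightarrow>
     (\<forall>p\<in>S. \<exists>W g. p \<in> W \<and> smooth_on_open E F W g \<and> (\<forall>q\<in>S \<inter> W. g q = f q))"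

definition diffeomorphism_between ::
    "('a::real_vector) normed_sub \<Rightarrow> ('b::real_vector) normed_sub \<Rightarrow> 'a set \<Rightarrow> 'b set \<Rightarrow>
      ('a \<Rightarrow> 'b) \<Rightarrow> bool" where
  "diffeomorphism_between E F S T f \<longleftrightarrow>
     bij_betw f S T \<and> smooth_map E F S f \<and> smooth_map F E T (inv_into S f)"

text \<open>
  \<open>f\<close> pulls the metric \<open>gT\<close> on \<open>T\<close> back to the metric \<open>g\<close> on \<open>S\<close>, where \<open>S\<close> is open
  with tangent spaces \<open>E\<close>, and \<open>T\<close> is a submanifold of \<open>F\<close> with tangent spaces
  \<open>tgt q\<close>.
\<close>

definition isometric_map ::
    "('a::real_vector) normed_sub \<Rightarrow> ('b::real_vector) normed_sub \<Rightarrow> 'a set \<Rightarrow> 'b set \<Rightarrow>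
      ('b \<Rightarrow> 'b set) \<Rightarrow> ('a \<Rightarrow> 'a \<Rightarrow> 'a \<Rightarrow> real) \<Rightarrow> ('b \<Rightarrow> 'b \<Rightarrow> 'b \<Rightarrow> real) \<Rightarrow>
      ('a \<Rightarrow> 'b) \<Rightarrow> bool" where
  "isometric_map E F S T tgt g gT f \<longleftrightarrow>
     (\<forall>p\<in>S. f p \<in> T \<and> (\<exists>L. has_frechet_derivative E F f L p \<and>
        (\<forall>U\<in>vecs E. L U \<in> tgt (f p)) \<and>
        (\<forall>U\<in>vecs E. \<forall>V\<in>vecs E. gT (f p) (L U) (L V) = g p U V)))"


section \<open>Sobolev spaces on the circle\<close>

text \<open>Functions on the circle are functions on the line of period 1.\<close>

definition circle_L2 :: "(real \<Rightarrow> real) set" where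
  "circle_L2 = {f. (\<forall>x. f (x + 1) = f x) \<and> f \<in> borel_measurable lebesgue \<and>
                   (\<lambda>x. (f x)\<^sup>2) integrable_on {0..1}}"

definition fourier_coeff :: "(real \<Rightarrow> real) \<Rightarrow> int \<Rightarrow> complex" where
  "fourier_coeff f n = integral {0..1} (\<lambda>x. of_real (f x) * cis (- 2 * pi * of_int n * x))"

text \<open>
  The elements of \<open>H\<^sup>r\<close> are represented by their continuous representatives, so this is
  \<open>H\<^sup>r\<close> only for \<open>r > 1/2\<close>.
\<close>

definition sobolev :: "real \<Rightarrow> (real \<Rightarrow> real) normed_sub" where
  "sobolev r =
     \<lparr>vecs = {f \<in> circle_L2. continuous_on UNIV f \<and>
        (\<lambda>n::int. (1 + (of_int n)\<^sup>2) powr r * (cmod (fourier_coeff f n))\<^sup>2) summable_on UNIV},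
      nrm = (\<lambda>f. sqrt (\<Sum>\<^sub>\<infinity>n::int. (1 + (of_int n)\<^sup>2) powr r * (cmod (fourier_coeff f n))\<^sup>2))\<rparr>"

definition sobolev0 :: "real \<Rightarrow> (real \<Rightarrow> real) normed_sub" where
  "sobolev0 r = \<lparr>vecs = {u \<in> vecs (sobolev r). u 0 = 0}, nrm = nrm (sobolev r)\<rparr>"


section \<open>The semidirect product\<close>

text \<open>
  A diffeomorphism of the circle fixing \<open>0\<close> is represented by its lift \<open>\<phi>\<close> to the line with
  \<open>\<phi> 0 = 0\<close>; that \<open>\<phi> (x + 1) = \<phi> x + 1\<close> is the periodicity of \<open>\<phi> - id\<close>.
\<close>

definition Diff0 :: "real \<Rightarrow> (real \<Rightarrow> real) set" where
  "Diff0 s = {\<phi>. (\<lambda>x. \<phi> x - x) \<in> vecs (sobolev s) \<and> \<phi> 0 = 0 \<and>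
                 strict_mono \<phi> \<and> bij \<phi> \<and>
                 \<phi> C1_differentiable_on UNIV \<and> inv \<phi> C1_differentiable_on UNIV}"

text \<open>
  As a manifold, \<open>G s\<close> is an open subset of an affine space over \<open>G_model s\<close>, which is also
  its tangent space at each point. The right translations of \<open>G_mult\<close> are isometries of
  \<open>G_metric\<close>.
\<close>

definition G :: "real \<Rightarrow> ((real \<Rightarrow> real) \<times> (real \<Rightarrow> real)) set" where
  "G s = Diff0 s \<times> vecs (sobolev (s - 1))"

definition G_model :: "real \<Rightarrow> ((real \<Rightarrow> real) \<times> (real \<Rightarrow> real)) normed_sub" where
  "G_model s = prod_space (sobolev0 s) (sobolev (s - 1))"

definition G_mult ::
    "(real \<Rightarrow> real) \<times> (real \<Rightarrow> real) \<Rightarrow> (real \<Rightarrow> real) \<times> (real \<Rightarrow> real) \<Rightarrow>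
      (real \<Rightarrow> real) \<times> (real \<Rightarrow> real)" where
  "G_mult = (\<lambda>(\<phi>, \<alpha>) (\<psi>, \<beta>). (\<phi> \<circ> \<psi>, \<lambda>x. \<beta> x + \<alpha> (\<psi> x)))"

definition G_metric ::
    "(real \<Rightarrow> real) \<times> (real \<Rightarrow> real) \<Rightarrow> (real \<Rightarrow> real) \<times> (real \<Rightarrow> real) \<Rightarrow>
      (real \<Rightarrow> real) \<times> (real \<Rightarrow> real) \<Rightarrow> real" where
  "G_metric = (\<lambda>(\<phi>, \<alpha>) (U1, U2) (V1, V2).
     1/4 * integral {0..1} (\<lambda>x. deriv U1 x * deriv V1 x / deriv \<phi> x - U2 x * V2 x * deriv \<phi> x))"


section \<open>The unit pseudosphere\<close>

definition pseudo_inner ::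
    "(real \<Rightarrow> real) \<times> (real \<Rightarrow> real) \<Rightarrow> (real \<Rightarrow> real) \<times> (real \<Rightarrow> real) \<Rightarrow> real" where
  "pseudo_inner = (\<lambda>(X1, X2) (Y1, Y2). integral {0..1} (\<lambda>x. X1 x * Y1 x - X2 x * Y2 x))"

definition pseudosphere :: "((real \<Rightarrow> real) \<times> (real \<Rightarrow> real)) set" where
  "pseudosphere = {(f1, f2). f1 \<in> circle_L2 \<and> f2 \<in> circle_L2 \<and>
                             integral {0..1} (\<lambda>x. (f1 x)\<^sup>2 - (f2 x)\<^sup>2) = 1}"

definition S_ambient :: "real \<Rightarrow> ((real \<Rightarrow> real) \<times> (real \<Rightarrow> real)) normed_sub" where
  "S_ambient r = prod_space (sobolev r) (sobolev r)"

definition pseudosphere_H :: "real \<Rightarrow> ((real \<Rightarrow> real) \<times> (real \<Rightarrow> real)) set" where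
  "pseudosphere_H r = pseudosphere \<inter> vecs (S_ambient r)"

definition S_tangent ::
    "real \<Rightarrow> (real \<Rightarrow> real) \<times> (real \<Rightarrow> real) \<Rightarrow> ((real \<Rightarrow> real) \<times> (real \<Rightarrow> real)) set" where
  "S_tangent r f = {X \<in> vecs (S_ambient r). pseudo_inner f X = 0}"

definition U_set :: "real \<Rightarrow> ((real \<Rightarrow> real) \<times> (real \<Rightarrow> real)) set" where
  "U_set r = {(f1, f2) \<in> pseudosphere_H r. \<forall>x. f1 x > 0 \<and> (f1 x)\<^sup>2 - (f2 x)\<^sup>2 > 0}"

definition Phi ::
    "(real \<Rightarrow> real) \<times> (real \<Rightarrow> real) \<Rightarrow> (real \<Rightarrow> real) \<times> (real \<Rightarrow> real)" where
  "Phi = (\<lambda>(\<phi>, \<alpha>). (\<lambda>x. sqrt (deriv \<phi> x) * cosh (\<alpha> x / 2),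
                     \<lambda>x. sqrt (deriv \<phi> x) * sinh (\<alpha> x / 2)))"

end

theory Submission
  imports Defs
begin

text \<open>
  In the null coordinates \<open>a = f\<^sub>1 + f\<^sub>2\<close> and \<open>b = f\<^sub>1 - f\<^sub>2\<close> the map reads
  \<open>a = exp ((ln \<phi>\<^sub>x + \<alpha>) / 2)\<close>, \<open>b = exp ((ln \<phi>\<^sub>x - \<alpha>) / 2)\<close>, with inverse
  \<open>\<phi>\<^sub>x = a * b\<close>, \<open>\<alpha> = ln a - ln b\<close>. Since \<open>u \<mapsto> u\<^sub>x\<close> is an isomorphism from
  \<open>H\<^sub>0\<^sup>s\<close> onto the functions of mean zero in \<open>H\<^sup>s\<^sup>-\<^sup>1\<close>, everything reduces to the smoothness of
  \<open>exp\<close> and \<open>ln\<close> on the Banach algebra \<open>H\<^sup>s\<^sup>-\<^sup>1\<close>. Locally both are given by power series; the only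
  global input is that a positive function in \<open>H\<^sup>r\<close> has its logarithm in \<open>H\<^sup>r\<close>. For \<open>r \<le> 3/2\<close> this
  is shown as in Newman's proof of Wiener's lemma, by expanding around a trigonometric polynomial,
  and one passes from \<open>r\<close> to \<open>r + 1\<close> by \<open>(ln f)' = f' * exp (- ln f)\<close>. The isometry is a pointwise
  identity for the explicit derivative.
\<close>

subsection \<open>Normed subspaces and Frechet derivatives\<close>

text \<open>The obstacle behind the logarithm is that positivity concerns the supremum, while series
  converge by the norm: a positive f in H^r may be far in norm from every constant, so expanding
  around a constant gives no control. After f = p + g with p a trigonometric polynomial, the terms
  g^k / p^k are summable once the norm of p^(-k) grows like the k-th power of the supremum of 1/p,
  up to a ratio such as 3/2. Third derivatives give this with a factor cubic in k, and they control
  the H^r norm for r at most 3/2. The range (1/2, 3/2] has exactly the length of one induction step.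
  Derivatives of all orders are not computed one by one: the functions c * exp (a * ln u + b * ln v)
  contain their own partial derivatives, so one first-order computation settles every order. The
  inverse has to be smooth on an open set of the ambient space, hence it is extended from the
  pseudosphere to all f with f_1 > |f_2|; there the mean of f_1^2 - f_2^2 need not be 1, and the
  antiderivative is made periodic by subtracting the mean.\<close>

locale normed_subspace =
  fixes E :: "('a::real_vector) normed_sub"
  assumes subspace: "subspace (vecs E)"
    and nrm_nonneg: "0 \<le> nrm E x"
    and nrm_triangle: "x \<in> vecs E \<Longrightarrow> y \<in> vecs E \<Longrightarrow> nrm E (x + y) \<le> nrm E x + nrm E y"
    and nrm_scaleR: "x \<in> vecs E \<Longrightarrow> nrm E (c *\<^sub>R x) = \<bar>c\<bar> * nrm E x"
begin

lemma mem_0: "0 \<in> vecs E"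
  and mem_add: "x \<in> vecs E \<Longrightarrow> y \<in> vecs E \<Longrightarrow> x + y \<in> vecs E"
  and mem_diff: "x \<in> vecs E \<Longrightarrow> y \<in> vecs E \<Longrightarrow> x - y \<in> vecs E"
  and mem_scaleR: "x \<in> vecs E \<Longrightarrow> c *\<^sub>R x \<in> vecs E"
  and mem_minus: "x \<in> vecs E \<Longrightarrow> - x \<in> vecs E"
  and mem_sum: "(\<And>t. t \<in> T \<Longrightarrow> f t \<in> vecs E) \<Longrightarrow> sum f T \<in> vecs E"
  using subspace
  by (auto simp: subspace_0 subspace_add subspace_diff subspace_scale subspace_neg subspace_sum)

lemma nrm_0: "nrm E 0 = 0"
  using nrm_scaleR[OF mem_0, of 0] by simp

lemma nrm_minus: "x \<in> vecs E \<Longrightarrow> nrm E (- x) = nrm E x"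
  using nrm_scaleR[of x "-1"] by simp

lemma nrm_diff: "x \<in> vecs E \<Longrightarrow> y \<in> vecs E \<Longrightarrow> nrm E (x - y) \<le> nrm E x + nrm E y"
  using nrm_triangle[of x "- y"] by (simp add: mem_minus nrm_minus)

lemma nrm_sum:
  "(\<And>t. t \<in> T \<Longrightarrow> f t \<in> vecs E) \<Longrightarrow> nrm E (sum f T) \<le> (\<Sum>t\<in>T. nrm E (f t))"
proof (induction T rule: infinite_finite_induct)
  case (insert t T)
  have "nrm E (f t + sum f T) \<le> nrm E (f t) + nrm E (sum f T)"
    using insert.prems by (intro nrm_triangle mem_sum) auto
  then show ?case using insert by fastforce
qed (auto simp: nrm_0)

end

section \<open>Bounded linear maps\<close>

lemma bounded_linear_map_mem: "bounded_linear_map E F L \<Longrightarrow> h \<in> vecs E \<Longrightarrow> L h \<in> vecs F"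
  by (simp add: bounded_linear_map_def)

text \<open>The definition allows a negative constant; the maximum with 0 makes the bound usable in
  products.\<close>

lemma bounded_linear_map_bound:
  assumes "bounded_linear_map E F L" "normed_subspace E"
  obtains C where "C \<ge> 0" "\<And>h. h \<in> vecs E \<Longrightarrow> nrm F (L h) \<le> C * nrm E h"
proof -
  interpret normed_subspace E by fact
  obtain C where C: "\<And>h. h \<in> vecs E \<Longrightarrow> nrm F (L h) \<le> C * nrm E h"
    using assms unfolding bounded_linear_map_def by blast
  show thesis
  proof (rule that[of "max C 0"])
    show "nrm F (L h) \<le> max C 0 * nrm E h" if "h \<in> vecs E" for h
      using C[OF that] mult_right_mono[OF max.cobounded1[of C 0] nrm_nonneg[of h]] by linarith
  qed simp
qed

lemma bounded_linear_map_diff: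
  assumes "bounded_linear_map E F L" "h \<in> vecs E" "k \<in> vecs E"
  shows "L (h - k) = L h - L k"
proof -
  have "L (h + (-1) *\<^sub>R k) = L h + (-1) *\<^sub>R L k"
    using assms unfolding bounded_linear_map_def by blast
  then show ?thesis by simp
qed

lemma bounded_linear_map_compose:
  assumes L: "bounded_linear_map E F L" and M: "bounded_linear_map F H M"
    and "normed_subspace E" "normed_subspace F"
  shows "bounded_linear_map E H (\<lambda>h. M (L h))"
proof -
  obtain C where C: "C \<ge> 0" "\<And>h. h \<in> vecs E \<Longrightarrow> nrm F (L h) \<le> C * nrm E h"
    using bounded_linear_map_bound assms by blast
  obtain B where B: "B \<ge> 0" "\<And>h. h \<in> vecs F \<Longrightarrow> nrm H (M h) \<le> B * nrm F h"
    using bounded_linear_map_bound assms by blast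
  have "nrm H (M (L h)) \<le> B * C * nrm E h" if "h \<in> vecs E" for h
    using B(2)[OF bounded_linear_map_mem[OF L that]] mult_left_mono[OF C(2)[OF that] B(1)] by simp
  then show ?thesis using L M unfolding bounded_linear_map_def by auto
qed

lemma bounded_linear_map_add_scaleR:
  assumes L: "bounded_linear_map E F L" and M: "bounded_linear_map E F M"
    and E: "normed_subspace E" and F: "normed_subspace F"
  shows "bounded_linear_map E F (\<lambda>h. L h + c *\<^sub>R M h)"
proof -
  interpret F: normed_subspace F by fact
  obtain C where C: "\<And>h. h \<in> vecs E \<Longrightarrow> nrm F (L h) \<le> C * nrm E h"
    using bounded_linear_map_bound[OF L E] by blast
  obtain B where B: "\<And>h. h \<in> vecs E \<Longrightarrow> nrm F (M h) \<le> B * nrm E h"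
    using bounded_linear_map_bound[OF M E] by blast
  have "nrm F (L h + c *\<^sub>R M h) \<le> (C + \<bar>c\<bar> * B) * nrm E h" if h: "h \<in> vecs E" for h
    using F.nrm_triangle[of "L h" "c *\<^sub>R M h"] F.nrm_scaleR[of "M h" c] C[OF h]
      mult_left_mono[OF B[OF h], of "\<bar>c\<bar>"] bounded_linear_map_mem[OF L h]
      bounded_linear_map_mem[OF M h] F.mem_scaleR
    by (simp add: algebra_simps)
  moreover have "L (h + a *\<^sub>R k) + c *\<^sub>R M (h + a *\<^sub>R k) =
      (L h + c *\<^sub>R M h) + a *\<^sub>R (L k + c *\<^sub>R M k)" if "h \<in> vecs E" "k \<in> vecs E" for h k a
    using L M that unfolding bounded_linear_map_def by (auto simp: algebra_simps)
  ultimately show ?thesis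
    using L M unfolding bounded_linear_map_def by (blast intro: F.mem_add F.mem_scaleR)
qed

text \<open>The remainder is identically 0. Only increments of \<open>f\<close> are constrained, so
  base points and values may lie in affine spaces over \<open>E\<close> and \<open>F\<close>; this
  is how \<open>\<phi>\<close>, a lift rather than a periodic function, is differentiated.\<close>

lemma has_frechet_derivative_affine:
  assumes "bounded_linear_map E F L" "\<And>h. h \<in> vecs E \<Longrightarrow> f (x + h) - f x = L h"
    and "normed_subspace E" "normed_subspace F"
  shows "has_frechet_derivative E F f L x"
proof -
  interpret E: normed_subspace E by fact
  interpret F: normed_subspace F by fact
  show ?thesis
    unfolding has_frechet_derivative_def
    using assms(1,2) bounded_linear_map_mem[OF assms(1)]
    by (auto simp: F.nrm_0 E.nrm_nonneg intro!: exI[of _ 1])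
qed

lemma has_frechet_derivative_add_scaleR:
  assumes f: "has_frechet_derivative E F f L x" and g: "has_frechet_derivative E F g M x"
    and E: "normed_subspace E" and F: "normed_subspace F"
  shows "has_frechet_derivative E F (\<lambda>x. f x + c *\<^sub>R g x) (\<lambda>h. L h + c *\<^sub>R M h) x"
  unfolding has_frechet_derivative_def
proof (intro conjI allI impI)
  interpret E: normed_subspace E by fact
  interpret F: normed_subspace F by fact
  have L: "bounded_linear_map E F L" and M: "bounded_linear_map E F M"
    using f g by (auto simp: has_frechet_derivative_def)
  show "bounded_linear_map E F (\<lambda>h. L h + c *\<^sub>R M h)"
    by (rule bounded_linear_map_add_scaleR[OF L M E F])
  fix e :: real assume e: "e > 0"
  \<comment> \<open>Each summand gets half of \<open>e\<close>; the \<open>+ 1\<close> keeps the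
    denominator positive when \<open>c = 0\<close>.\<close>
  then have e': "e/2 > 0" "e / (2 * (\<bar>c\<bar> + 1)) > 0" by (auto intro!: divide_pos_pos add_nonneg_pos)
  obtain d1 where d1: "d1 > 0" "\<And>h. h \<in> vecs E \<Longrightarrow> nrm E h < d1 \<Longrightarrow>
      f (x + h) - f x \<in> vecs F \<and> nrm F (f (x + h) - f x - L h) \<le> e/2 * nrm E h"
    using f e' unfolding has_frechet_derivative_def by blast
  obtain d2 where d2: "d2 > 0" "\<And>h. h \<in> vecs E \<Longrightarrow> nrm E h < d2 \<Longrightarrow>
      g (x + h) - g x \<in> vecs F \<and>
      nrm F (g (x + h) - g x - M h) \<le> e / (2 * (\<bar>c\<bar> + 1)) * nrm E h"
    using g e' unfolding has_frechet_derivative_def by blast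
  show "\<exists>d>0. \<forall>h\<in>vecs E. nrm E h < d \<longrightarrow>
      f (x + h) + c *\<^sub>R g (x + h) - (f x + c *\<^sub>R g x) \<in> vecs F \<and>
      nrm F (f (x + h) + c *\<^sub>R g (x + h) - (f x + c *\<^sub>R g x) - (L h + c *\<^sub>R M h)) \<le> e * nrm E h"
  proof (intro exI[of _ "min d1 d2"] conjI ballI impI)
    fix h assume h: "h \<in> vecs E" "nrm E h < min d1 d2"
    note a = d1(2)[of h] d2(2)[of h]
    have eq: "f (x + h) + c *\<^sub>R g (x + h) - (f x + c *\<^sub>R g x) =
        (f (x + h) - f x) + c *\<^sub>R (g (x + h) - g x)"
      by (simp add: algebra_simps)
    show "f (x + h) + c *\<^sub>R g (x + h) - (f x + c *\<^sub>R g x) \<in> vecs F"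
      unfolding eq using a h by (auto intro!: F.mem_add F.mem_scaleR)
    have m: "f (x + h) - f x - L h \<in> vecs F" "g (x + h) - g x - M h \<in> vecs F"
      using a h bounded_linear_map_mem[OF L h(1)] bounded_linear_map_mem[OF M h(1)]
      by (auto intro!: F.mem_diff)
    have eq2: "f (x + h) + c *\<^sub>R g (x + h) - (f x + c *\<^sub>R g x) - (L h + c *\<^sub>R M h) =
        (f (x + h) - f x - L h) + c *\<^sub>R (g (x + h) - g x - M h)"
      by (simp add: algebra_simps)
    have "\<bar>c\<bar> * (e / (2 * (\<bar>c\<bar> + 1)) * nrm E h) \<le> e/2 * nrm E h"
    proof -
      have "\<bar>c\<bar> * (e / (2 * (\<bar>c\<bar> + 1))) \<le> e/2" using e by (simp add: field_simps)
      from mult_right_mono[OF this E.nrm_nonneg[of h]] show ?thesis by (simp add: mult.assoc)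
    qed
    moreover have "\<bar>c\<bar> * nrm F (g (x + h) - g x - M h) \<le> \<bar>c\<bar> * (e / (2 * (\<bar>c\<bar> + 1)) * nrm E h)"
      using a h by (intro mult_left_mono) auto
    ultimately have "\<bar>c\<bar> * nrm F (g (x + h) - g x - M h) \<le> e/2 * nrm E h" by linarith
    then show "nrm F (f (x + h) + c *\<^sub>R g (x + h) - (f x + c *\<^sub>R g x) - (L h + c *\<^sub>R M h)) \<le> e * nrm E h"
      unfolding eq2
      using F.nrm_triangle[OF m(1) F.mem_scaleR[OF m(2), of c]] F.nrm_scaleR[OF m(2), of c] a h
      by (auto simp: field_simps)
  qed (use d1 d2 in auto)
qed

lemma has_frechet_derivative_chain:
  assumes f: "has_frechet_derivative E F f L x" and g: "has_frechet_derivative F H g M (f x)"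
    and E: "normed_subspace E" and F: "normed_subspace F" and H: "normed_subspace H"
  shows "has_frechet_derivative E H (\<lambda>x. g (f x)) (\<lambda>h. M (L h)) x"
  unfolding has_frechet_derivative_def
proof (intro conjI allI impI)
  interpret E: normed_subspace E by fact
  interpret F: normed_subspace F by fact
  interpret H: normed_subspace H by fact
  have L: "bounded_linear_map E F L" and M: "bounded_linear_map F H M"
    using f g by (auto simp: has_frechet_derivative_def)
  show "bounded_linear_map E H (\<lambda>h. M (L h))"
    by (rule bounded_linear_map_compose[OF L M E F])
  fix e :: real assume e: "e > 0"
  obtain C where C: "C \<ge> 0" "\<And>h. h \<in> vecs E \<Longrightarrow> nrm F (L h) \<le> C * nrm E h"
    using bounded_linear_map_bound[OF L E] by blast
  obtain B where B: "B \<ge> 0" "\<And>h. h \<in> vecs F \<Longrightarrow> nrm H (M h) \<le> B * nrm F h"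
    using bounded_linear_map_bound[OF M F] by blast
  \<comment> \<open>\<open>e1\<close> is the tolerance of the outer remainder, which sees an
    increment of norm at most \<open>(C + 1) * nrm E h\<close>. For the inner remainder,
    \<open>e2 \<le> 1\<close> yields that bound, and \<open>B * e2 \<le> e/2\<close> controls its
    image under \<open>M\<close>.\<close>
  define e1 where "e1 = e / (2 * (C + 1))"
  define e2 where "e2 = min 1 (e / (2 * (B + 1)))"
  have e1: "e1 > 0" "e1 * (C + 1) = e/2" using e C by (auto simp: e1_def field_simps)
  have e2: "e2 > 0" "e2 \<le> 1" using e B by (auto simp: e2_def)
  have e2B: "B * e2 \<le> e/2"
  proof -
    have "B * e2 \<le> B * (e / (2 * (B + 1)))" using B by (intro mult_left_mono) (auto simp: e2_def)
    also have "\<dots> \<le> e/2" using e B by (simp add: field_simps)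
    finally show ?thesis .
  qed
  obtain d1 where d1: "d1 > 0" "\<And>k. k \<in> vecs F \<Longrightarrow> nrm F k < d1 \<Longrightarrow>
      g (f x + k) - g (f x) \<in> vecs H \<and> nrm H (g (f x + k) - g (f x) - M k) \<le> e1 * nrm F k"
    using g e1 unfolding has_frechet_derivative_def by blast
  obtain d2 where d2: "d2 > 0" "\<And>h. h \<in> vecs E \<Longrightarrow> nrm E h < d2 \<Longrightarrow>
      f (x + h) - f x \<in> vecs F \<and> nrm F (f (x + h) - f x - L h) \<le> e2 * nrm E h"
    using f e2 unfolding has_frechet_derivative_def by blast
  show "\<exists>d>0. \<forall>h\<in>vecs E. nrm E h < d \<longrightarrow> g (f (x + h)) - g (f x) \<in> vecs H \<and>
      nrm H (g (f (x + h)) - g (f x) - M (L h)) \<le> e * nrm E h"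
  proof (intro exI[of _ "min d2 (d1 / (C + 1))"] conjI ballI impI)
    fix h assume h: "h \<in> vecs E" "nrm E h < min d2 (d1 / (C + 1))"
    define k where "k = f (x + h) - f x"
    have k: "k \<in> vecs F" "nrm F (k - L h) \<le> e2 * nrm E h"
      using d2(2)[of h] h by (auto simp: k_def)
    have fxh: "f (x + h) = f x + k" by (simp add: k_def)
    have Lh: "L h \<in> vecs F" by (rule bounded_linear_map_mem[OF L h(1)])
    have "nrm F k \<le> nrm F (k - L h) + nrm F (L h)"
      using F.nrm_triangle[OF F.mem_diff[OF k(1) Lh] Lh] by simp
    also have "\<dots> \<le> 1 * nrm E h + C * nrm E h"
      using k(2) C(2)[OF h(1)] mult_right_mono[OF e2(2) E.nrm_nonneg[of h]] by linarith
    finally have nk: "nrm F k \<le> (C + 1) * nrm E h" by (simp add: algebra_simps)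
    also have "\<dots> < d1" using h C by (simp add: field_simps)
    finally have gk: "g (f x + k) - g (f x) \<in> vecs H"
        "nrm H (g (f x + k) - g (f x) - M k) \<le> e1 * nrm F k"
      using d1(2)[OF k(1)] by auto
    show "g (f (x + h)) - g (f x) \<in> vecs H" using gk by (simp add: fxh)
    have Mk: "M k \<in> vecs H" "M (L h) \<in> vecs H"
      using bounded_linear_map_mem[OF M] k Lh by auto
    have "nrm H (M k - M (L h)) \<le> B * (e2 * nrm E h)"
      using B(2)[OF F.mem_diff[OF k(1) Lh]] mult_left_mono[OF k(2) B(1)]
        bounded_linear_map_diff[OF M k(1) Lh] by simp
    also have "\<dots> \<le> e/2 * nrm E h"
      using mult_right_mono[OF e2B E.nrm_nonneg[of h]] by (simp add: mult.assoc)
    finally have 1: "nrm H (M k - M (L h)) \<le> e/2 * nrm E h" .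
    have "e1 * nrm F k \<le> e1 * ((C + 1) * nrm E h)" using nk e1 by (intro mult_left_mono) auto
    also have "\<dots> = e/2 * nrm E h" using e1(2) by (metis mult.assoc)
    finally have 2: "nrm H (g (f x + k) - g (f x) - M k) \<le> e/2 * nrm E h" using gk by linarith
    have "nrm H ((g (f x + k) - g (f x) - M k) + (M k - M (L h))) \<le> e * nrm E h"
      using H.nrm_triangle[OF H.mem_diff[OF gk(1) Mk(1)] H.mem_diff[OF Mk]] 1 2 by linarith
    then show "nrm H (g (f (x + h)) - g (f x) - M (L h)) \<le> e * nrm E h" by (simp add: fxh)
  qed (use d1 d2 C in auto)
qed

section \<open>Product spaces\<close>

lemma vecs_prod_space: "vecs (prod_space E F) = vecs E \<times> vecs F"
  and nrm_prod_space: "nrm (prod_space E F) (u, v) = sqrt ((nrm E u)\<^sup>2 + (nrm F v)\<^sup>2)"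
  by (simp_all add: prod_space_def)

lemma normed_subspace_prod_space:
  assumes "normed_subspace E" "normed_subspace F"
  shows "normed_subspace (prod_space E F)"
proof -
  interpret E: normed_subspace E by fact
  interpret F: normed_subspace F by fact
  show ?thesis
  proof
    show "subspace (vecs (prod_space E F))"
      by (simp add: vecs_prod_space subspace_Times E.subspace F.subspace)
    show "0 \<le> nrm (prod_space E F) x" for x
      by (cases x) (simp add: nrm_prod_space)
    fix x y assume xy: "x \<in> vecs (prod_space E F)" "y \<in> vecs (prod_space E F)"
    obtain a b c d where [simp]: "x = (a, b)" "y = (c, d)" by (cases x; cases y)
    have m: "a \<in> vecs E" "c \<in> vecs E" "b \<in> vecs F" "d \<in> vecs F"
      using xy by (auto simp: vecs_prod_space)
    have "sqrt ((nrm E (a + c))\<^sup>2 + (nrm F (b + d))\<^sup>2)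
        \<le> sqrt ((nrm E a + nrm E c)\<^sup>2 + (nrm F b + nrm F d)\<^sup>2)"
      using m by (intro real_sqrt_le_mono add_mono power_mono E.nrm_triangle F.nrm_triangle
          E.nrm_nonneg F.nrm_nonneg)
    also have "\<dots> \<le> sqrt ((nrm E a)\<^sup>2 + (nrm F b)\<^sup>2) + sqrt ((nrm E c)\<^sup>2 + (nrm F d)\<^sup>2)"
      by (rule real_sqrt_sum_squares_triangle_ineq)
    finally show "nrm (prod_space E F) (x + y) \<le> nrm (prod_space E F) x + nrm (prod_space E F) y"
      by (simp add: nrm_prod_space)
  next
    fix x c assume "x \<in> vecs (prod_space E F)"
    then show "nrm (prod_space E F) (c *\<^sub>R x) = \<bar>c\<bar> * nrm (prod_space E F) x"
      by (cases x) (simp add: nrm_prod_space vecs_prod_space E.nrm_scaleR F.nrm_scaleR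
          power_mult_distrib real_sqrt_mult flip: distrib_left)
  qed
qed

lemma nrm_fst_le: "normed_subspace F \<Longrightarrow> nrm E u \<le> nrm (prod_space E F) (u, v)"
  and nrm_snd_le: "normed_subspace E \<Longrightarrow> nrm F v \<le> nrm (prod_space E F) (u, v)"
  by (auto simp: nrm_prod_space intro!: real_le_rsqrt)

lemma nrm_prod_space_le:
  assumes "normed_subspace E" "normed_subspace F"
  shows "nrm (prod_space E F) (u, v) \<le> nrm E u + nrm F v"
  using assms
  by (auto simp: nrm_prod_space normed_subspace.nrm_nonneg intro!: sqrt_sum_squares_le_sum)

lemma bounded_linear_map_fst: "normed_subspace F \<Longrightarrow> bounded_linear_map (prod_space E F) E fst"
  and bounded_linear_map_snd: "normed_subspace E \<Longrightarrow> bounded_linear_map (prod_space E F) F snd"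
  unfolding bounded_linear_map_def
  by (auto simp: vecs_prod_space nrm_fst_le nrm_snd_le intro!: exI[of _ 1])

subsection \<open>Smooth maps\<close>

text \<open>The witness condition of \<open>smooth_on_open\<close>, named so that families of
  derivatives can be transformed explicitly.\<close>

definition derivative_family ::
    "('a::real_vector) normed_sub \<Rightarrow> ('b::real_vector) normed_sub \<Rightarrow> 'a set \<Rightarrow>
      ('a \<Rightarrow> 'b) \<Rightarrow> ('a \<Rightarrow> 'a list \<Rightarrow> 'b) \<Rightarrow> bool" where
  "derivative_family E F W f D \<longleftrightarrow>
        (\<forall>x\<in>W. D x [] = f x) \<and>
        (\<forall>x\<in>W. \<forall>k\<ge>1. bounded_multilinear_map E F k (D x)) \<and>
        (\<forall>x\<in>W. \<forall>k. \<forall>e>0. \<exists>d>0. \<forall>h\<in>vecs E. nrm E h < d \<longrightarrow>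
           (\<forall>hs. length hs = k \<and> set hs \<subseteq> vecs E \<longrightarrow>
              D (x + h) hs - D x hs \<in> vecs F \<and>
              nrm F (D (x + h) hs - D x hs - D x (h # hs))
                \<le> e * nrm E h * prod_list (map (nrm E) hs)))"

lemma smooth_on_open_iff:
  "smooth_on_open E F W f \<longleftrightarrow> open_in E W \<and> (\<exists>D. derivative_family E F W f D)"
  by (simp add: smooth_on_open_def derivative_family_def)

lemma prod_list_nonneg_nrm:
  "normed_subspace E \<Longrightarrow> 0 \<le> prod_list (map (nrm E) hs)"
  by (induction hs) (auto simp: normed_subspace.nrm_nonneg)

text \<open>A bounded linear map commutes with differentiation, so it is applied to every
  derivative. The link between \<open>f\<close> and \<open>g\<close> is through increments because
  \<open>g\<close> may take values in an affine space: the inverse of \<open>Phi\<close> produces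
  lifts x + u(x), whose identity part cancels in differences.\<close>

lemma smooth_on_open_affine_compose:
  assumes f: "smooth_on_open E F W f" and L: "bounded_linear_map F H L"
    and g: "\<And>x y. x \<in> W \<Longrightarrow> y \<in> W \<Longrightarrow> f y - f x \<in> vecs F \<Longrightarrow> g y - g x = L (f y - f x)"
    and E: "normed_subspace E" and F: "normed_subspace F" and H: "normed_subspace H"
  shows "smooth_on_open E H W g"
proof -
  interpret E: normed_subspace E by fact
  interpret F: normed_subspace F by fact
  interpret H: normed_subspace H by fact
  obtain D where op: "open_in E W" and D: "derivative_family E F W f D"
    using f by (auto simp: smooth_on_open_iff)
  have D0: "D x [] = f x" if "x \<in> W" for x using D that by (auto simp: derivative_family_def)
  have bm: "bounded_multilinear_map E F k (D x)" if "x \<in> W" "k \<ge> 1" for x k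
    using D that by (auto simp: derivative_family_def)
  obtain C where C: "C \<ge> 0" "\<And>h. h \<in> vecs F \<Longrightarrow> nrm H (L h) \<le> C * nrm F h"
    using bounded_linear_map_bound[OF L F] by blast
  \<comment> \<open>Order zero is \<open>g\<close> itself, since \<open>f x\<close> need not lie in
    \<open>F\<close>; from order one on the derivatives do lie in \<open>F\<close> and
    \<open>L\<close> applies.\<close>
  define D' where "D' x hs = (if hs = [] then g x else L (D x hs))" for x hs
  have "derivative_family E H W g D'"
    unfolding derivative_family_def
  proof (intro conjI ballI allI impI)
    show "D' x [] = g x" for x by (simp add: D'_def)
  next
    fix x and k :: nat assume x: "x \<in> W" and k: "1 \<le> k"
    note bm = bm[OF x k, unfolded bounded_multilinear_map_def]
    have eq: "D' x hs = L (D x hs)" if "length hs = k" for hs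
      using that k by (auto simp: D'_def)
    show "bounded_multilinear_map E H k (D' x)"
      unfolding bounded_multilinear_map_def
    proof (intro conjI allI impI ballI)
      show "D' x hs \<in> vecs H" if "length hs = k \<and> set hs \<subseteq> vecs E" for hs
        using bm that bounded_linear_map_mem[OF L] by (auto simp: eq)
    next
      fix hs i a b c assume *: "length hs = k \<and> set hs \<subseteq> vecs E" "i < k" "a \<in> vecs E" "b \<in> vecs E"
      have "set (hs[i := a]) \<subseteq> vecs E" "set (hs[i := b]) \<subseteq> vecs E"
        using * set_update_subset_insert[of hs i] by blast+
      then have "D x (hs[i := a]) \<in> vecs F" "D x (hs[i := b]) \<in> vecs F"
        using conjunct1[OF bm] * by auto
      moreover have "D x (hs[i := a + c *\<^sub>R b]) = D x (hs[i := a]) + c *\<^sub>R D x (hs[i := b])"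
        using bm * by blast
      ultimately show "D' x (hs[i := a + c *\<^sub>R b]) = D' x (hs[i := a]) + c *\<^sub>R D' x (hs[i := b])"
        using * L by (simp add: eq bounded_linear_map_def)
    next
      obtain B where B: "\<And>hs. length hs = k \<and> set hs \<subseteq> vecs E \<Longrightarrow>
          nrm F (D x hs) \<le> B * prod_list (map (nrm E) hs)" using bm by blast
      show "\<exists>B. \<forall>hs. length hs = k \<and> set hs \<subseteq> vecs E \<longrightarrow>
          nrm H (D' x hs) \<le> B * prod_list (map (nrm E) hs)"
      proof (intro exI[of _ "C * B"] allI impI)
        fix hs assume *: "length hs = k \<and> set hs \<subseteq> vecs E"
        have "nrm H (D' x hs) \<le> C * nrm F (D x hs)" using C(2)[of "D x hs"] bm * by (auto simp: eq)
        also have "\<dots> \<le> C * (B * prod_list (map (nrm E) hs))"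
          using B[OF *] C(1) by (rule mult_left_mono)
        finally show "nrm H (D' x hs) \<le> C * B * prod_list (map (nrm E) hs)" by (simp add: mult.assoc)
      qed
    qed
  next
    fix x and k :: nat and e :: real assume x: "x \<in> W" and e: "e > 0"
    define e' where "e' = e / (C + 1)"
    have e': "e' > 0" "C * e' \<le> e" using C(1) e by (auto simp: e'_def field_simps)
    obtain d1 where d1: "d1 > 0" "\<And>h. h \<in> vecs E \<Longrightarrow> nrm E h < d1 \<Longrightarrow> x + h \<in> W"
      using op x unfolding open_in_def by blast
    have "\<exists>d>0. \<forall>h\<in>vecs E. nrm E h < d \<longrightarrow>
           (\<forall>hs. length hs = k \<and> set hs \<subseteq> vecs E \<longrightarrow>
              D (x + h) hs - D x hs \<in> vecs F \<and>
              nrm F (D (x + h) hs - D x hs - D x (h # hs))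
                \<le> e' * nrm E h * prod_list (map (nrm E) hs))"
      using D x e'(1) unfolding derivative_family_def by blast
    then obtain d2 where d2: "d2 > 0" "\<And>h hs. h \<in> vecs E \<Longrightarrow> nrm E h < d2 \<Longrightarrow>
        length hs = k \<Longrightarrow> set hs \<subseteq> vecs E \<Longrightarrow> D (x + h) hs - D x hs \<in> vecs F \<and>
              nrm F (D (x + h) hs - D x hs - D x (h # hs))
                \<le> e' * nrm E h * prod_list (map (nrm E) hs)" by blast
    show "\<exists>d>0. \<forall>h\<in>vecs E. nrm E h < d \<longrightarrow>
           (\<forall>hs. length hs = k \<and> set hs \<subseteq> vecs E \<longrightarrow>
              D' (x + h) hs - D' x hs \<in> vecs H \<and>
              nrm H (D' (x + h) hs - D' x hs - D' x (h # hs))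
                \<le> e * nrm E h * prod_list (map (nrm E) hs))"
    proof (intro exI[of _ "min d1 d2"] ballI impI allI conjI[of "_ < _"])
      fix h hs assume h: "h \<in> vecs E" "nrm E h < min d1 d2" and hs: "length hs = k \<and> set hs \<subseteq> vecs E"
      have xh: "x + h \<in> W" using d1 h by auto
      have dm: "D (x + h) hs - D x hs \<in> vecs F"
        and dn: "nrm F (D (x + h) hs - D x hs - D x (h # hs)) \<le> e' * nrm E h * prod_list (map (nrm E) hs)"
        using d2(2)[of h hs] h hs by auto
      have d1m: "D x (h # hs) \<in> vecs F"
        using bm[OF x, of "Suc k"] h hs by (auto simp: bounded_multilinear_map_def)
      have eq: "D' (x + h) hs - D' x hs = L (D (x + h) hs - D x hs)"
      proof (cases "hs = []")
        case True
        then show ?thesis using g[OF x xh] dm by (simp add: D'_def D0 x xh)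
      next
        case False
        then have "D (x + h) hs \<in> vecs F" "D x hs \<in> vecs F"
          using bm[OF x, of k] bm[OF xh, of k] hs
          by (auto simp: bounded_multilinear_map_def Suc_le_eq)
        then show ?thesis using False by (simp add: D'_def bounded_linear_map_diff[OF L])
      qed
      have "D' (x + h) hs - D' x hs - D' x (h # hs) = L (D (x + h) hs - D x hs - D x (h # hs))"
        using bounded_linear_map_diff[OF L dm d1m] by (simp add: eq) (simp add: D'_def)
      then have "nrm H (D' (x + h) hs - D' x hs - D' x (h # hs)) \<le>
          C * nrm F (D (x + h) hs - D x hs - D x (h # hs))"
        using C(2)[OF F.mem_diff[OF dm d1m]] by simp
      also have "\<dots> \<le> C * (e' * nrm E h * prod_list (map (nrm E) hs))"
        using dn C(1) by (rule mult_left_mono)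
      also have "\<dots> \<le> e * (nrm E h * prod_list (map (nrm E) hs))"
        using mult_right_mono[OF e'(2), of "nrm E h * prod_list (map (nrm E) hs)"]
          E.nrm_nonneg[of h] prod_list_nonneg_nrm[OF E, of hs] by (simp add: mult.assoc)
      finally show "D' (x + h) hs - D' x hs \<in> vecs H \<and>
          nrm H (D' (x + h) hs - D' x hs - D' x (h # hs)) \<le> e * nrm E h * prod_list (map (nrm E) hs)"
        using bounded_linear_map_mem[OF L dm] eq by (simp add: mult.assoc)
    qed (use d1 d2 in auto)
  qed
  then show ?thesis using op by (auto simp: smooth_on_open_iff)
qed

lemma smooth_on_open_Pair:
  assumes f: "smooth_on_open E F W f" and g: "smooth_on_open E H W g"
    and E: "normed_subspace E" and F: "normed_subspace F" and H: "normed_subspace H"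
  shows "smooth_on_open E (prod_space F H) W (\<lambda>x. (f x, g x))"
proof -
  obtain D where op: "open_in E W" and D: "derivative_family E F W f D"
    using f by (auto simp: smooth_on_open_iff)
  obtain D' where D': "derivative_family E H W g D'"
    using g by (auto simp: smooth_on_open_iff)
  have bm: "bounded_multilinear_map E F k (D x)" "bounded_multilinear_map E H k (D' x)"
    if "x \<in> W" "k \<ge> 1" for x k
    using D D' that by (auto simp: derivative_family_def)
  interpret E: normed_subspace E by fact
  have "derivative_family E (prod_space F H) W (\<lambda>x. (f x, g x)) (\<lambda>x hs. (D x hs, D' x hs))"
    unfolding derivative_family_def
  proof (intro conjI ballI allI impI)
    show "(D x [], D' x []) = (f x, g x)" if "x \<in> W" for x
      using D D' that by (auto simp: derivative_family_def)
  next
    fix x and k :: nat assume x: "x \<in> W" and k: "1 \<le> k"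
    note bm = bm[OF x k, unfolded bounded_multilinear_map_def]
    show "bounded_multilinear_map E (prod_space F H) k (\<lambda>hs. (D x hs, D' x hs))"
      unfolding bounded_multilinear_map_def
    proof (intro conjI allI impI ballI)
      show "(D x hs, D' x hs) \<in> vecs (prod_space F H)" if "length hs = k \<and> set hs \<subseteq> vecs E" for hs
        using bm that by (auto simp: vecs_prod_space)
    next
      fix hs i a b c assume *: "length hs = k \<and> set hs \<subseteq> vecs E" "i < k" "a \<in> vecs E" "b \<in> vecs E"
      have "D x (hs[i := a + c *\<^sub>R b]) = D x (hs[i := a]) + c *\<^sub>R D x (hs[i := b])"
        "D' x (hs[i := a + c *\<^sub>R b]) = D' x (hs[i := a]) + c *\<^sub>R D' x (hs[i := b])"
        using bm * by blast+
      then show "(D x (hs[i := a + c *\<^sub>R b]), D' x (hs[i := a + c *\<^sub>R b])) =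
          (D x (hs[i := a]), D' x (hs[i := a])) + c *\<^sub>R (D x (hs[i := b]), D' x (hs[i := b]))"
        by simp
    next
      obtain B where B: "\<And>hs. length hs = k \<and> set hs \<subseteq> vecs E \<Longrightarrow>
          nrm F (D x hs) \<le> B * prod_list (map (nrm E) hs)" using bm(1) by blast
      obtain B' where B': "\<And>hs. length hs = k \<and> set hs \<subseteq> vecs E \<Longrightarrow>
          nrm H (D' x hs) \<le> B' * prod_list (map (nrm E) hs)" using bm(2) by blast
      show "\<exists>C. \<forall>hs. length hs = k \<and> set hs \<subseteq> vecs E \<longrightarrow>
          nrm (prod_space F H) (D x hs, D' x hs) \<le> C * prod_list (map (nrm E) hs)"
      proof (intro exI[of _ "B + B'"] allI impI)
        fix hs assume *: "length hs = k \<and> set hs \<subseteq> vecs E"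
        show "nrm (prod_space F H) (D x hs, D' x hs) \<le> (B + B') * prod_list (map (nrm E) hs)"
          using nrm_prod_space_le[OF F H, of "D x hs" "D' x hs"] B[OF *] B'[OF *]
          by (simp add: algebra_simps)
      qed
    qed
  next
    fix x and k :: nat and e :: real assume x: "x \<in> W" and e: "e > 0"
    then have e': "e/2 > 0" by simp
    have "\<exists>d>0. \<forall>h\<in>vecs E. nrm E h < d \<longrightarrow>
           (\<forall>hs. length hs = k \<and> set hs \<subseteq> vecs E \<longrightarrow>
              D (x + h) hs - D x hs \<in> vecs F \<and>
              nrm F (D (x + h) hs - D x hs - D x (h # hs))
                \<le> e/2 * nrm E h * prod_list (map (nrm E) hs))"
      using D x e' unfolding derivative_family_def by blast
    then obtain d1 where d1: "d1 > 0" "\<And>h hs. h \<in> vecs E \<Longrightarrow> nrm E h < d1 \<Longrightarrow>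
        length hs = k \<Longrightarrow> set hs \<subseteq> vecs E \<Longrightarrow> D (x + h) hs - D x hs \<in> vecs F \<and>
              nrm F (D (x + h) hs - D x hs - D x (h # hs))
                \<le> e/2 * nrm E h * prod_list (map (nrm E) hs)" by blast
    have "\<exists>d>0. \<forall>h\<in>vecs E. nrm E h < d \<longrightarrow>
           (\<forall>hs. length hs = k \<and> set hs \<subseteq> vecs E \<longrightarrow>
              D' (x + h) hs - D' x hs \<in> vecs H \<and>
              nrm H (D' (x + h) hs - D' x hs - D' x (h # hs))
                \<le> e/2 * nrm E h * prod_list (map (nrm E) hs))"
      using D' x e' unfolding derivative_family_def by blast
    then obtain d2 where d2: "d2 > 0" "\<And>h hs. h \<in> vecs E \<Longrightarrow> nrm E h < d2 \<Longrightarrow>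
        length hs = k \<Longrightarrow> set hs \<subseteq> vecs E \<Longrightarrow> D' (x + h) hs - D' x hs \<in> vecs H \<and>
              nrm H (D' (x + h) hs - D' x hs - D' x (h # hs))
                \<le> e/2 * nrm E h * prod_list (map (nrm E) hs)" by blast
    show "\<exists>d>0. \<forall>h\<in>vecs E. nrm E h < d \<longrightarrow>
           (\<forall>hs. length hs = k \<and> set hs \<subseteq> vecs E \<longrightarrow>
              (D (x + h) hs, D' (x + h) hs) - (D x hs, D' x hs) \<in> vecs (prod_space F H) \<and>
              nrm (prod_space F H) ((D (x + h) hs, D' (x + h) hs) - (D x hs, D' x hs) -
                  (D x (h # hs), D' x (h # hs)))
                \<le> e * nrm E h * prod_list (map (nrm E) hs))"
    proof (intro exI[of _ "min d1 d2"] ballI impI allI conjI[of "_ < _"])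
      fix h hs assume h: "h \<in> vecs E" "nrm E h < min d1 d2" and hs: "length hs = k \<and> set hs \<subseteq> vecs E"
      show "(D (x + h) hs, D' (x + h) hs) - (D x hs, D' x hs) \<in> vecs (prod_space F H) \<and>
              nrm (prod_space F H) ((D (x + h) hs, D' (x + h) hs) - (D x hs, D' x hs) -
                  (D x (h # hs), D' x (h # hs)))
                \<le> e * nrm E h * prod_list (map (nrm E) hs)"
        using d1(2)[of h hs] d2(2)[of h hs] h hs
          nrm_prod_space_le[OF F H, of "D (x + h) hs - D x hs - D x (h # hs)"
            "D' (x + h) hs - D' x hs - D' x (h # hs)"]
        by (auto simp: vecs_prod_space)
    qed (use d1 d2 in auto)
  qed
  then show ?thesis using op by (auto simp: smooth_on_open_iff)
qed

subsection \<open>Banach algebras of functions\<close>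

text \<open>Completeness appears as the convergence of absolutely summable series, with the
  pointwise sum as the limit, which is the form in which power series use it. One constant
  \<open>K\<close> serves both for the product and for the embedding into bounded functions.\<close>

locale function_algebra = normed_subspace A for A :: "('x \<Rightarrow> real) normed_sub" +
  fixes K :: real
  assumes K_ge_1: "1 \<le> K"
    and one_mem: "1 \<in> vecs A"
    and mem_mult: "f \<in> vecs A \<Longrightarrow> g \<in> vecs A \<Longrightarrow> f * g \<in> vecs A"
    and nrm_mult: "f \<in> vecs A \<Longrightarrow> g \<in> vecs A \<Longrightarrow> nrm A (f * g) \<le> K * nrm A f * nrm A g"
    and abs_le_nrm: "f \<in> vecs A \<Longrightarrow> \<bar>f x\<bar> \<le> K * nrm A f"
    and series_mem: "(\<And>k::nat. F k \<in> vecs A) \<Longrightarrow> summable (\<lambda>k. nrm A (F k)) \<Longrightarrow>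
      (\<lambda>x. \<Sum>k. F k x) \<in> vecs A"
    and nrm_series: "(\<And>k::nat. F k \<in> vecs A) \<Longrightarrow> summable (\<lambda>k. nrm A (F k)) \<Longrightarrow>
      nrm A (\<lambda>x. \<Sum>k. F k x) \<le> (\<Sum>k. nrm A (F k))"
begin

lemma normed_subspace_A: "normed_subspace A" ..

section \<open>Powers and power series\<close>

lemma mem_power: "f \<in> vecs A \<Longrightarrow> f ^ k \<in> vecs A"
  by (induction k) (auto simp: one_mem mem_mult)

text \<open>Stated for successors because k + 1 factors cost only k multiplications, and the power 0
  would bring in the norm of 1, on which no upper bound is assumed.\<close>

lemma nrm_power_Suc: "f \<in> vecs A \<Longrightarrow> nrm A (f ^ Suc k) \<le> K ^ k * nrm A f ^ Suc k"
proof (induction k)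
  case (Suc k)
  have "nrm A (f ^ Suc (Suc k)) \<le> K * nrm A f * nrm A (f ^ Suc k)"
    using nrm_mult[OF Suc.prems mem_power[OF Suc.prems, of "Suc k"]] by (simp only: power_Suc)
  also have "\<dots> \<le> K * nrm A f * (K ^ k * nrm A f ^ Suc k)"
    using K_ge_1 nrm_nonneg by (intro mult_left_mono Suc.IH Suc.prems) auto
  also have "\<dots> = K ^ Suc k * nrm A f ^ Suc (Suc k)" by (simp add: mult_ac)
  finally show ?case .
qed auto

lemma power_fun_apply: "(f ^ k) x = (f x :: real) ^ k"
  by (induction k) auto

lemma bounded_linear_map_mult:
  assumes f: "f \<in> vecs A"
  shows "bounded_linear_map A A (\<lambda>h. f * h)"
  unfolding bounded_linear_map_def
proof (intro conjI ballI allI exI)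
  show "nrm A (f * h) \<le> (K * nrm A f) * nrm A h" if "h \<in> vecs A" for h
    using nrm_mult[OF f that] .
  show "f * (h + c *\<^sub>R k) = f * h + c *\<^sub>R (f * k)" for h k c
    by (simp add: fun_eq_iff scaleR_fun_def algebra_simps)
qed (simp add: mem_mult f)

text \<open>The k-th term is at most \<open>K * (nrm A g)\<^sup>2 * (1/2) ^ k\<close>, a geometric
  series with sum factor 2. Starting at the power 2 makes the remainder quadratic in
  \<open>g\<close>, which is what the Frechet derivatives of \<open>exp\<close> and
  \<open>ln\<close> require.\<close>

lemma power_series_remainder:
  assumes g: "g \<in> vecs A" "K * nrm A g \<le> 1/2" and c: "\<And>k. \<bar>c k\<bar> \<le> 1"
  defines "R \<equiv> (\<lambda>x. \<Sum>k. c k * g x ^ (k + 2))"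
  shows "R \<in> vecs A" "nrm A R \<le> 2 * K * (nrm A g)\<^sup>2"
    and "summable (\<lambda>k. c k * g x ^ (k + 2))"
proof -
  define F where "F k = c k *\<^sub>R g ^ (k + 2)" for k
  have F_mem: "F k \<in> vecs A" for k
    unfolding F_def by (intro mem_scaleR mem_power g)
  have F_bound: "nrm A (F k) \<le> K * (nrm A g)\<^sup>2 * (1/2) ^ k" for k
  proof -
    have "nrm A (F k) \<le> 1 * nrm A (g ^ (k + 2))"
      unfolding F_def nrm_scaleR[OF mem_power[OF g(1)]] by (rule mult_right_mono[OF c nrm_nonneg])
    also have "\<dots> \<le> K ^ Suc k * nrm A g ^ (k + 2)"
      using nrm_power_Suc[OF g(1), of "Suc k"] by simp
    also have "\<dots> = K * (nrm A g)\<^sup>2 * (K * nrm A g) ^ k"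
      by (simp add: power_mult_distrib power2_eq_square power_add)
    also have "\<dots> \<le> K * (nrm A g)\<^sup>2 * (1/2) ^ k"
      using g K_ge_1 nrm_nonneg by (intro mult_left_mono power_mono) auto
    finally show ?thesis .
  qed
  have geo: "summable (\<lambda>k. K * (nrm A g)\<^sup>2 * (1/2) ^ k)"
    by (intro summable_mult summable_geometric) auto
  have sF: "summable (\<lambda>k. nrm A (F k))"
    by (rule summable_comparison_test_ev[OF always_eventually geo]) (use F_bound nrm_nonneg in auto)
  have FR: "(\<lambda>x. \<Sum>k. F k x) = R"
    by (simp add: F_def R_def scaleR_fun_def power_fun_apply)
  show "R \<in> vecs A" using series_mem[OF F_mem sF] by (simp add: FR)
  have "nrm A R \<le> (\<Sum>k. nrm A (F k))" using nrm_series[OF F_mem sF] by (simp add: FR)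
  also have "\<dots> \<le> (\<Sum>k. K * (nrm A g)\<^sup>2 * (1/2) ^ k)"
    by (intro suminf_le F_bound sF geo)
  also have "\<dots> = 2 * K * (nrm A g)\<^sup>2"
    by (subst suminf_mult) (auto simp: suminf_geometric)
  finally show "nrm A R \<le> 2 * K * (nrm A g)\<^sup>2" .
  have "\<bar>c k * g x ^ (k + 2)\<bar> \<le> (1/2) ^ k" for k
  proof -
    have "\<bar>g x\<bar> \<le> 1/2" using abs_le_nrm[OF g(1), of x] g(2) by linarith
    then have "\<bar>g x\<bar> ^ (k + 2) \<le> (1/2) ^ (k + 2)" by (intro power_mono) auto
    then have "\<bar>c k\<bar> * \<bar>g x\<bar> ^ (k + 2) \<le> 1 * (1/2) ^ (k + 2)" 
      using c[of k] by (intro mult_mono) auto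
    also have "\<dots> \<le> (1/2) ^ k" by simp
    finally show ?thesis by (simp add: abs_mult power_abs)
  qed
  then show "summable (\<lambda>k. c k * g x ^ (k + 2))"
    by (intro summable_comparison_test_ev[OF always_eventually summable_geometric[of "1/2::real"]]) auto
qed

lemma exp_remainder:
  assumes g: "g \<in> vecs A" "K * nrm A g \<le> 1/2"
  obtains R where "R \<in> vecs A" "nrm A R \<le> 2 * K * (nrm A g)\<^sup>2" "\<And>x. exp (g x) = 1 + g x + R x"
proof
  define c :: "nat \<Rightarrow> real" where "c k = inverse (fact (k + 2))" for k
  have c: "\<bar>c k\<bar> \<le> 1" for k
    using fact_ge_1[of "k + 2", where 'a = real] unfolding c_def
    by (simp only: abs_inverse abs_of_nonneg fact_ge_zero inverse_le_1_iff simp_thms)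
  note P = power_series_remainder[OF g c]
  show "(\<lambda>x. \<Sum>k. c k * g x ^ (k + 2)) \<in> vecs A" "nrm A (\<lambda>x. \<Sum>k. c k * g x ^ (k + 2)) \<le> 2 * K * (nrm A g)\<^sup>2"
    by (rule P)+
  fix x
  have "exp (g x) = (\<Sum>k. inverse (fact (k + 2)) * g x ^ (k + 2)) + (\<Sum>k<2. inverse (fact k) * g x ^ k)"
    unfolding exp_def using suminf_split_initial_segment[OF summable_exp, of "g x" 2]
    by (simp add: scaleR_conv_of_real divide_inverse)
  then show "exp (g x) = 1 + g x + (\<Sum>k. c k * g x ^ (k + 2))"
    by (simp add: c_def eval_nat_numeral)
qed

text \<open>The Mercator series without its linear term: the index moves by one, so
  \<open>a (Suc k)\<close> is the k-th term of the remainder. The bound on \<open>g x\<close> is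
  exported because it keeps 1 + g positive.\<close>

lemma ln_remainder:
  assumes g: "g \<in> vecs A" "K * nrm A g \<le> 1/2"
  obtains R where "R \<in> vecs A" "nrm A R \<le> 2 * K * (nrm A g)\<^sup>2"
    "\<And>x. ln (1 + g x) = g x + R x" "\<And>x. \<bar>g x\<bar> \<le> 1/2"
proof
  define c :: "nat \<Rightarrow> real" where "c k = (-1) ^ (k + 1) / (k + 2)" for k
  have c: "\<bar>c k\<bar> \<le> 1" for k by (simp add: c_def abs_mult power_abs)
  note P = power_series_remainder[OF g c]
  show "(\<lambda>x. \<Sum>k. c k * g x ^ (k + 2)) \<in> vecs A" "nrm A (\<lambda>x. \<Sum>k. c k * g x ^ (k + 2)) \<le> 2 * K * (nrm A g)\<^sup>2"
    by (rule P)+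
  fix x
  show gx: "\<bar>g x\<bar> \<le> 1/2" using abs_le_nrm[OF g(1), of x] g(2) by linarith
  define a where "a n = (-1) ^ n * (1 / real (n + 1)) * ((1 + g x) - 1) ^ Suc n" for n
  have ln: "ln (1 + g x) = suminf a"
    unfolding a_def using gx ln_series[of "1 + g x"] by (simp add: abs_le_iff)
  have aS: "a (Suc k) = c k * g x ^ (k + 2)" for k by (simp add: a_def c_def)
  then have "summable (\<lambda>k. a (Suc k))" using P(3) by simp
  then have "summable a" by (simp add: summable_Suc_iff)
  from suminf_split_head[OF this] have "(\<Sum>k. c k * g x ^ (k + 2)) = suminf a - a 0"
    by (simp only: aS)
  moreover have "a 0 = g x" by (simp add: a_def)
  ultimately show "ln (1 + g x) = g x + (\<Sum>k. c k * g x ^ (k + 2))"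
    using ln by linarith
qed

text \<open>Small arguments are covered by \<open>exp_remainder\<close>. For a general
  \<open>f\<close>, the choice n > 2 * K * |f| makes f / n small enough, and exp f is the n-th power
  of exp (f / n).\<close>

lemma exp_mem:
  assumes f: "f \<in> vecs A"
  shows "(\<lambda>x. exp (f x)) \<in> vecs A"
proof -
  obtain n :: nat where n: "2 * K * nrm A f < n" using reals_Archimedean2 by blast
  have n0: "real n > 0" using n K_ge_1 nrm_nonneg[of f]
    by (meson le_less_trans mult_nonneg_nonneg order_trans zero_le_numeral zero_le_one)
  define g where "g = (1 / real n) *\<^sub>R f"
  have g: "g \<in> vecs A" unfolding g_def by (rule mem_scaleR[OF f])
  have "K * nrm A g \<le> 1/2"
    unfolding g_def nrm_scaleR[OF f] using n n0 by (simp add: field_simps)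
  from exp_remainder[OF g this] obtain R where R: "R \<in> vecs A" "\<And>x. exp (g x) = 1 + g x + R x"
    by blast
  have "(1 + g + R) ^ n \<in> vecs A" by (intro mem_power mem_add one_mem g R)
  also have "(1 + g + R) ^ n = (\<lambda>x. exp (f x))"
  proof
    fix x
    have "((1 + g + R) ^ n) x = exp (g x) ^ n" by (simp add: power_fun_apply R)
    also have "\<dots> = exp (f x)" using n0 by (simp flip: exp_of_nat_mult add: g_def scaleR_fun_def)
    finally show "((1 + g + R) ^ n) x = exp (f x)" .
  qed
  finally show ?thesis .
qed

lemma small_multiple:
  assumes "0 \<le> B" "(e::real) > 0"
  obtains d where "d > 0" "\<And>t. 0 \<le> t \<Longrightarrow> t < d \<Longrightarrow> B * t \<le> e"
proof
  show "e / (B + 1) > 0" using assms by auto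
  show "B * t \<le> e" if "0 \<le> t" "t < e / (B + 1)" for t
  proof -
    have "B * t \<le> (B + 1) * t" using that by (intro mult_right_mono) auto
    also have "\<dots> \<le> e" using that assms by (simp add: field_simps)
    finally show ?thesis .
  qed
qed

text \<open>By exp (f + h) = exp f * exp h the error is exactly exp f times the quadratic remainder
  of exp h.\<close>

lemma has_frechet_derivative_exp:
  assumes f: "f \<in> vecs A"
  shows "has_frechet_derivative A A (\<lambda>f x. exp (f x)) (\<lambda>h. (\<lambda>x. exp (f x)) * h) f"
  unfolding has_frechet_derivative_def
proof (intro conjI allI impI bounded_linear_map_mult exp_mem f)
  fix e :: real assume "e > 0"
  define B where "B = K * nrm A (\<lambda>x. exp (f x)) * (2 * K)"
  have "B \<ge> 0" unfolding B_def using K_ge_1 nrm_nonneg by auto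
  then obtain d where d: "d > 0" "\<And>t. 0 \<le> t \<Longrightarrow> t < d \<Longrightarrow> B * t \<le> e"
    using small_multiple \<open>e > 0\<close> by blast
  show "\<exists>d>0. \<forall>h\<in>vecs A. nrm A h < d \<longrightarrow>
      (\<lambda>x. exp ((f + h) x)) - (\<lambda>x. exp (f x)) \<in> vecs A \<and>
      nrm A ((\<lambda>x. exp ((f + h) x)) - (\<lambda>x. exp (f x)) - (\<lambda>x. exp (f x)) * h) \<le> e * nrm A h"
  proof (intro exI[of _ "min d (1 / (2 * K))"] conjI ballI impI)
    fix h assume h: "h \<in> vecs A" "nrm A h < min d (1 / (2 * K))"
    then have "K * nrm A h \<le> 1/2" using K_ge_1 by (simp add: field_simps)
    from exp_remainder[OF h(1) this] obtain R where R: "R \<in> vecs A"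
      "nrm A R \<le> 2 * K * (nrm A h)\<^sup>2" "\<And>x. exp (h x) = 1 + h x + R x"
      by blast
    show "(\<lambda>x. exp ((f + h) x)) - (\<lambda>x. exp (f x)) \<in> vecs A"
      by (intro mem_diff exp_mem mem_add f h)
    have "(\<lambda>x. exp ((f + h) x)) - (\<lambda>x. exp (f x)) - (\<lambda>x. exp (f x)) * h = (\<lambda>x. exp (f x)) * R"
      by (simp add: fun_eq_iff exp_add R(3) algebra_simps)
    then have "nrm A ((\<lambda>x. exp ((f + h) x)) - (\<lambda>x. exp (f x)) - (\<lambda>x. exp (f x)) * h)
        \<le> K * nrm A (\<lambda>x. exp (f x)) * nrm A R"
      using nrm_mult[OF exp_mem[OF f] R(1)] by simp
    also have "\<dots> \<le> K * nrm A (\<lambda>x. exp (f x)) * (2 * K * (nrm A h)\<^sup>2)"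
      using R(2) K_ge_1 nrm_nonneg by (intro mult_left_mono) auto
    also have "\<dots> = (B * nrm A h) * nrm A h" by (simp add: B_def power2_eq_square)
    also have "\<dots> \<le> e * nrm A h" using d(2)[of "nrm A h"] h nrm_nonneg by (intro mult_right_mono) auto
    finally show "nrm A ((\<lambda>x. exp ((f + h) x)) - (\<lambda>x. exp (f x)) - (\<lambda>x. exp (f x)) * h) \<le> e * nrm A h" .
  qed (use d K_ge_1 in auto)
qed

text \<open>Membership of the logarithm is part of the definition, since in a general function
  algebra it does not follow from positivity. For Sobolev spaces with r > 1/2 it is supplied by
  \<open>ln_mem_sobolev\<close>.\<close>

definition log_domain :: "('x \<Rightarrow> real) set" where
  "log_domain = {f \<in> vecs A. (\<forall>x. f x > 0) \<and> (\<lambda>x. ln (f x)) \<in> vecs A}"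

text \<open>Uses 1 / f = exp (- ln f).\<close>

lemma inverse_mem: "f \<in> log_domain \<Longrightarrow> (\<lambda>x. 1 / f x) \<in> vecs A"
  using exp_mem[OF mem_minus, of "\<lambda>x. ln (f x)"]
  by (auto simp: log_domain_def exp_minus divide_inverse)

text \<open>Factor f + h = f * (1 + h / f). For small h the quotient is small in norm, so ln (f + h)
  = ln f + h / f + R with R quadratic. This gives openness of the domain and the derivative of
  \<open>ln\<close> at the same time.\<close>

lemma log_domain_perturb:
  assumes f: "f \<in> log_domain"
  obtains d B where "d > 0" "B \<ge> 0" and "\<And>h. h \<in> vecs A \<Longrightarrow> nrm A h < d \<Longrightarrow> f + h \<in> log_domain"
    and "\<And>h. h \<in> vecs A \<Longrightarrow> nrm A h < d \<Longrightarrow>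
      nrm A ((\<lambda>x. ln ((f + h) x)) - (\<lambda>x. ln (f x)) - (\<lambda>x. 1 / f x) * h) \<le> B * (nrm A h)\<^sup>2"
proof -
  define i where "i = (\<lambda>x. 1 / f x)"
  have i: "i \<in> vecs A" unfolding i_def by (rule inverse_mem[OF f])
  have fA: "f \<in> vecs A" and fp: "f x > 0" and lnf: "(\<lambda>x. ln (f x)) \<in> vecs A" for x
    using f by (auto simp: log_domain_def)
  define M where "M = K * nrm A i"
  have "M \<ge> 0" using K_ge_1 nrm_nonneg by (auto simp: M_def)
  then obtain d where d: "d > 0" "\<And>t. 0 \<le> t \<Longrightarrow> t < d \<Longrightarrow> (K * M) * t \<le> 1/2"
    using small_multiple[of "K * M" "1/2"] K_ge_1 by auto
  have *: "f + h \<in> log_domain \<and>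
    nrm A ((\<lambda>x. ln ((f + h) x)) - (\<lambda>x. ln (f x)) - (\<lambda>x. 1 / f x) * h) \<le> (2 * K * M\<^sup>2) * (nrm A h)\<^sup>2"
    if h: "h \<in> vecs A" "nrm A h < d" for h
  proof -
    define g where "g = i * h"
    have g: "g \<in> vecs A" unfolding g_def by (intro mem_mult i h)
    have ng: "nrm A g \<le> M * nrm A h" using nrm_mult[OF i h(1)] by (simp add: g_def M_def)
    then have "K * nrm A g \<le> K * (M * nrm A h)" using K_ge_1 by (intro mult_left_mono) auto
    also have "\<dots> \<le> 1/2" using d(2)[OF nrm_nonneg h(2)] by (simp add: mult.assoc)
    finally obtain R where R: "R \<in> vecs A" "nrm A R \<le> 2 * K * (nrm A g)\<^sup>2"
      "\<And>x. ln (1 + g x) = g x + R x" "\<And>x. \<bar>g x\<bar> \<le> 1/2"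
      using ln_remainder[OF g] by metis
    have fg: "f x + h x = f x * (1 + g x)" for x
      using fp[of x] by (simp add: g_def i_def field_simps)
    have pos: "1 + g x > 0" for x using R(4)[of x] by (simp add: abs_le_iff)
    have ln_eq: "ln (f x + h x) = ln (f x) + g x + R x" for x
      using ln_mult[of "f x" "1 + g x"] fp[of x] pos[of x] R(3)[of x] by (simp add: fg)
    have "f + h \<in> log_domain"
    proof -
      have "(\<lambda>x. ln (f x)) + g + R \<in> vecs A" by (intro mem_add lnf g R)
      moreover have "(\<lambda>x. ln (f x)) + g + R = (\<lambda>x. ln ((f + h) x))" by (simp add: fun_eq_iff ln_eq)
      moreover have "f x + h x > 0" for x unfolding fg using fp pos by simp
      ultimately show ?thesis using mem_add[OF fA h(1)] by (auto simp: log_domain_def)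
    qed
    moreover have "(\<lambda>x. ln ((f + h) x)) - (\<lambda>x. ln (f x)) - (\<lambda>x. 1 / f x) * h = R"
      by (simp add: fun_eq_iff ln_eq g_def i_def)
    moreover have "nrm A R \<le> 2 * K * (M * nrm A h)\<^sup>2"
      using R(2) K_ge_1 power_mono[OF ng nrm_nonneg, of 2]
        mult_left_mono[of "(nrm A g)\<^sup>2" "(M * nrm A h)\<^sup>2" "2 * K"] by linarith
    ultimately show ?thesis by (simp add: power_mult_distrib mult_ac)
  qed
  show thesis by (rule that[of d "2 * K * M\<^sup>2"]) (use d * K_ge_1 in auto)
qed

lemma has_frechet_derivative_ln:
  assumes f: "f \<in> log_domain"
  shows "has_frechet_derivative A A (\<lambda>f x. ln (f x)) (\<lambda>h. (\<lambda>x. 1 / f x) * h) f"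
  unfolding has_frechet_derivative_def
proof (intro conjI allI impI bounded_linear_map_mult inverse_mem f)
  fix e :: real assume "e > 0"
  obtain d B where dB: "d > 0" "B \<ge> 0" "\<And>h. h \<in> vecs A \<Longrightarrow> nrm A h < d \<Longrightarrow> f + h \<in> log_domain"
    "\<And>h. h \<in> vecs A \<Longrightarrow> nrm A h < d \<Longrightarrow>
      nrm A ((\<lambda>x. ln ((f + h) x)) - (\<lambda>x. ln (f x)) - (\<lambda>x. 1 / f x) * h) \<le> B * (nrm A h)\<^sup>2"
    using log_domain_perturb[OF f] by metis
  obtain d' where d': "d' > 0" "\<And>t. 0 \<le> t \<Longrightarrow> t < d' \<Longrightarrow> B * t \<le> e"
    using small_multiple[OF dB(2) \<open>e > 0\<close>] by blast
  show "\<exists>d>0. \<forall>h\<in>vecs A. nrm A h < d \<longrightarrow>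
      (\<lambda>x. ln ((f + h) x)) - (\<lambda>x. ln (f x)) \<in> vecs A \<and>
      nrm A ((\<lambda>x. ln ((f + h) x)) - (\<lambda>x. ln (f x)) - (\<lambda>x. 1 / f x) * h) \<le> e * nrm A h"
  proof (intro exI[of _ "min d d'"] conjI ballI impI)
    fix h assume h: "h \<in> vecs A" "nrm A h < min d d'"
    then show "(\<lambda>x. ln ((f + h) x)) - (\<lambda>x. ln (f x)) \<in> vecs A"
      using dB(3)[of h] f by (intro mem_diff) (auto simp: log_domain_def)
    have "nrm A ((\<lambda>x. ln ((f + h) x)) - (\<lambda>x. ln (f x)) - (\<lambda>x. 1 / f x) * h) \<le> (B * nrm A h) * nrm A h"
      using dB(4)[of h] h by (simp add: power2_eq_square mult_ac)
    also have "\<dots> \<le> e * nrm A h"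
      using d'(2)[OF nrm_nonneg] h nrm_nonneg by (intro mult_right_mono) auto
    finally show "nrm A ((\<lambda>x. ln ((f + h) x)) - (\<lambda>x. ln (f x)) - (\<lambda>x. 1 / f x) * h) \<le> e * nrm A h" .
  qed (use dB d' in auto)
qed

end

text \<open>
  If the partial derivatives of every member of the family \<open>F\<close> belong to \<open>F\<close> again, then
  iterating them gives all higher derivatives. The recursion peels off the last argument,
  because the direction in which one differentiates next is put in front.
\<close>

primrec iterated_partial ::
    "('i \<Rightarrow> 'a \<Rightarrow> 'b::comm_ring) \<Rightarrow> 't set \<Rightarrow> ('t \<Rightarrow> 'i \<Rightarrow> 'i) \<Rightarrow> ('t \<Rightarrow> 'a \<Rightarrow> 'b) \<Rightarrow>
      'a list \<Rightarrow> 'i \<Rightarrow> 'a \<Rightarrow> 'b" where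
  "iterated_partial F T pd l [] i x = F i x"
| "iterated_partial F T pd l (h # rs) i x = (\<Sum>t\<in>T. iterated_partial F T pd l rs (pd t i) x * l t h)"

text \<open>The derivative is assumed for every index, so an induction on the order may pass from
  \<open>i\<close> to \<open>pd t i\<close>. The directions \<open>l t h\<close> do not depend on
  \<open>x\<close>; differentiation therefore acts on the factor from \<open>F\<close> alone and no
  product rule arises.\<close>

lemma (in function_algebra) smooth_on_open_family:
  fixes E :: "('a::real_vector) normed_sub" and F :: "'i \<Rightarrow> 'a \<Rightarrow> 'x \<Rightarrow> real"
  assumes E: "normed_subspace E" and op: "open_in E W" and T: "finite T"
    and F_mem: "\<And>i x. x \<in> W \<Longrightarrow> F i x \<in> vecs A"
    and l: "\<And>t. t \<in> T \<Longrightarrow> bounded_linear_map E A (l t)"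
    and F_deriv: "\<And>i x. x \<in> W \<Longrightarrow>
      has_frechet_derivative E A (F i) (\<lambda>h. \<Sum>t\<in>T. F (pd t i) x * l t h) x"
  shows "smooth_on_open E A W (F i)"
proof -
  interpret E: normed_subspace E by fact
  define P where "P = iterated_partial F T pd l"
  have P_simps: "P [] i x = F i x" "P (h # rs) i x = (\<Sum>t\<in>T. P rs (pd t i) x * l t h)" for i x h rs
    by (simp_all add: P_def)
  have lm: "l t h \<in> vecs A" if "t \<in> T" "h \<in> vecs E" for t h
    using bounded_linear_map_mem[OF l] that by blast
  have P_mem: "P rs i x \<in> vecs A" if "x \<in> W" "set rs \<subseteq> vecs E" for rs i x
    using that(2)
  proof (induction rs arbitrary: i)
    case Nil
    then show ?case using F_mem that by (simp add: P_simps)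
  next
    case (Cons h rs)
    then show ?case unfolding P_simps by (intro mem_sum mem_mult lm) auto
  qed
  have "\<exists>C\<ge>0. \<forall>t\<in>T. \<forall>h\<in>vecs E. nrm A (l t h) \<le> C * nrm E h"
  proof -
    have "\<forall>t\<in>T. \<exists>c. c \<ge> 0 \<and> (\<forall>h\<in>vecs E. nrm A (l t h) \<le> c * nrm E h)"
    proof
      fix t assume "t \<in> T"
      show "\<exists>c. c \<ge> 0 \<and> (\<forall>h\<in>vecs E. nrm A (l t h) \<le> c * nrm E h)"
        using bounded_linear_map_bound[OF l[OF \<open>t \<in> T\<close>] E] by metis
    qed
    then have "\<exists>c. \<forall>t\<in>T. c t \<ge> 0 \<and> (\<forall>h\<in>vecs E. nrm A (l t h) \<le> c t * nrm E h)"
      by (rule bchoice)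
    then obtain c where c: "\<And>t. t \<in> T \<Longrightarrow> c t \<ge> 0"
      "\<And>t h. t \<in> T \<Longrightarrow> h \<in> vecs E \<Longrightarrow> nrm A (l t h) \<le> c t * nrm E h" by blast
    show ?thesis
    proof (intro exI[of _ "sum c T"] conjI ballI)
      show "sum c T \<ge> 0" using c by (auto intro: sum_nonneg)
      fix t h assume "t \<in> T" "h \<in> vecs E"
      moreover have "c t \<le> sum c T" using c \<open>t \<in> T\<close> T by (intro member_le_sum) auto
      ultimately show "nrm A (l t h) \<le> sum c T * nrm E h"
        using c(2)[of t h] mult_right_mono[of "c t" "sum c T" "nrm E h"] E.nrm_nonneg[of h] by linarith
    qed
  qed
  then obtain C where C: "C \<ge> 0"
    "\<And>t h. t \<in> T \<Longrightarrow> h \<in> vecs E \<Longrightarrow> nrm A (l t h) \<le> C * nrm E h" by blast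
  have P_bound: "\<exists>B\<ge>0. \<forall>rs. length rs = k \<and> set rs \<subseteq> vecs E \<longrightarrow>
      nrm A (P rs i x) \<le> B * prod_list (map (nrm E) rs)" if x: "x \<in> W" for k i x
  proof (induction k arbitrary: i)
    case 0
    show ?case by (intro exI[of _ "nrm A (F i x)"]) (simp add: P_simps nrm_nonneg)
  next
    case (Suc k)
    have "\<exists>B. \<forall>i. B i \<ge> 0 \<and> (\<forall>rs. length rs = k \<and> set rs \<subseteq> vecs E \<longrightarrow>
        nrm A (P rs i x) \<le> B i * prod_list (map (nrm E) rs))"
      by (rule choice, rule allI, rule Suc.IH)
    then obtain B where B: "\<And>i. B i \<ge> 0" "\<And>i rs. length rs = k \<Longrightarrow> set rs \<subseteq> vecs E \<Longrightarrow>
        nrm A (P rs i x) \<le> B i * prod_list (map (nrm E) rs)"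
      by blast
    show ?case
    proof (intro exI[of _ "\<Sum>t\<in>T. K * B (pd t i) * C"] conjI allI impI)
      show "0 \<le> (\<Sum>t\<in>T. K * B (pd t i) * C)" using B C K_ge_1 by (auto intro!: sum_nonneg mult_nonneg_nonneg)
      fix rs assume "length rs = Suc k \<and> set rs \<subseteq> vecs E"
      then obtain h rs' where rs: "rs = h # rs'" "length rs' = k" "h \<in> vecs E" "set rs' \<subseteq> vecs E"
        by (cases rs) auto
      have "nrm A (P rs i x) \<le> (\<Sum>t\<in>T. nrm A (P rs' (pd t i) x * l t h))"
        unfolding rs(1) P_simps using rs x by (intro nrm_sum mem_mult P_mem lm) auto
      also have "\<dots> \<le> (\<Sum>t\<in>T. K * (B (pd t i) * prod_list (map (nrm E) rs')) * (C * nrm E h))"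
      proof (intro sum_mono)
        fix t assume t: "t \<in> T"
        have "nrm A (P rs' (pd t i) x * l t h) \<le> K * nrm A (P rs' (pd t i) x) * nrm A (l t h)"
          using rs x t by (intro nrm_mult P_mem lm) auto
        also have "\<dots> \<le> K * (B (pd t i) * prod_list (map (nrm E) rs')) * (C * nrm E h)"
          using B C rs t K_ge_1 nrm_nonneg prod_list_nonneg_nrm[OF E]
          by (intro mult_mono mult_nonneg_nonneg) auto
        finally show "nrm A (P rs' (pd t i) x * l t h) \<le>
            K * (B (pd t i) * prod_list (map (nrm E) rs')) * (C * nrm E h)" .
      qed
      also have "\<dots> = (\<Sum>t\<in>T. K * B (pd t i) * C * prod_list (map (nrm E) rs))"
      proof (rule sum.cong[OF refl])
        fix t
        show "K * (B (pd t i) * prod_list (map (nrm E) rs')) * (C * nrm E h) =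
            K * B (pd t i) * C * prod_list (map (nrm E) rs)"
          by (simp add: rs(1))
      qed
      also have "\<dots> = (\<Sum>t\<in>T. K * B (pd t i) * C) * prod_list (map (nrm E) rs)"
        by (rule sum_distrib_right[symmetric])
      finally show "nrm A (P rs i x) \<le> (\<Sum>t\<in>T. K * B (pd t i) * C) * prod_list (map (nrm E) rs)" .
    qed
  qed
  have P_linear: "P (rs[j := a + c *\<^sub>R b]) i x = P (rs[j := a]) i x + c *\<^sub>R P (rs[j := b]) i x"
    if "j < length rs" "a \<in> vecs E" "b \<in> vecs E" for rs j a b c i x
    using that(1)
  proof (induction rs arbitrary: i j)
    case (Cons h rs)
    show ?case
    proof (cases j)
      case 0
      have "P rs (pd t i) x * l t (a + c *\<^sub>R b) =
          P rs (pd t i) x * l t a + c *\<^sub>R (P rs (pd t i) x * l t b)" if "t \<in> T" for t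
      proof -
        have "l t (a + c *\<^sub>R b) = l t a + c *\<^sub>R l t b"
          using l[OF that] \<open>a \<in> _\<close> \<open>b \<in> _\<close> by (simp add: bounded_linear_map_def)
        then show ?thesis by (simp add: fun_eq_iff scaleR_fun_def algebra_simps)
      qed
      then have "P ((a + c *\<^sub>R b) # rs) i x =
          (\<Sum>t\<in>T. P rs (pd t i) x * l t a + c *\<^sub>R (P rs (pd t i) x * l t b))"
        unfolding P_simps by (intro sum.cong refl)
      also have "\<dots> = P (a # rs) i x + c *\<^sub>R P (b # rs) i x"
        by (simp only: P_simps sum.distrib scaleR_right.sum)
      finally show ?thesis by (simp add: 0)
    next
      case (Suc j')
      have IH: "P (rs[j' := a + c *\<^sub>R b]) i x = P (rs[j' := a]) i x + c *\<^sub>R P (rs[j' := b]) i x" for i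
        using Cons.prems Suc by (intro Cons.IH) simp
      have "P (h # rs[j' := a + c *\<^sub>R b]) i x =
          (\<Sum>t\<in>T. P (rs[j' := a]) (pd t i) x * l t h + c *\<^sub>R (P (rs[j' := b]) (pd t i) x * l t h))"
        unfolding P_simps IH
        by (intro sum.cong refl) (simp add: fun_eq_iff scaleR_fun_def algebra_simps)
      also have "\<dots> = P (h # rs[j' := a]) i x + c *\<^sub>R P (h # rs[j' := b]) i x"
        by (simp only: P_simps sum.distrib scaleR_right.sum)
      finally show ?thesis by (simp add: Suc)
    qed
  qed simp
  \<comment> \<open>The new direction \<open>h\<close> is appended at the end, where it meets the
    innermost factor \<open>F\<close>. Peeling the first argument off \<open>rs\<close> reduces the
    claim to the finitely many indices \<open>pd t i\<close>.\<close>
  have P_deriv: "\<exists>d>0. \<forall>h\<in>vecs E. nrm E h < d \<longrightarrow>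
      (\<forall>rs. length rs = k \<and> set rs \<subseteq> vecs E \<longrightarrow>
        nrm A (P rs i (x + h) - P rs i x - P (rs @ [h]) i x)
          \<le> e * nrm E h * prod_list (map (nrm E) rs))"
    if x: "x \<in> W" and "e > 0" for x i k and e :: real
    using \<open>e > 0\<close>
  proof (induction k arbitrary: i e)
    case 0
    then obtain d where "d > 0" "\<And>h. h \<in> vecs E \<Longrightarrow> nrm E h < d \<Longrightarrow>
        nrm A (F i (x + h) - F i x - (\<Sum>t\<in>T. F (pd t i) x * l t h)) \<le> e * nrm E h"
      using F_deriv[OF x, of i] unfolding has_frechet_derivative_def by blast
    then show ?case
      by (intro exI[of _ d])
         (simp only: length_0_conv P_simps append_Nil list.map prod_list.Nil mult_1_right
           list.set empty_subsetI simp_thms imp_conjL all_simps, blast)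
  next
    case (Suc k)
    \<comment> \<open>Each of the \<open>card T\<close> summands loses a factor
      \<open>K * C\<close>, so the induction hypothesis is used with \<open>e / N\<close>; the
      \<open>+ 1\<close> keeps \<open>N\<close> positive.\<close>
    define N where "N = real (card T) * K * C + 1"
    have N: "N > 0" using K_ge_1 C by (auto simp: N_def intro!: add_nonneg_pos)
    have eN: "e / N > 0" using N Suc.prems by simp
    have "\<exists>d. \<forall>t\<in>T. d t > 0 \<and> (\<forall>h\<in>vecs E. nrm E h < d t \<longrightarrow>
      (\<forall>rs. length rs = k \<and> set rs \<subseteq> vecs E \<longrightarrow>
        nrm A (P rs (pd t i) (x + h) - P rs (pd t i) x - P (rs @ [h]) (pd t i) x)
          \<le> e / N * nrm E h * prod_list (map (nrm E) rs)))"
      by (rule bchoice, rule ballI, rule Suc.IH[OF eN])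
    then obtain d where d: "\<And>t. t \<in> T \<Longrightarrow> d t > 0"
      "\<And>t h rs. t \<in> T \<Longrightarrow> h \<in> vecs E \<Longrightarrow> nrm E h < d t \<Longrightarrow> length rs = k \<Longrightarrow> set rs \<subseteq> vecs E \<Longrightarrow>
        nrm A (P rs (pd t i) (x + h) - P rs (pd t i) x - P (rs @ [h]) (pd t i) x)
          \<le> e / N * nrm E h * prod_list (map (nrm E) rs)"
      by blast
    obtain d0 where d0: "d0 > 0" "\<And>h. h \<in> vecs E \<Longrightarrow> nrm E h < d0 \<Longrightarrow> x + h \<in> W"
      using op x unfolding open_in_def by blast
    \<comment> \<open>Inserting \<open>d0\<close> keeps \<open>x + h\<close> inside \<open>W\<close>
      and makes the minimum meaningful when \<open>T\<close> is empty.\<close>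
    show ?case
    proof (intro exI[of _ "Min (insert d0 (d ` T))"] ballI impI allI conjI)
      show "0 < Min (insert d0 (d ` T))" using d d0 T by (subst Min_gr_iff) auto
      fix h rs assume h: "h \<in> vecs E" "nrm E h < Min (insert d0 (d ` T))"
        and "length rs = Suc k \<and> set rs \<subseteq> vecs E"
      then obtain k' rs' where rs: "rs = k' # rs'" "length rs' = k" "k' \<in> vecs E" "set rs' \<subseteq> vecs E"
        by (cases rs) auto
      have xh: "x + h \<in> W" using d0 h T by (subst (asm) Min_gr_iff) auto
      have dh: "nrm E h < d t" if "t \<in> T" for t using h T that by (subst (asm) Min_gr_iff) auto
      let ?Q = "\<lambda>t. P rs' (pd t i) (x + h) - P rs' (pd t i) x - P (rs' @ [h]) (pd t i) x"
      have Q_mem: "?Q t \<in> vecs A" if "t \<in> T" for t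
        using rs h x xh that by (intro mem_diff P_mem) auto
      have "P rs i (x + h) - P rs i x - P (rs @ [h]) i x = (\<Sum>t\<in>T. ?Q t * l t k')"
        by (simp add: rs(1) P_simps sum_subtractf left_diff_distrib)
      then have "nrm A (P rs i (x + h) - P rs i x - P (rs @ [h]) i x) \<le> (\<Sum>t\<in>T. nrm A (?Q t * l t k'))"
        using Q_mem rs by (auto intro!: nrm_sum mem_mult lm)
      also have "\<dots> \<le> (\<Sum>t\<in>T. K * (e / N * nrm E h * prod_list (map (nrm E) rs')) * (C * nrm E k'))"
      proof (intro sum_mono)
        fix t assume t: "t \<in> T"
        have "nrm A (?Q t * l t k') \<le> K * nrm A (?Q t) * nrm A (l t k')"
          using Q_mem t rs by (intro nrm_mult lm) auto
        also have "\<dots> \<le> K * (e / N * nrm E h * prod_list (map (nrm E) rs')) * (C * nrm E k')"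
          using d(2)[OF t h(1) dh[OF t] rs(2,4)] C(2)[OF t rs(3)] K_ge_1 nrm_nonneg E.nrm_nonneg
            prod_list_nonneg_nrm[OF E] \<open>e / N > 0\<close>
          by (intro mult_mono mult_left_mono mult_nonneg_nonneg) auto
        finally show "nrm A (?Q t * l t k') \<le>
          K * (e / N * nrm E h * prod_list (map (nrm E) rs')) * (C * nrm E k')" .
      qed
      also have "\<dots> = (real (card T) * K * C / N * e) * (nrm E h * prod_list (map (nrm E) rs))"
        by (simp add: rs(1) mult_ac)
      also have "\<dots> \<le> e * (nrm E h * prod_list (map (nrm E) rs))"
      proof (intro mult_right_mono mult_nonneg_nonneg E.nrm_nonneg prod_list_nonneg_nrm[OF E])
        have "real (card T) * K * C / N \<le> 1" using N by (simp add: N_def)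
        then show "real (card T) * K * C / N * e \<le> e"
          using mult_right_mono[of _ 1 e] Suc.prems by fastforce
      qed
      finally show "nrm A (P rs i (x + h) - P rs i x - P (rs @ [h]) i x)
          \<le> e * nrm E h * prod_list (map (nrm E) rs)" by (simp add: mult.assoc)
    qed
  qed
  have prod_rev: "prod_list (map (nrm E) (rev hs)) = prod_list (map (nrm E) hs)" for hs
    by (induction hs) (auto simp: mult.commute)
  \<comment> \<open>Reversal turns the argument that \<open>P_deriv\<close> appends into the one
    that \<open>derivative_family\<close> puts in front.\<close>
  have "derivative_family E A W (F i) (\<lambda>x hs. P (rev hs) i x)"
    unfolding derivative_family_def
  proof (intro conjI ballI allI impI)
    show "P (rev []) i x = F i x" for x by (simp add: P_simps)
  next
    fix x and k :: nat assume x: "x \<in> W"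
    show "bounded_multilinear_map E A k (\<lambda>hs. P (rev hs) i x)"
      unfolding bounded_multilinear_map_def
    proof (intro conjI allI impI ballI)
      show "P (rev hs) i x \<in> vecs A" if "length hs = k \<and> set hs \<subseteq> vecs E" for hs
        using that x by (intro P_mem) auto
      show "P (rev (hs[j := a + c *\<^sub>R b])) i x = P (rev (hs[j := a])) i x + c *\<^sub>R P (rev (hs[j := b])) i x"
        if "length hs = k \<and> set hs \<subseteq> vecs E" "j < k" "a \<in> vecs E" "b \<in> vecs E" for hs j a b c
        using that P_linear[of "length hs - j - 1" "rev hs" a b c i x] by (simp add: rev_update)
      obtain B where "\<And>rs. length rs = k \<Longrightarrow> set rs \<subseteq> vecs E \<Longrightarrow>
          nrm A (P rs i x) \<le> B * prod_list (map (nrm E) rs)"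
        using P_bound[OF x, of k i] by blast
      from this[of "rev _"] show "\<exists>B. \<forall>hs. length hs = k \<and> set hs \<subseteq> vecs E \<longrightarrow>
          nrm A (P (rev hs) i x) \<le> B * prod_list (map (nrm E) hs)"
        by (auto simp: prod_rev)
    qed
  next
    fix x and k :: nat and e :: real assume x: "x \<in> W" and e: "e > 0"
    obtain d0 where d0: "d0 > 0" "\<And>h. h \<in> vecs E \<Longrightarrow> nrm E h < d0 \<Longrightarrow> x + h \<in> W"
      using op x unfolding open_in_def by blast
    obtain d where d: "d > 0" "\<And>h rs. h \<in> vecs E \<Longrightarrow> nrm E h < d \<Longrightarrow> length rs = k \<Longrightarrow>
        set rs \<subseteq> vecs E \<Longrightarrow> nrm A (P rs i (x + h) - P rs i x - P (rs @ [h]) i x)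
          \<le> e * nrm E h * prod_list (map (nrm E) rs)"
      using P_deriv[OF x e, of k i] by blast
    show "\<exists>d>0. \<forall>h\<in>vecs E. nrm E h < d \<longrightarrow>
           (\<forall>hs. length hs = k \<and> set hs \<subseteq> vecs E \<longrightarrow>
              P (rev hs) i (x + h) - P (rev hs) i x \<in> vecs A \<and>
              nrm A (P (rev hs) i (x + h) - P (rev hs) i x - P (rev (h # hs)) i x)
                \<le> e * nrm E h * prod_list (map (nrm E) hs))"
    proof (intro exI[of _ "min d0 d"] ballI impI allI conjI[of "_ < _"])
      fix h hs assume h: "h \<in> vecs E" "nrm E h < min d0 d" and hs: "length hs = k \<and> set hs \<subseteq> vecs E"
      have "x + h \<in> W" using d0 h by auto
      then have "P (rev hs) i (x + h) - P (rev hs) i x \<in> vecs A"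
        using x hs by (intro mem_diff P_mem) auto
      then show "P (rev hs) i (x + h) - P (rev hs) i x \<in> vecs A \<and>
              nrm A (P (rev hs) i (x + h) - P (rev hs) i x - P (rev (h # hs)) i x)
                \<le> e * nrm E h * prod_list (map (nrm E) hs)"
        using d(2)[of h "rev hs"] h hs by (simp add: prod_rev)
    qed (use d d0 in auto)
  qed
  then show ?thesis using op by (auto simp: smooth_on_open_iff)
qed

subsection \<open>Fourier series\<close>

definition fourier_basis :: "int \<Rightarrow> real \<Rightarrow> complex" where
  "fourier_basis n x = cis (2 * pi * of_int n * x)"

lemma norm_fourier_basis [simp]: "norm (fourier_basis n x) = 1"
  by (simp add: fourier_basis_def)

lemma fourier_basis_0 [simp]: "fourier_basis 0 x = 1"
  by (simp add: fourier_basis_def)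

lemma fourier_basis_add: "fourier_basis (m + n) x = fourier_basis m x * fourier_basis n x"
  by (simp add: fourier_basis_def cis_mult algebra_simps)

lemma cnj_fourier_basis: "cnj (fourier_basis n x) = fourier_basis (- n) x"
  by (simp add: fourier_basis_def cis_cnj)

lemma fourier_basis_periodic: "fourier_basis n (x + 1) = fourier_basis n x"
proof -
  have "fourier_basis n (x + 1) = fourier_basis n x * cis (2 * pi * of_int n)"
    by (simp add: fourier_basis_def cis_mult algebra_simps)
  then show ?thesis by (simp add: cis_multiple_2pi)
qed

lemma fourier_basis_has_vector_derivative:
  "(fourier_basis n has_vector_derivative 2 * pi * \<i> * of_int n * fourier_basis n x) (at x within S)"
  unfolding fourier_basis_def cis_conv_exp
  by (rule derivative_eq_intros refl has_vector_derivative_real_field | simp)+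

lemma continuous_on_fourier_basis [continuous_intros]:
  "continuous_on S g \<Longrightarrow> continuous_on S (\<lambda>x. fourier_basis n (g x))"
  unfolding fourier_basis_def by (intro continuous_intros)

lemma fourier_coeff_eq: "fourier_coeff f n = integral {0..1} (\<lambda>x. of_real (f x) * fourier_basis (- n) x)"
  by (simp add: fourier_coeff_def fourier_basis_def)

lemma integral_fourier_basis: "integral {0..1} (fourier_basis n) = (if n = 0 then 1 else 0)"
proof (cases "n = 0")
  case False
  define c where "c = 2 * pi * \<i> * of_int n"
  have c: "c \<noteq> 0" using False by (simp add: c_def)
  have "((\<lambda>x. fourier_basis n x / c) has_vector_derivative fourier_basis n x) (at x within {0..1})" for x
    using has_vector_derivative_divide[OF fourier_basis_has_vector_derivative[of n x], of c] c
    by (simp add: c_def)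
  then have "(fourier_basis n has_integral (fourier_basis n 1 / c - fourier_basis n 0 / c)) {0..1}"
    by (intro fundamental_theorem_of_calculus) auto
  then show ?thesis
    using False fourier_basis_periodic[of n 0] by (simp add: integral_unique)
qed (simp add: fourier_basis_def[abs_def])

section \<open>Periodic functions and uniqueness of Fourier coefficients\<close>

lemma periodic_add_int:
  fixes f :: "real \<Rightarrow> 'a"
  assumes "\<And>x. f (x + 1) = f x"
  shows "f (x + of_int n) = f x"
proof -
  have nat: "f (x + real k) = f x" for x k
    by (induction k) (use assms in \<open>auto simp: add.assoc[symmetric] add.commute[of 1]\<close>)
  show ?thesis
  proof (cases "n \<ge> 0")
    case True
    then show ?thesis using nat[of x "nat n"] by simp
  next
    case False
    then show ?thesis using nat[of "x + of_int n" "nat (- n)"] by simp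
  qed
qed

lemma periodic_frac:
  fixes f :: "real \<Rightarrow> 'a"
  assumes "\<And>x. f (x + 1) = f x"
  shows "f (frac x) = f x"
  using periodic_add_int[of f x "- \<lfloor>x\<rfloor>"] assms by (simp add: frac_def)

lemma periodic_bounded:
  fixes f :: "real \<Rightarrow> real"
  assumes "continuous_on UNIV f" "\<And>x. f (x + 1) = f x"
  obtains B where "B \<ge> 0" "\<And>x. \<bar>f x\<bar> \<le> B"
proof -
  have "compact (f ` {0..1})"
    by (intro compact_continuous_image continuous_on_subset[OF assms(1)]) auto
  then obtain B where B: "\<And>x. x \<in> {0..1} \<Longrightarrow> \<bar>f x\<bar> \<le> B"
    using compact_imp_bounded bounded_iff by (metis image_eqI real_norm_def)
  have "\<bar>f x\<bar> \<le> B" for x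
    using B[of "frac x"] periodic_frac[of f x] assms(2) frac_ge_0[of x] frac_lt_1[of x] by auto
  moreover have "B \<ge> 0" using B[of 0] by force
  ultimately show thesis using that by blast
qed

text \<open>Moves a periodic function to the compact unit circle, where the Stone-Weierstrass
  theorem applies. \<open>Arg\<close> jumps on the negative axis, so continuity is not read off the
  formula: a closed preimage is the image of a compact subset of [0, 1], hence closed.\<close>

lemma continuous_on_circle_factor:
  fixes f :: "real \<Rightarrow> real"
  assumes "continuous_on UNIV f" "\<And>x. f (x + 1) = f x"
  obtains F where "continuous_on (sphere 0 1) F" "\<And>x. F (fourier_basis 1 x) = f x"
proof -
  define F where "F z = f (Arg z / (2 * pi))" for z :: complex
  have eq: "F (fourier_basis 1 x) = f x" for x
  proof -
    obtain n :: int where "Arg (fourier_basis 1 x) = 2 * pi * x + 2 * of_int n * pi"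
    proof -
      have "cis (Arg (fourier_basis 1 x)) = cis (2 * pi * x)"
        using cis_Arg[of "fourier_basis 1 x"] norm_fourier_basis[of 1 x]
        by (simp add: sgn_div_norm del: norm_fourier_basis) (simp add: fourier_basis_def)
      then have "sin (Arg (fourier_basis 1 x)) = sin (2 * pi * x) \<and>
          cos (Arg (fourier_basis 1 x)) = cos (2 * pi * x)" by (simp add: complex_eq_iff)
      then show thesis using that by (auto simp: sin_cos_eq_iff)
    qed
    then have "Arg (fourier_basis 1 x) / (2 * pi) = x + of_int n" by (simp add: field_simps)
    then show ?thesis using periodic_add_int[of f x n] assms(2) by (simp add: F_def)
  qed
  have sph: "sphere 0 1 = fourier_basis 1 ` {0..1}"
  proof (intro equalityI subsetI)
    fix z :: complex assume "z \<in> sphere 0 1"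
    then have z: "norm z = 1" "z \<noteq> 0" by auto
    define x where "x = Arg z / (2 * pi)"
    have "fourier_basis 1 x = z"
      using z cis_Arg[OF z(2)] by (simp add: fourier_basis_def x_def sgn_div_norm)
    then have "z = fourier_basis 1 (frac x)"
      using periodic_frac[of "fourier_basis 1" x] fourier_basis_periodic by simp
    then show "z \<in> fourier_basis 1 ` {0..1}" using frac_ge_0[of x] frac_lt_1[of x] by force
  qed auto
  have "continuous_on (sphere 0 1) F"
  proof (rule continuous_on_closed_invariant[THEN iffD2], intro allI impI)
    fix B :: "real set" assume B: "closed B"
    have "closed (f -` B)" using assms(1) B by (simp add: continuous_on_closed_vimage vimage_def)
    then have "compact ({0..1} \<inter> f -` B)" by (intro compact_Int_closed) auto
    then have "compact (fourier_basis 1 ` ({0..1} \<inter> f -` B))"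
      by (intro compact_continuous_image continuous_intros continuous_on_id)
    moreover have "fourier_basis 1 ` ({0..1} \<inter> f -` B) \<inter> sphere 0 1 = F -` B \<inter> sphere 0 1"
      unfolding sph by (auto simp: eq[symmetric])
    ultimately show "\<exists>A. closed A \<and> A \<inter> sphere 0 1 = F -` B \<inter> sphere 0 1"
      using compact_imp_closed by blast
  qed
  then show thesis using eq that by blast
qed

text \<open>Vanishing coefficients make f orthogonal to every real polynomial in the circle
  coordinates. Approximating f uniformly by such polynomials shows that the integral of f^2 is
  0.\<close>

lemma fourier_coeff_0_imp_0:
  fixes f :: "real \<Rightarrow> real"
  assumes cont: "continuous_on UNIV f" and per: "\<And>x. f (x + 1) = f x"
    and zero: "\<And>n. fourier_coeff f n = 0"
  shows "f x = 0"
proof -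
  obtain F where F: "continuous_on (sphere 0 1) F" "\<And>x. F (fourier_basis 1 x) = f x"
    using continuous_on_circle_factor[OF cont per] by blast
  \<comment> \<open>The space of continuous functions without Fourier coefficients. It is shown to
    be stable under multiplication by polynomials on the circle: by Re (w * e_1) = (w * e_1 + cnj w
    * e_(-1)) / 2, a linear factor only shifts the index by one in either direction.\<close>
  define orth :: "(real \<Rightarrow> real) \<Rightarrow> bool" where "orth g \<longleftrightarrow> continuous_on UNIV g \<and>
    (\<forall>n. integral {0..1} (\<lambda>x. of_real (g x) * fourier_basis n x) = 0)" for g
  have int: "(\<lambda>x. of_real (g x) * fourier_basis n x) integrable_on {0..1}"
    if "continuous_on UNIV g" for g n
    by (intro integrable_continuous_real continuous_intros continuous_on_subset[OF that]) auto
  have orth_add: "orth (\<lambda>x. g x + h x)" if "orth g" "orth h" for g h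
    using that int[of g] int[of h]
    by (auto simp: orth_def distrib_right integral_add intro!: continuous_intros)
  have orth_scale: "orth (\<lambda>x. c * g x)" if "orth g" for g c
    using that by (auto simp: orth_def mult.assoc intro!: continuous_intros)
  have orth_shift: "orth (\<lambda>x. g x * Re (w * fourier_basis 1 x))" if g: "orth g" for g and w :: complex
  proof -
    have "of_real (g x * Re (w * fourier_basis 1 x)) * fourier_basis n x =
        w / 2 * (of_real (g x) * fourier_basis (n + 1) x) +
        cnj w / 2 * (of_real (g x) * fourier_basis (n - 1) x)" for n x
    proof -
      have Re_eq: "complex_of_real (Re (w * fourier_basis 1 x)) =
          (w * fourier_basis 1 x + cnj w * fourier_basis (-1) x) / 2"
        using complex_add_cnj[of "w * fourier_basis 1 x"] by (simp add: cnj_fourier_basis)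
      show ?thesis
        unfolding of_real_mult Re_eq diff_conv_add_uminus[of n 1] fourier_basis_add[of n]
        by (simp add: algebra_simps add_divide_distrib)
    qed
    moreover have hi: "((\<lambda>x. of_real (g x) * fourier_basis n x) has_integral 0) {0..1}" for n
      using int[of g n] g by (auto simp: orth_def has_integral_iff)
    ultimately have "integral {0..1} (\<lambda>x. of_real (g x * Re (w * fourier_basis 1 x)) * fourier_basis n x) = 0" for n
      using has_integral_add[OF has_integral_mult_right[OF hi[of "n + 1"], of "w / 2"]
          has_integral_mult_right[OF hi[of "n - 1"], of "cnj w / 2"]]
      by (simp only:) (simp add: integral_unique)
    moreover have "continuous_on UNIV (\<lambda>x. g x * Re (w * fourier_basis 1 x))"
      using g by (auto simp: orth_def intro!: continuous_intros)
    ultimately show ?thesis by (simp add: orth_def)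
  qed
  have orth_poly: "orth (\<lambda>x. g x * P (fourier_basis 1 x))" if "real_polynomial_function P" "orth g" for P g
    using that
  proof (induction P arbitrary: g)
    case (linear P)
    \<comment> \<open>Every real linear functional on the plane has the form Re (w * z); its values
      at 1 and at \<open>\<i>\<close> determine w.\<close>
    define w where "w = Complex (P 1) (- P \<i>)"
    have "P z = Re (w * z)" for z
    proof -
      interpret bounded_linear P by fact
      have "P (Re z *\<^sub>R 1 + Im z *\<^sub>R \<i>) = Re z * P 1 + Im z * P \<i>" by (simp add: add scaleR)
      moreover have "Re z *\<^sub>R 1 + Im z *\<^sub>R \<i> = z" by (simp add: complex_eq_iff)
      ultimately show ?thesis by (simp add: w_def)
    qed
    then show ?case using orth_shift[OF linear(2), of w] by simp
  next
    case (const c)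
    then show ?case using orth_scale[of g c] by (simp add: mult.commute)
  next
    case (add P Q)
    then show ?case using orth_add[OF add.IH(1)[OF add.prems] add.IH(2)[OF add.prems]]
      by (simp add: distrib_left)
  next
    case (mult P Q)
    then show ?case using mult.IH(2)[OF mult.IH(1)[OF mult.prems]] by (simp add: mult.assoc)
  qed
  have orth_f: "orth f"
    unfolding orth_def using cont zero[of "- _"] by (simp add: fourier_coeff_eq)
  obtain M where M: "M \<ge> 0" "\<And>x. \<bar>f x\<bar> \<le> M" using periodic_bounded[OF cont per] by blast
  have cs: "continuous_on {0..1} f" by (rule continuous_on_subset[OF cont]) auto
  \<comment> \<open>Orthogonality replaces f^2 by f * (f - P) under the integral, and the accuracy e
    / (M + 1) of P absorbs the bound M of f.\<close>
  have "integral {0..1} (\<lambda>x. (f x)\<^sup>2) \<le> 0 + e" if "e > 0" for e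
  proof -
    have "e / (M + 1) > 0" using M that by auto
    with Stone_Weierstrass_real_polynomial_function[OF compact_sphere F(1) this]
    obtain P where P: "real_polynomial_function P"
      "\<And>z. z \<in> sphere 0 1 \<Longrightarrow> \<bar>F z - P z\<bar> < e / (M + 1)" by blast
    have cP: "continuous_on {0..1} (\<lambda>x. P (fourier_basis 1 x))"
    proof (rule continuous_on_compose2[of UNIV P "{0..1}" "fourier_basis 1", OF _ _ subset_UNIV])
      show "continuous_on UNIV P"
        using continuous_real_polymonial_function[OF P(1)] by (simp add: continuous_at_imp_continuous_on)
      show "continuous_on {0..1} (fourier_basis 1)" by (intro continuous_on_fourier_basis continuous_on_id)
    qed
    have "integral {0..1} (\<lambda>x. complex_of_real (f x * P (fourier_basis 1 x))) = 0"
      using orth_poly[OF P(1) orth_f] by (auto simp: orth_def dest: spec[of _ 0])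
    moreover have "((\<lambda>x. complex_of_real (f x * P (fourier_basis 1 x))) has_integral
        of_real (integral {0..1} (\<lambda>x. f x * P (fourier_basis 1 x)))) {0..1}"
      by (intro has_integral_of_real integrable_integral integrable_continuous_real
          continuous_on_mult cs cP)
    ultimately have "integral {0..1} (\<lambda>x. f x * P (fourier_basis 1 x)) = 0"
      by (metis integral_unique of_real_eq_0_iff)
    then have "integral {0..1} (\<lambda>x. (f x)\<^sup>2) = integral {0..1} (\<lambda>x. (f x)\<^sup>2 - f x * P (fourier_basis 1 x))"
      by (subst integral_diff) (auto intro!: integrable_continuous_real continuous_intros cs cP)
    also have "\<dots> \<le> integral {0..1} (\<lambda>x::real. e)"
    proof (rule integral_le)
      fix x :: real
      have "(f x)\<^sup>2 - f x * P (fourier_basis 1 x) = f x * (f x - P (fourier_basis 1 x))"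
        by (simp add: power2_eq_square algebra_simps)
      also have "\<dots> \<le> \<bar>f x\<bar> * \<bar>f x - P (fourier_basis 1 x)\<bar>" by (metis abs_ge_self abs_mult)
      also have "\<dots> \<le> M * (e / (M + 1))"
        using P(2)[of "fourier_basis 1 x"] M F(2)[of x] by (intro mult_mono) auto
      also have "\<dots> \<le> e" using M(1) that by (simp add: field_simps)
      finally show "(f x)\<^sup>2 - f x * P (fourier_basis 1 x) \<le> e" .
    qed (auto intro!: integrable_continuous_real continuous_intros cs cP)
    finally show ?thesis by simp
  qed
  then have "integral {0..1} (\<lambda>x. (f x)\<^sup>2) \<le> 0" by (rule field_le_epsilon)
  moreover have "integral {0..1} (\<lambda>x. (f x)\<^sup>2) \<ge> 0"
    by (intro integral_nonneg integrable_continuous_real continuous_intros cs) auto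
  ultimately have "integral {0..1} (\<lambda>x. (f x)\<^sup>2) = 0" by simp
  then have "f y = 0" if "y \<in> {0..1}" for y
    using integral_eq_0_iff[OF continuous_on_power[OF cs, of 2]] that by auto
  then show ?thesis using periodic_frac[of f x] per frac_ge_0[of x] frac_lt_1[of x] by auto
qed

definition fourier_series :: "(int \<Rightarrow> complex) \<Rightarrow> real \<Rightarrow> complex" where
  "fourier_series c x = (\<Sum>\<^sub>\<infinity>n. c n * fourier_basis n x)"

lemma continuous_on_fourier_series:
  assumes "(\<lambda>n. cmod (c n)) summable_on UNIV"
  shows "continuous_on UNIV (fourier_series c)"
proof (rule uniform_limit_theorem)
  show "uniform_limit UNIV (\<lambda>X x. \<Sum>n\<in>X. c n * fourier_basis n x) (fourier_series c)
      (finite_subsets_at_top UNIV)"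
    unfolding fourier_series_def[abs_def]
    by (rule Weierstrass_m_test_general[OF _ assms]) (simp add: norm_mult)
  show "\<forall>\<^sub>F X in finite_subsets_at_top UNIV. continuous_on UNIV (\<lambda>x. \<Sum>n\<in>X. c n * fourier_basis n x)"
    by (intro always_eventually allI continuous_intros)
qed auto

lemma fourier_series_periodic: "fourier_series c (x + 1) = fourier_series c x"
  by (simp add: fourier_series_def fourier_basis_periodic)

text \<open>Termwise integration by uniform convergence. The factor \<open>g\<close> is kept
  general: a basis function recovers the coefficients, and another function times a basis function
  yields the convolution formula.\<close>

lemma has_sum_integral_fourier_series:
  assumes c: "(\<lambda>n. cmod (c n)) summable_on UNIV" and g: "continuous_on {0..1} g"
  shows "((\<lambda>n. c n * integral {0..1} (\<lambda>x. fourier_basis n x * g x)) has_sum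
    integral {0..1} (\<lambda>x. fourier_series c x * g x)) UNIV"
proof -
  obtain B where B: "\<And>x. x \<in> {0..1} \<Longrightarrow> norm (g x) \<le> B"
    using compact_imp_bounded[OF compact_continuous_image[OF g]] unfolding bounded_iff by blast
  have "uniform_limit {0..1} (\<lambda>X x. \<Sum>n\<in>X. c n * fourier_basis n x * g x)
      (\<lambda>x. \<Sum>\<^sub>\<infinity>n. c n * fourier_basis n x * g x) (finite_subsets_at_top UNIV)"
  proof (rule Weierstrass_m_test_general)
    show "(\<lambda>n. cmod (c n) * B) summable_on UNIV" by (rule summable_on_cmult_left[OF c])
    show "norm (c n * fourier_basis n x * g x) \<le> cmod (c n) * B" if "x \<in> {0..1}" for n x
      using B[OF that] by (auto simp: norm_mult intro: mult_left_mono)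
  qed
  moreover have "continuous_on {0..1} (\<lambda>x. \<Sum>n\<in>X. c n * fourier_basis n x * g x)" for X
    by (intro continuous_intros g)
  ultimately obtain I J where IJ:
      "\<And>X. ((\<lambda>x. \<Sum>n\<in>X. c n * fourier_basis n x * g x) has_integral I X) {0..1}"
      "((\<lambda>x. \<Sum>\<^sub>\<infinity>n. c n * fourier_basis n x * g x) has_integral J) {0..1}"
      "(I \<longlongrightarrow> J) (finite_subsets_at_top UNIV)"
    by (rule uniform_limit_integral) auto
  have "I X = (\<Sum>n\<in>X. c n * integral {0..1} (\<lambda>x. fourier_basis n x * g x))" for X
  proof (rule has_integral_unique[OF IJ(1)])
    show "((\<lambda>x. \<Sum>n\<in>X. c n * fourier_basis n x * g x) has_integral
        (\<Sum>n\<in>X. c n * integral {0..1} (\<lambda>x. fourier_basis n x * g x))) {0..1}"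
      unfolding sum_distrib_left mult.assoc
    proof (cases "finite X")
      case True
      then show "((\<lambda>x. \<Sum>n\<in>X. c n * (fourier_basis n x * g x)) has_integral
        (\<Sum>n\<in>X. c n * integral {0..1} (\<lambda>x. fourier_basis n x * g x))) {0..1}"
        by (intro has_integral_sum has_integral_mult_right integrable_integral
            integrable_continuous_real continuous_intros g)
    qed auto
  qed
  then have "I = sum (\<lambda>n. c n * integral {0..1} (\<lambda>x. fourier_basis n x * g x))" by blast
  moreover have "J = integral {0..1} (\<lambda>x. fourier_series c x * g x)"
    using integral_unique[OF IJ(2)] by (simp add: fourier_series_def infsum_cmult_left')
  ultimately show ?thesis using IJ(3) by (simp add: has_sum_def)
qed

lemma integral_fourier_series:
  assumes c: "(\<lambda>n. cmod (c n)) summable_on UNIV"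
  shows "integral {0..1} (\<lambda>x. fourier_series c x * fourier_basis (- n) x) = c n"
proof (rule has_sum_unique[OF has_sum_integral_fourier_series[OF c]])
  show "continuous_on {0..1} (fourier_basis (- n))"
    by (intro continuous_on_fourier_basis continuous_on_id)
  have eq: "(\<lambda>x. fourier_basis m x * fourier_basis (- n) x) = fourier_basis (m - n)" for m
    by (simp add: fun_eq_iff flip: fourier_basis_add)
  show "((\<lambda>m. c m * integral {0..1} (\<lambda>x. fourier_basis m x * fourier_basis (- n) x)) has_sum c n) UNIV"
    unfolding eq integral_fourier_basis by (rule has_sum_finite_neutralI[of "{n}"]) auto
qed

text \<open>Conjugation replaces n by -n, and the sum over all integers is invariant under that
  reflection.\<close>

lemma fourier_series_real:
  assumes "\<And>n. c (- n) = cnj (c n)"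
  shows "of_real (Re (fourier_series c x)) = fourier_series c x"
proof -
  have "cnj (fourier_series c x) = (\<Sum>\<^sub>\<infinity>n. c (- n) * fourier_basis (- n) x)"
    unfolding fourier_series_def infsum_cnj[symmetric]
    by (simp add: assms cnj_fourier_basis)
  also have "\<dots> = fourier_series c x"
    unfolding fourier_series_def
    by (rule infsum_reindex_bij_betw[of uminus]) (auto intro: bij_betwI[of _ _ _ uminus])
  finally show ?thesis by (simp add: complex_eq_iff)
qed

lemma fourier_coeff_synthesis:
  assumes "(\<lambda>n. cmod (c n)) summable_on UNIV" "\<And>n. c (- n) = cnj (c n)"
  shows "fourier_coeff (\<lambda>x. Re (fourier_series c x)) n = c n"
  using integral_fourier_series[OF assms(1)] by (simp add: fourier_coeff_eq fourier_series_real[of c, OF assms(2)])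

section \<open>Calculus of Fourier coefficients\<close>

lemma fourier_coeff_minus: "fourier_coeff f (- n) = cnj (fourier_coeff f n)"
  by (simp add: fourier_coeff_eq integral_cnj cnj_fourier_basis)

lemma fourier_coeff_integrable:
  assumes "continuous_on UNIV f"
  shows "(\<lambda>x. of_real (f x) * fourier_basis n x) integrable_on {0..1}"
  by (intro integrable_continuous_real continuous_intros continuous_on_subset[OF assms]) auto

lemma fourier_coeff_add:
  assumes "continuous_on UNIV f" "continuous_on UNIV g"
  shows "fourier_coeff (f + g) n = fourier_coeff f n + fourier_coeff g n"
  unfolding fourier_coeff_eq
  by (subst integral_add[symmetric]) (auto intro: fourier_coeff_integrable assms simp: algebra_simps)

lemma fourier_coeff_scaleR: "fourier_coeff (c *\<^sub>R f) n = of_real c * fourier_coeff f n"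
  by (simp add: fourier_coeff_eq scaleR_fun_def mult.assoc)

lemma fourier_coeff_diff:
  assumes "continuous_on UNIV f" "continuous_on UNIV g"
  shows "fourier_coeff (f - g) n = fourier_coeff f n - fourier_coeff g n"
  unfolding fourier_coeff_eq
  by (subst integral_diff[symmetric]) (auto intro: fourier_coeff_integrable assms simp: algebra_simps)

lemma fourier_coeff_const: "fourier_coeff (\<lambda>_. c) n = (if n = 0 then of_real c else 0)"
  using integral_fourier_basis[of "- n"] by (simp add: fourier_coeff_eq)

lemma fourier_coeff_inject:
  assumes "continuous_on UNIV f" "\<And>x. f (x + 1) = f x"
    and "continuous_on UNIV g" "\<And>x. g (x + 1) = g x"
    and "\<And>n. fourier_coeff f n = fourier_coeff g n"
  shows "f x = g x"
proof -
  have "(f - g) x = 0"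
  proof (rule fourier_coeff_0_imp_0[of "f - g"])
    show "continuous_on UNIV (f - g)"
      using continuous_on_diff[OF assms(1,3)] by (simp add: fun_diff_def)
    show "fourier_coeff (f - g) n = 0" for n by (simp only: fourier_coeff_diff assms diff_self)
  qed (simp add: assms)
  then show ?thesis by simp
qed

text \<open>The series is continuous and periodic and has the coefficients of f, so uniqueness
  identifies the two.\<close>

lemma fourier_inversion:
  assumes cont: "continuous_on UNIV f" and per: "\<And>x. f (x + 1) = f x"
    and sum: "(\<lambda>n. cmod (fourier_coeff f n)) summable_on UNIV"
  shows "of_real (f x) = fourier_series (fourier_coeff f) x"
proof -
  have "f x = Re (fourier_series (fourier_coeff f) x)"
    by (rule fourier_coeff_inject[of f "\<lambda>x. Re (fourier_series (fourier_coeff f) x)"])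
       (auto intro!: continuous_intros continuous_on_fourier_series
          simp: cont per sum fourier_series_periodic fourier_coeff_synthesis fourier_coeff_minus)
  then show ?thesis by (simp add: fourier_series_real[of "fourier_coeff f", OF fourier_coeff_minus])
qed

text \<open>The series of f is inserted into the coefficient integral of the product; its m-th basis
  function shifts the index of g to n - m.\<close>

lemma fourier_coeff_mult:
  assumes f: "continuous_on UNIV f" "\<And>x. f (x + 1) = f x" "(\<lambda>n. cmod (fourier_coeff f n)) summable_on UNIV"
    and g: "continuous_on UNIV g"
  shows "((\<lambda>m. fourier_coeff f m * fourier_coeff g (n - m)) has_sum fourier_coeff (f * g) n) UNIV"
proof -
  have "continuous_on {0..1} (\<lambda>x. of_real (g x) * fourier_basis (- n) x)"
    by (intro continuous_intros continuous_on_subset[OF g]) auto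
  from has_sum_integral_fourier_series[OF f(3) this]
  have "((\<lambda>m. fourier_coeff f m * integral {0..1} (\<lambda>x. fourier_basis m x * (of_real (g x) * fourier_basis (- n) x)))
      has_sum integral {0..1} (\<lambda>x. fourier_series (fourier_coeff f) x * (of_real (g x) * fourier_basis (- n) x))) UNIV" .
  moreover have "fourier_basis m x * (of_real (g x) * fourier_basis (- n) x) =
      of_real (g x) * fourier_basis (- (n - m)) x" for m x
    by (simp add: diff_conv_add_uminus fourier_basis_add del: add_uminus_conv_diff)
  ultimately show ?thesis
    by (simp add: fourier_coeff_eq[of g] fourier_coeff_eq[of "f * g"]
        fourier_inversion[OF f, symmetric] mult.assoc)
qed

text \<open>Integration by parts; the boundary terms cancel by periodicity.\<close>

lemma fourier_coeff_derivative:
  assumes per: "\<And>x. f (x + 1) = f x" and deriv: "\<And>x. (f has_real_derivative f' x) (at x)"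
    and cont: "continuous_on UNIV f'"
  shows "fourier_coeff f' n = 2 * pi * \<i> * of_int n * fourier_coeff f n"
proof -
  have contf: "continuous_on UNIV f"
    using DERIV_isCont[OF deriv] by (simp add: continuous_at_imp_continuous_on)
  have "((\<lambda>x. of_real (f x) * fourier_basis (- n) x) has_vector_derivative
      of_real (f x) * (2 * pi * \<i> * of_int (- n) * fourier_basis (- n) x) +
      of_real (f' x) * fourier_basis (- n) x) (at x within {0..1})" for x
    by (intro has_vector_derivative_mult fourier_basis_has_vector_derivative
        has_vector_derivative_of_real has_real_derivative_iff_has_vector_derivative[THEN iffD1]
        DERIV_subset[OF deriv] subset_UNIV)
  then have i1: "((\<lambda>x. of_real (f x) * (2 * pi * \<i> * of_int (- n) * fourier_basis (- n) x) +
      of_real (f' x) * fourier_basis (- n) x) has_integral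
      of_real (f 1) * fourier_basis (- n) 1 - of_real (f 0) * fourier_basis (- n) 0) {0..1}"
    by (intro fundamental_theorem_of_calculus) auto
  have z: "of_real (f 1) * fourier_basis (- n) 1 - of_real (f 0) * fourier_basis (- n) 0 = 0"
    using per[of 0] fourier_basis_periodic[of "- n" 0] by simp
  have i2: "((\<lambda>x. (2 * pi * \<i> * of_int (- n)) * (of_real (f x) * fourier_basis (- n) x) +
      of_real (f' x) * fourier_basis (- n) x) has_integral
      (2 * pi * \<i> * of_int (- n)) * fourier_coeff f n + fourier_coeff f' n) {0..1}"
    unfolding fourier_coeff_eq
    by (intro has_integral_add has_integral_mult_right integrable_integral fourier_coeff_integrable
        contf cont)
  have "(\<lambda>x. of_real (f x) * (2 * pi * \<i> * of_int (- n) * fourier_basis (- n) x) +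
      of_real (f' x) * fourier_basis (- n) x) =
      (\<lambda>x. (2 * pi * \<i> * of_int (- n)) * (of_real (f x) * fourier_basis (- n) x) +
      of_real (f' x) * fourier_basis (- n) x)"
    by (simp add: mult_ac)
  from has_integral_unique[OF i2 i1[unfolded this z]]
  have "(2 * pi * \<i> * of_int (- n)) * fourier_coeff f n + fourier_coeff f' n = 0" .
  then show ?thesis by simp
qed

subsection \<open>Weighted square-summable sequences\<close>

lemma infsum_Cauchy_Schwarz:
  fixes a b :: "'i \<Rightarrow> real"
  assumes nonneg: "\<And>i. 0 \<le> a i" "\<And>i. 0 \<le> b i"
    and a: "(\<lambda>i. (a i)\<^sup>2) summable_on UNIV" and b: "(\<lambda>i. (b i)\<^sup>2) summable_on UNIV"
  shows "(\<lambda>i. a i * b i) summable_on UNIV"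
    and "(\<Sum>\<^sub>\<infinity>i. a i * b i) \<le> sqrt (\<Sum>\<^sub>\<infinity>i. (a i)\<^sup>2) * sqrt (\<Sum>\<^sub>\<infinity>i. (b i)\<^sup>2)"
proof -
  have le: "(\<Sum>i\<in>F. a i * b i) \<le> sqrt (\<Sum>\<^sub>\<infinity>i. (a i)\<^sup>2) * sqrt (\<Sum>\<^sub>\<infinity>i. (b i)\<^sup>2)" if "finite F" for F
  proof -
    have "(\<Sum>i\<in>F. a i * b i) \<le> L2_set a F * L2_set b F"
      using L2_set_mult_ineq[of a b F] nonneg by simp
    also have "\<dots> \<le> sqrt (\<Sum>\<^sub>\<infinity>i. (a i)\<^sup>2) * sqrt (\<Sum>\<^sub>\<infinity>i. (b i)\<^sup>2)"
      unfolding L2_set_def using that a b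
      by (intro mult_mono real_sqrt_le_mono finite_sum_le_infsum)
         (auto intro: sum_nonneg infsum_nonneg)
    finally show ?thesis .
  qed
  show sum: "(\<lambda>i. a i * b i) summable_on UNIV"
    by (rule nonneg_bdd_above_summable_on) (use nonneg le in \<open>auto intro!: bdd_aboveI2\<close>)
  show "(\<Sum>\<^sub>\<infinity>i. a i * b i) \<le> sqrt (\<Sum>\<^sub>\<infinity>i. (a i)\<^sup>2) * sqrt (\<Sum>\<^sub>\<infinity>i. (b i)\<^sup>2)"
    by (rule infsum_le_finite_sums[OF sum le])
qed

lemma infsum_squares_le:
  fixes c :: "'i \<Rightarrow> real"
  assumes "\<And>F. finite F \<Longrightarrow> L2_set c F \<le> B"
  shows "(\<lambda>i. (c i)\<^sup>2) summable_on UNIV" and "sqrt (\<Sum>\<^sub>\<infinity>i. (c i)\<^sup>2) \<le> B"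
proof -
  have B: "B \<ge> 0" using assms[of "{}"] by simp
  have le: "(\<Sum>i\<in>F. (c i)\<^sup>2) \<le> B\<^sup>2" if "finite F" for F
    using assms[OF that] B by (simp add: L2_set_def real_le_lsqrt real_sqrt_le_iff sqrt_le_D)
  show sum: "(\<lambda>i. (c i)\<^sup>2) summable_on UNIV"
    by (rule nonneg_bdd_above_summable_on) (use le in \<open>auto intro!: bdd_aboveI2\<close>)
  show "sqrt (\<Sum>\<^sub>\<infinity>i. (c i)\<^sup>2) \<le> B"
    using infsum_le_finite_sums[OF sum le] B by (simp add: real_le_lsqrt infsum_nonneg)
qed

lemma L2_set_le_infsum:
  "(\<lambda>i. (c i)\<^sup>2) summable_on UNIV \<Longrightarrow> finite F \<Longrightarrow> L2_set c F \<le> sqrt (\<Sum>\<^sub>\<infinity>i. (c i)\<^sup>2)"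
  unfolding L2_set_def by (intro real_sqrt_le_mono finite_sum_le_infsum) auto

definition sobolev_weight :: "real \<Rightarrow> int \<Rightarrow> real" where
  "sobolev_weight r n = (1 + (of_int n)\<^sup>2) powr r"

lemma sobolev_weight_pos: "0 < sobolev_weight r n"
proof -
  have "(0::real) < 1 + (of_int n)\<^sup>2" by (rule add_pos_nonneg) auto
  then show ?thesis by (simp add: sobolev_weight_def)
qed

lemma sobolev_weight_mono: "r \<le> r' \<Longrightarrow> sobolev_weight r n \<le> sobolev_weight r' n"
  unfolding sobolev_weight_def by (rule powr_mono) auto

lemma sobolev_weight_add: "sobolev_weight (r + t) n = sobolev_weight r n * sobolev_weight t n"
  unfolding sobolev_weight_def by (rule powr_add)

lemma sobolev_weight_1: "sobolev_weight 1 n = 1 + (of_int n)\<^sup>2"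
  by (simp add: sobolev_weight_def add_nonneg_nonneg)

text \<open>From (m + k)^2 \<le> 2 m^2 + 2 k^2, the base for m + k is at most four times the larger
  of the two bases, and the larger weight is at most their sum.\<close>

lemma sobolev_weight_subadditive:
  assumes "r \<ge> 0"
  shows "sobolev_weight r (m + k) \<le> 4 powr r * (sobolev_weight r m + sobolev_weight r k)"
proof -
  define M :: real where "M = max (1 + (of_int m)\<^sup>2) (1 + (of_int k)\<^sup>2)"
  have M: "1 + (of_int m)\<^sup>2 \<le> M" "1 + (of_int k)\<^sup>2 \<le> M" by (auto simp: M_def)
  have "(of_int (m + k) :: real)\<^sup>2 \<le> 2 * (of_int m)\<^sup>2 + 2 * (of_int k)\<^sup>2"
    using zero_le_power2[of "of_int m - of_int k :: real"] by (simp add: power2_eq_square algebra_simps)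
  then have "1 + (of_int (m + k) :: real)\<^sup>2 \<le> 4 * M"
    using M by simp
  then have "sobolev_weight r (m + k) \<le> (4 * M) powr r"
    unfolding sobolev_weight_def by (intro powr_mono2 assms) auto
  also have "\<dots> = 4 powr r * M powr r" by (rule powr_mult)
  also have "M powr r \<le> sobolev_weight r m + sobolev_weight r k"
    using sobolev_weight_pos[of r m] sobolev_weight_pos[of r k]
    by (auto simp: M_def max_def sobolev_weight_def)
  finally show ?thesis by simp
qed

text \<open>Comparison with n^(-2r), whose exponent makes 1/2 the threshold; the integers are
  covered by the two half-lines.\<close>

lemma summable_inverse_sobolev_weight:
  assumes "r > 1/2"
  shows "(\<lambda>n. 1 / sobolev_weight r n) summable_on UNIV"
proof -
  have "summable (\<lambda>n::nat. 1 / sobolev_weight r (int n))"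
  proof (rule summable_comparison_test'[of "\<lambda>n::nat. real n powr (- 2 * r)" 1])
    show "summable (\<lambda>n::nat. real n powr (- 2 * r))" using assms by (simp add: summable_real_powr_iff)
    fix n :: nat assume n: "1 \<le> n"
    have "real n powr (2 * r) = ((real n)\<^sup>2) powr r"
      using n by (simp add: powr_powr[symmetric] powr_realpow)
    also have "\<dots> \<le> sobolev_weight r (int n)"
      unfolding sobolev_weight_def using assms by (intro powr_mono2) auto
    finally have "1 / sobolev_weight r (int n) \<le> 1 / real n powr (2 * r)"
      using n by (intro divide_left_mono mult_pos_pos sobolev_weight_pos) auto
    also have "\<dots> = real n powr (- 2 * r)" by (simp add: powr_minus_divide)
    finally show "norm (1 / sobolev_weight r (int n)) \<le> real n powr (- 2 * r)"
      using sobolev_weight_pos[of r "int n"] by simp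
  qed
  then have nat: "(\<lambda>n::nat. 1 / sobolev_weight r (int n)) summable_on UNIV"
    by (rule summable_nonneg_imp_summable_on) (simp add: sobolev_weight_pos less_imp_le)
  have "(\<lambda>n. 1 / sobolev_weight r n) summable_on range int"
    using nat by (subst summable_on_reindex) (auto simp: o_def)
  moreover have "(\<lambda>n. 1 / sobolev_weight r n) summable_on range (\<lambda>n. - int n)"
    using nat by (subst summable_on_reindex) (auto simp: o_def sobolev_weight_def inj_def)
  ultimately have "(\<lambda>n. 1 / sobolev_weight r n) summable_on (range int \<union> range (\<lambda>n. - int n))"
    by (rule summable_on_union)
  moreover have "range int \<union> range (\<lambda>n. - int n) = UNIV"
    by (auto simp: image_iff) (metis int_cases2)
  ultimately show ?thesis by simp
qed

subsection \<open>Sobolev spaces\<close>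

text \<open>Continuity already gives measurability and square integrability over a period, so of
  \<open>circle_L2\<close> only the periodicity remains.\<close>

lemma mem_sobolev_iff:
  "f \<in> vecs (sobolev r) \<longleftrightarrow> continuous_on UNIV f \<and> (\<forall>x. f (x + 1) = f x) \<and>
     (\<lambda>n. sobolev_weight r n * (cmod (fourier_coeff f n))\<^sup>2) summable_on UNIV"
proof -
  have "f \<in> circle_L2" if "continuous_on UNIV f" "\<forall>x. f (x + 1) = f x"
  proof -
    have "(\<lambda>x. (f x)\<^sup>2) integrable_on {0..1}"
      by (intro integrable_continuous_real continuous_intros continuous_on_subset[OF that(1)]) auto
    moreover have "f \<in> borel_measurable lebesgue"
      using borel_measurable_continuous_onI[OF that(1)] by (auto intro: measurable_completion)
    ultimately show ?thesis using that by (simp add: circle_L2_def)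
  qed
  then show ?thesis
    by (auto simp: sobolev_def sobolev_weight_def circle_L2_def)
qed

lemma sobolev_continuous: "f \<in> vecs (sobolev r) \<Longrightarrow> continuous_on S f"
  and sobolev_periodic: "f \<in> vecs (sobolev r) \<Longrightarrow> f (x + 1) = f x"
  by (auto simp: mem_sobolev_iff intro: continuous_on_subset)

text \<open>The Sobolev norm is the plain l2 norm of this sequence, so Minkowski and Cauchy-Schwarz
  apply without weights.\<close>

definition weighted_coeff :: "real \<Rightarrow> (real \<Rightarrow> real) \<Rightarrow> int \<Rightarrow> real" where
  "weighted_coeff r f n = sqrt (sobolev_weight r n) * cmod (fourier_coeff f n)"

lemma weighted_coeff_nonneg: "0 \<le> weighted_coeff r f n"
  using sobolev_weight_pos[of r n] by (simp add: weighted_coeff_def)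

lemma weighted_coeff_squared:
  "(weighted_coeff r f n)\<^sup>2 = sobolev_weight r n * (cmod (fourier_coeff f n))\<^sup>2"
  using sobolev_weight_pos[of r n] by (simp add: weighted_coeff_def power_mult_distrib)

lemma mem_sobolev_iff':
  "f \<in> vecs (sobolev r) \<longleftrightarrow> continuous_on UNIV f \<and> (\<forall>x. f (x + 1) = f x) \<and>
     (\<lambda>n. (weighted_coeff r f n)\<^sup>2) summable_on UNIV"
  by (simp add: mem_sobolev_iff weighted_coeff_squared)

lemma nrm_sobolev: "nrm (sobolev r) f = sqrt (\<Sum>\<^sub>\<infinity>n. (weighted_coeff r f n)\<^sup>2)"
  by (simp add: sobolev_def weighted_coeff_squared sobolev_weight_def)

lemma nrm_sobolev_nonneg: "0 \<le> nrm (sobolev r) f"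
  unfolding nrm_sobolev by (intro real_sqrt_ge_zero infsum_nonneg) simp

lemma nrm_sobolev_squared:
  "(nrm (sobolev r) f)\<^sup>2 = (\<Sum>\<^sub>\<infinity>n. sobolev_weight r n * (cmod (fourier_coeff f n))\<^sup>2)"
  unfolding nrm_sobolev weighted_coeff_squared
  using sobolev_weight_pos[of r] by (intro real_sqrt_pow2 infsum_nonneg) (simp add: less_imp_le)

lemma L2_set_le_nrm_sobolev:
  "f \<in> vecs (sobolev r) \<Longrightarrow> finite F \<Longrightarrow> L2_set (weighted_coeff r f) F \<le> nrm (sobolev r) f"
  unfolding nrm_sobolev mem_sobolev_iff' by (intro L2_set_le_infsum) auto

text \<open>Membership and norm bound are both read off uniform bounds on finite sections. Triangle
  inequalities and limits are easy for finite sections, and no summability has to be known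
  beforehand.\<close>

lemma mem_sobolevI:
  assumes "continuous_on UNIV f" "\<And>x. f (x + 1) = f x"
    and "\<And>F. finite F \<Longrightarrow> L2_set (weighted_coeff r f) F \<le> B"
  shows "f \<in> vecs (sobolev r)" "nrm (sobolev r) f \<le> B"
  using infsum_squares_le[OF assms(3)] assms(1,2) by (auto simp: mem_sobolev_iff' nrm_sobolev)

lemma normed_subspace_sobolev: "normed_subspace (sobolev r)"
proof
  have scale: "c *\<^sub>R f \<in> vecs (sobolev r) \<and> nrm (sobolev r) (c *\<^sub>R f) = \<bar>c\<bar> * nrm (sobolev r) f"
    if f: "f \<in> vecs (sobolev r)" for c f
  proof -
    have eq: "(weighted_coeff r (c *\<^sub>R f) n)\<^sup>2 = c\<^sup>2 * (weighted_coeff r f n)\<^sup>2" for n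
      by (simp add: weighted_coeff_squared fourier_coeff_scaleR norm_mult power_mult_distrib)
    have "(\<lambda>n. c\<^sup>2 * (weighted_coeff r f n)\<^sup>2) summable_on UNIV"
      using f by (intro summable_on_cmult_right) (simp add: mem_sobolev_iff')
    then have "c *\<^sub>R f \<in> vecs (sobolev r)"
      using f unfolding mem_sobolev_iff' eq by (auto simp: scaleR_fun_def intro!: continuous_intros)
    moreover have "nrm (sobolev r) (c *\<^sub>R f) = \<bar>c\<bar> * nrm (sobolev r) f"
      unfolding nrm_sobolev eq by (simp add: infsum_cmult_right' real_sqrt_mult)
    ultimately show ?thesis by blast
  qed
  have add: "f + g \<in> vecs (sobolev r) \<and> nrm (sobolev r) (f + g) \<le> nrm (sobolev r) f + nrm (sobolev r) g"
    if f: "f \<in> vecs (sobolev r)" and g: "g \<in> vecs (sobolev r)" for f g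
  proof -
    have "L2_set (weighted_coeff r (f + g)) F \<le> nrm (sobolev r) f + nrm (sobolev r) g" if "finite F" for F
    proof -
      have "L2_set (weighted_coeff r (f + g)) F \<le> L2_set (\<lambda>n. weighted_coeff r f n + weighted_coeff r g n) F"
      proof (intro L2_set_mono weighted_coeff_nonneg)
        fix n
        have "cmod (fourier_coeff (f + g) n) \<le> cmod (fourier_coeff f n) + cmod (fourier_coeff g n)"
          using f g by (subst fourier_coeff_add) (auto simp: sobolev_continuous norm_triangle_ineq)
        then show "weighted_coeff r (f + g) n \<le> weighted_coeff r f n + weighted_coeff r g n"
          unfolding weighted_coeff_def distrib_left[symmetric]
          using sobolev_weight_pos[of r n] by (intro mult_left_mono) auto
      qed
      also have "\<dots> \<le> L2_set (weighted_coeff r f) F + L2_set (weighted_coeff r g) F"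
        by (rule L2_set_triangle_ineq)
      also have "\<dots> \<le> nrm (sobolev r) f + nrm (sobolev r) g"
        using L2_set_le_nrm_sobolev[OF f that] L2_set_le_nrm_sobolev[OF g that] by (rule add_mono)
      finally show ?thesis .
    qed
    moreover have "continuous_on UNIV (f + g)"
      using continuous_on_add[OF sobolev_continuous[OF f] sobolev_continuous[OF g]]
      by (simp add: plus_fun_def)
    moreover have "(f + g) (x + 1) = (f + g) x" for x
      using sobolev_periodic[OF f] sobolev_periodic[OF g] by simp
    ultimately show ?thesis by (intro conjI mem_sobolevI)
  qed
  have "fourier_coeff 0 n = 0" for n by (simp add: fourier_coeff_eq)
  then have "0 \<in> vecs (sobolev r)"
    by (simp add: mem_sobolev_iff zero_fun_def)
  then show "subspace (vecs (sobolev r))" 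
    by (rule subspaceI) (erule (1) conjunct1[OF add], erule conjunct1[OF scale])
  show "0 \<le> nrm (sobolev r) f" for f
    by (rule nrm_sobolev_nonneg)
  show "nrm (sobolev r) (f + g) \<le> nrm (sobolev r) f + nrm (sobolev r) g"
    if "f \<in> vecs (sobolev r)" "g \<in> vecs (sobolev r)" for f g
    by (rule conjunct2[OF add[OF that]])
  show "nrm (sobolev r) (c *\<^sub>R f) = \<bar>c\<bar> * nrm (sobolev r) f" if "f \<in> vecs (sobolev r)" for c f
    by (rule conjunct2[OF scale[OF that]])
qed

text \<open>For r > 1/2 its square root is the constant with which H^r embeds into the absolutely
  convergent Fourier series, and hence into the bounded functions.\<close>

definition weight_sum :: "real \<Rightarrow> real" where
  "weight_sum r = (\<Sum>\<^sub>\<infinity>n. 1 / sobolev_weight r n)"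

lemma weight_sum_ge_1:
  assumes "r > 1/2"
  shows "1 \<le> weight_sum r"
proof -
  have "(\<Sum>n\<in>{0}. 1 / sobolev_weight r n) \<le> weight_sum r"
    unfolding weight_sum_def using sobolev_weight_pos
    by (intro finite_sum_le_infsum summable_inverse_sobolev_weight assms) (auto simp: less_imp_le)
  then show ?thesis by (simp add: sobolev_weight_def)
qed

text \<open>Cauchy-Schwarz for the weighted coefficients against the inverse square roots of the
  weights.\<close>

lemma sobolev_fourier_summable:
  assumes r: "r > 1/2" and f: "f \<in> vecs (sobolev r)"
  shows "(\<lambda>n. cmod (fourier_coeff f n)) summable_on UNIV"
    and "(\<Sum>\<^sub>\<infinity>n. cmod (fourier_coeff f n)) \<le> sqrt (weight_sum r) * nrm (sobolev r) f"
proof -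
  define b where "b n = 1 / sqrt (sobolev_weight r n)" for n
  have b2: "(b n)\<^sup>2 = 1 / sobolev_weight r n" for n
    using sobolev_weight_pos[of r n] by (simp add: b_def power_divide)
  have ab: "weighted_coeff r f n * b n = cmod (fourier_coeff f n)" for n
    using sobolev_weight_pos[of r n] by (simp add: weighted_coeff_def b_def)
  have b0: "0 \<le> b n" for n using sobolev_weight_pos[of r n] by (simp add: b_def)
  note CS = infsum_Cauchy_Schwarz[of "weighted_coeff r f" b, OF weighted_coeff_nonneg b0]
  have a: "(\<lambda>n. (weighted_coeff r f n)\<^sup>2) summable_on UNIV" using f by (simp add: mem_sobolev_iff')
  have b: "(\<lambda>n. (b n)\<^sup>2) summable_on UNIV"
    unfolding b2 by (rule summable_inverse_sobolev_weight[OF r])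
  show "(\<lambda>n. cmod (fourier_coeff f n)) summable_on UNIV" using CS(1)[OF a b] by (simp add: ab)
  show "(\<Sum>\<^sub>\<infinity>n. cmod (fourier_coeff f n)) \<le> sqrt (weight_sum r) * nrm (sobolev r) f"
    using CS(2)[OF a b] unfolding ab b2 nrm_sobolev weight_sum_def by (subst mult.commute)
qed

lemma sobolev_fourier_inversion:
  "r > 1/2 \<Longrightarrow> f \<in> vecs (sobolev r) \<Longrightarrow> of_real (f x) = fourier_series (fourier_coeff f) x"
  by (intro fourier_inversion sobolev_fourier_summable(1) sobolev_continuous sobolev_periodic)

lemma sobolev_sup_bound:
  assumes r: "r > 1/2" and f: "f \<in> vecs (sobolev r)"
  shows "\<bar>f x\<bar> \<le> sqrt (weight_sum r) * nrm (sobolev r) f"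
proof -
  have "\<bar>f x\<bar> = cmod (fourier_series (fourier_coeff f) x)"
    using sobolev_fourier_inversion[OF r f, of x] by (metis norm_of_real)
  also have "\<dots> \<le> (\<Sum>\<^sub>\<infinity>n. cmod (fourier_coeff f n))"
  proof (rule norm_infsum_le)
    have "(\<lambda>n. fourier_coeff f n * fourier_basis n x) summable_on UNIV"
      by (rule abs_summable_summable) (simp add: norm_mult sobolev_fourier_summable(1)[OF r f])
    then show "((\<lambda>n. fourier_coeff f n * fourier_basis n x) has_sum
        fourier_series (fourier_coeff f) x) UNIV"
      unfolding fourier_series_def by (rule has_sum_infsum)
    show "((\<lambda>n. cmod (fourier_coeff f n)) has_sum (\<Sum>\<^sub>\<infinity>n. cmod (fourier_coeff f n))) UNIV"
      by (rule has_sum_infsum[OF sobolev_fourier_summable(1)[OF r f]])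
  qed (simp add: norm_mult)
  finally show ?thesis using sobolev_fourier_summable(2)[OF r f] by linarith
qed

lemma one_mem_sobolev: "1 \<in> vecs (sobolev r)"
proof -
  have eq: "sobolev_weight r n * (cmod (fourier_coeff 1 n))\<^sup>2 = (if n = 0 then 1 else 0)" for n
    using fourier_coeff_const[of 1 n] by (simp add: one_fun_def sobolev_weight_def)
  have "finite {n::int. (if n = 0 then 1 else 0 :: real) \<noteq> 0}" by simp
  then show ?thesis
    unfolding mem_sobolev_iff eq
    by (auto simp: one_fun_def intro!: finite_nonzero_values_imp_summable_on)
qed

text \<open>
  The weights satisfy \<open>w (m + k) / (w m * w k) \<le> C * (1 / w m + 1 / w k)\<close>, so
  Cauchy-Schwarz bounds \<open>w n\<close> times the square of the \<open>n\<close>-th coefficient of a product by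
  the convolution of the weighted squares, which is summable.
\<close>

lemma sobolev_mult:
  assumes r: "r > 1/2" and f: "f \<in> vecs (sobolev r)" and g: "g \<in> vecs (sobolev r)"
  defines "C \<equiv> 2 * 4 powr r * weight_sum r"
  shows "f * g \<in> vecs (sobolev r)"
    and "nrm (sobolev r) (f * g) \<le> sqrt C * nrm (sobolev r) f * nrm (sobolev r) g"
proof -
  define w where "w = sobolev_weight r"
  define a where "a = weighted_coeff r f"
  define b where "b = weighted_coeff r g"
  have w: "w n > 0" for n by (simp add: w_def sobolev_weight_pos)
  have a: "a n \<ge> 0" "(\<lambda>n. (a n)\<^sup>2) summable_on UNIV"
    and b: "b n \<ge> 0" "(\<lambda>n. (b n)\<^sup>2) summable_on UNIV" for n
    using f g by (simp_all add: a_def b_def weighted_coeff_nonneg mem_sobolev_iff')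
  have shift: "bij_betw (\<lambda>m::int. n - m) UNIV UNIV" "bij_betw (\<lambda>m::int. m - n) UNIV UNIV" for n
    by (auto intro: bij_betwI[of _ _ _ "\<lambda>m. n - m"] bij_betwI[of _ _ _ "\<lambda>m. m + n"])
  let ?S = "(nrm (sobolev r) f)\<^sup>2 * (nrm (sobolev r) g)\<^sup>2"
  have S: "?S = (\<Sum>\<^sub>\<infinity>n. (a n)\<^sup>2) * (\<Sum>\<^sub>\<infinity>n. (b n)\<^sup>2)"
    by (simp add: nrm_sobolev_squared weighted_coeff_squared a_def b_def)
  define conv where "conv n = (\<Sum>\<^sub>\<infinity>m. (a m)\<^sup>2 * (b (n - m))\<^sup>2)" for n
  \<comment> \<open>The double series over (m, n) is summed over n first, where the shift invariance
    of the sum splits off a product. After swapping, summation over m gives \<open>conv\<close>,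
    which thereby has the product as its total.\<close>
  have rows: "((\<lambda>n. (a m)\<^sup>2 * (b (n - m))\<^sup>2) has_sum (a m)\<^sup>2 * (\<Sum>\<^sub>\<infinity>n. (b n)\<^sup>2)) UNIV" for m
  proof (intro has_sum_cmult_right)
    show "((\<lambda>n. (b (n - m))\<^sup>2) has_sum (\<Sum>\<^sub>\<infinity>n. (b n)\<^sup>2)) UNIV"
      using has_sum_reindex_bij_betw[OF shift(2)[of m], of "\<lambda>n. (b n)\<^sup>2"] has_sum_infsum[OF b(2)]
      by blast
  qed
  have col: "((\<lambda>m. (a m)\<^sup>2 * (\<Sum>\<^sub>\<infinity>n. (b n)\<^sup>2)) has_sum ?S) UNIV"
    unfolding S by (intro has_sum_cmult_left has_sum_infsum a)
  have dsum: "(\<lambda>(m, n). (a m)\<^sup>2 * (b (n - m))\<^sup>2) summable_on UNIV \<times> UNIV"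
    by (rule summable_on_SigmaI[where g = "\<lambda>m. (a m)\<^sup>2 * (\<Sum>\<^sub>\<infinity>n. (b n)\<^sup>2)"])
       (use rows has_sum_imp_summable[OF col] in auto)
  have "((\<lambda>(m, n). (a m)\<^sup>2 * (b (n - m))\<^sup>2) has_sum ?S) (UNIV \<times> UNIV)"
    by (rule has_sum_SigmaI[OF _ col dsum]) (use rows in auto)
  then have double: "((\<lambda>(n, m). (a m)\<^sup>2 * (b (n - m))\<^sup>2) has_sum ?S) (UNIV \<times> UNIV)"
    by (subst (asm) has_sum_swap) (simp add: case_prod_unfold)
  have fibre: "(\<lambda>m. (a m)\<^sup>2 * (b (n - m))\<^sup>2) summable_on UNIV" for n
    using summable_on_SigmaD1[OF has_sum_imp_summable[OF double], of n] by simp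
  have conv: "(conv has_sum ?S) UNIV"
    by (rule has_sum_SigmaD[OF double]) (use fibre in \<open>auto simp: conv_def\<close>)
  have bound: "(weighted_coeff r (f * g) n)\<^sup>2 \<le> C * conv n" for n
  proof -
    \<comment> \<open>What remains when the weights are divided out:
      \<open>a m * b (n - m) * d m\<close> is the modulus of the m-th term of the convolution.
      Cauchy-Schwarz separates the first two factors from \<open>d\<close>.\<close>
    define d where "d m = 1 / sqrt (w m * w (n - m))" for m
    have d0: "d m \<ge> 0" for m using w by (simp add: d_def less_imp_le)
    have d2: "(d m)\<^sup>2 = 1 / (w m * w (n - m))" for m
      using w[of m] w[of "n - m"] by (simp add: d_def power_divide)
    have d_le: "w n * (d m)\<^sup>2 \<le> 4 powr r * (1 / w m + 1 / w (n - m))" for m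
    proof -
      have "w n \<le> 4 powr r * (w m + w (n - m))"
        using sobolev_weight_subadditive[of r m "n - m"] r by (simp add: w_def)
      then have "w n * (d m)\<^sup>2 \<le> 4 powr r * (w m + w (n - m)) * (d m)\<^sup>2" by (rule mult_right_mono) auto
      also have "\<dots> = 4 powr r * (1 / w m + 1 / w (n - m))"
        unfolding d2 using w[of m] w[of "n - m"] by (simp add: field_simps)
      finally show ?thesis .
    qed
    \<comment> \<open>Both reciprocal weights have the same total by translation and reflection,
      which is the factor 2 in \<open>C\<close>.\<close>
    have wsum: "((\<lambda>m. 1 / w m) has_sum weight_sum r) UNIV"
      unfolding w_def weight_sum_def by (intro has_sum_infsum summable_inverse_sobolev_weight r)
    then have "((\<lambda>m. 1 / w (n - m)) has_sum weight_sum r) UNIV"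
      using has_sum_reindex_bij_betw[OF shift(1)[of n], of "\<lambda>m. 1 / w m"] by blast
    from has_sum_cmult_right[OF has_sum_add[OF wsum this], of "4 powr r"]
    have maj: "((\<lambda>m. 4 powr r * (1 / w m + 1 / w (n - m))) has_sum C) UNIV"
      by (simp add: C_def mult_ac)
    have wd: "(\<lambda>m. w n * (d m)\<^sup>2) summable_on UNIV"
      by (rule summable_on_comparison_test[OF has_sum_imp_summable[OF maj] d_le])
         (use w[of n] in \<open>auto simp: less_imp_le\<close>)
    have ds: "(\<lambda>m. (d m)\<^sup>2) summable_on UNIV"
      using summable_on_cmult_right[OF wd, of "1 / w n"] w[of n] by simp
    have wdC: "w n * (\<Sum>\<^sub>\<infinity>m. (d m)\<^sup>2) \<le> C"
      using infsum_mono[OF wd has_sum_imp_summable[OF maj] d_le] infsumI[OF maj]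
      by (simp add: infsum_cmult_right')
    have e2: "(a m * b (n - m))\<^sup>2 = (a m)\<^sup>2 * (b (n - m))\<^sup>2" for m by (simp add: power_mult_distrib)
    have ed: "(a m * b (n - m)) * d m = cmod (fourier_coeff f m * fourier_coeff g (n - m))" for m
      using w[of m] w[of "n - m"]
      by (simp add: a_def b_def weighted_coeff_def d_def w_def[symmetric] norm_mult real_sqrt_mult field_simps)
    have abn: "0 \<le> a m * b (n - m)" for m using a b by simp
    note CS = infsum_Cauchy_Schwarz[of "\<lambda>m. a m * b (n - m)" d, OF abn d0, unfolded e2, OF fibre ds]
    have "cmod (fourier_coeff (f * g) n) \<le> (\<Sum>\<^sub>\<infinity>m. (a m * b (n - m)) * d m)"
    proof (rule norm_infsum_le)
      show "((\<lambda>m. fourier_coeff f m * fourier_coeff g (n - m)) has_sum fourier_coeff (f * g) n) UNIV"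
        using r f g by (intro fourier_coeff_mult sobolev_continuous sobolev_periodic sobolev_fourier_summable)
      show "((\<lambda>m. (a m * b (n - m)) * d m) has_sum (\<Sum>\<^sub>\<infinity>m. (a m * b (n - m)) * d m)) UNIV"
        by (rule has_sum_infsum[OF CS(1)])
    qed (simp add: ed)
    also have "\<dots> \<le> sqrt (conv n) * sqrt (\<Sum>\<^sub>\<infinity>m. (d m)\<^sup>2)"
      using CS(2) by (simp add: conv_def)
    finally have "(cmod (fourier_coeff (f * g) n))\<^sup>2 \<le> (sqrt (conv n) * sqrt (\<Sum>\<^sub>\<infinity>m. (d m)\<^sup>2))\<^sup>2"
      by (rule power_mono) simp
    also have "\<dots> = conv n * (\<Sum>\<^sub>\<infinity>m. (d m)\<^sup>2)"
      by (simp add: power_mult_distrib conv_def infsum_nonneg)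
    finally have "(weighted_coeff r (f * g) n)\<^sup>2 \<le> w n * (conv n * (\<Sum>\<^sub>\<infinity>m. (d m)\<^sup>2))"
      unfolding weighted_coeff_squared w_def[symmetric] using w[of n] by (intro mult_left_mono) auto
    also have "\<dots> = (w n * (\<Sum>\<^sub>\<infinity>m. (d m)\<^sup>2)) * conv n" by simp
    also have "\<dots> \<le> C * conv n"
      using wdC by (intro mult_right_mono) (auto simp: conv_def intro!: infsum_nonneg)
    finally show ?thesis .
  qed
  have Cconv: "((\<lambda>n. C * conv n) has_sum C * ?S) UNIV" by (rule has_sum_cmult_right[OF conv])
  have sum: "(\<lambda>n. (weighted_coeff r (f * g) n)\<^sup>2) summable_on UNIV"
    by (rule summable_on_comparison_test[OF has_sum_imp_summable[OF Cconv] bound]) simp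
  show "f * g \<in> vecs (sobolev r)"
    unfolding mem_sobolev_iff'
    using sum continuous_on_mult[OF sobolev_continuous[OF f] sobolev_continuous[OF g]]
      sobolev_periodic[OF f] sobolev_periodic[OF g] by (auto simp: times_fun_def)
  have "(nrm (sobolev r) (f * g))\<^sup>2 \<le> C * ?S"
    using infsum_mono[OF sum has_sum_imp_summable[OF Cconv] bound] infsumI[OF Cconv]
    by (simp add: nrm_sobolev_squared weighted_coeff_squared)
  also have "\<dots> = (sqrt C * nrm (sobolev r) f * nrm (sobolev r) g)\<^sup>2"
    using weight_sum_ge_1[OF r] by (simp add: C_def power_mult_distrib)
  finally have "(nrm (sobolev r) (f * g))\<^sup>2 \<le> (sqrt C * nrm (sobolev r) f * nrm (sobolev r) g)\<^sup>2" .
  moreover have "C \<ge> 0" using weight_sum_ge_1[OF r] by (simp add: C_def)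
  ultimately show "nrm (sobolev r) (f * g) \<le> sqrt C * nrm (sobolev r) f * nrm (sobolev r) g"
    by (elim power2_le_imp_le) (intro mult_nonneg_nonneg real_sqrt_ge_zero nrm_sobolev_nonneg)
qed

text \<open>By the inequality 2 |c| \<le> w |c|^2 + 1 / w. It concerns bare coefficient sequences,
  so it is available before a function with these coefficients has been constructed.\<close>

lemma weighted_summable_imp_summable:
  assumes r: "r > 1/2" and c: "(\<lambda>n. sobolev_weight r n * (cmod (c n))\<^sup>2) summable_on UNIV"
  shows "(\<lambda>n. cmod (c n)) summable_on UNIV"
proof (rule summable_on_comparison_test)
  show "(\<lambda>n. sobolev_weight r n * (cmod (c n))\<^sup>2 + 1 / sobolev_weight r n) summable_on UNIV"
    by (rule summable_on_add[OF c summable_inverse_sobolev_weight[OF r]])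
  fix n
  have w: "sobolev_weight r n > 0" by (rule sobolev_weight_pos)
  have "0 \<le> (sobolev_weight r n * cmod (c n) - 1)\<^sup>2" by simp
  also have "\<dots> = sobolev_weight r n *
      (sobolev_weight r n * (cmod (c n))\<^sup>2 + 1 / sobolev_weight r n - 2 * cmod (c n))"
    using w by (simp add: power2_eq_square algebra_simps)
  finally have "2 * cmod (c n) \<le> sobolev_weight r n * (cmod (c n))\<^sup>2 + 1 / sobolev_weight r n"
    using w by (simp add: zero_le_mult_iff)
  then show "cmod (c n) \<le> sobolev_weight r n * (cmod (c n))\<^sup>2 + 1 / sobolev_weight r n"
    using norm_ge_zero[of "c n"] by linarith
qed simp

lemma fourier_coeff_uniform_limit:
  assumes "\<And>N. continuous_on UNIV (P N)" "uniform_limit UNIV P f sequentially"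
  shows "(\<lambda>N. fourier_coeff (P N) n) \<longlonglongrightarrow> fourier_coeff f n"
proof -
  have "uniform_limit {0..1} (\<lambda>N x. of_real (P N x) * fourier_basis (- n) x)
      (\<lambda>x. of_real (f x) * fourier_basis (- n) x) sequentially"
    unfolding uniform_limit_iff
  proof (intro allI impI)
    fix e :: real assume "e > 0"
    with assms(2) have "\<forall>\<^sub>F N in sequentially. \<forall>x\<in>UNIV. dist (P N x) (f x) < e"
      unfolding uniform_limit_iff by blast
    then show "\<forall>\<^sub>F N in sequentially. \<forall>x\<in>{0..1}. dist (of_real (P N x) * fourier_basis (- n) x)
        (of_real (f x) * fourier_basis (- n) x) < e"
      unfolding dist_norm left_diff_distrib[symmetric] of_real_diff[symmetric] norm_mult norm_of_real
        norm_fourier_basis by (rule eventually_mono) simp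
  qed
  moreover have "continuous_on {0..1} (\<lambda>x. of_real (P N x) * fourier_basis (- n) x)" for N
    by (intro continuous_intros continuous_on_subset[OF assms(1)]) auto
  ultimately obtain I J where IJ:
      "\<And>N. ((\<lambda>x. of_real (P N x) * fourier_basis (- n) x) has_integral I N) {0..1}"
      "((\<lambda>x. of_real (f x) * fourier_basis (- n) x) has_integral J) {0..1}"
      "(I \<longlongrightarrow> J) sequentially"
    by (rule uniform_limit_integral) auto
  show ?thesis
    using IJ(3) unfolding fourier_coeff_eq integral_unique[OF IJ(1)] integral_unique[OF IJ(2)] .
qed

text \<open>A Fatou argument: Fourier coefficients pass to uniform limits, hence so does each finite
  section of the norm. Applied to partial sums, it provides the completeness of H^r.\<close>

lemma sobolev_uniform_limit:
  assumes P: "\<And>N. P N \<in> vecs (sobolev r)" "\<And>N. nrm (sobolev r) (P N) \<le> B"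
    and lim: "uniform_limit UNIV P f sequentially"
  shows "f \<in> vecs (sobolev r)" "nrm (sobolev r) f \<le> B"
proof -
  have c: "continuous_on UNIV f"
    by (rule uniform_limit_theorem[OF _ lim])
       (auto intro!: always_eventually sobolev_continuous[OF P(1)])
  have p: "f (x + 1) = f x" for x
  proof (rule LIMSEQ_unique)
    show "(\<lambda>N. P N (x + 1)) \<longlonglongrightarrow> f (x + 1)" by (rule tendsto_uniform_limitI[OF lim]) simp
    show "(\<lambda>N. P N (x + 1)) \<longlonglongrightarrow> f x"
      unfolding sobolev_periodic[OF P(1)] by (rule tendsto_uniform_limitI[OF lim]) simp
  qed
  have l: "L2_set (weighted_coeff r f) F \<le> B" if "finite F" for F
  proof (rule tendsto_upperbound)
    show "((\<lambda>N. L2_set (weighted_coeff r (P N)) F) \<longlongrightarrow> L2_set (weighted_coeff r f) F) sequentially"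
      unfolding L2_set_def weighted_coeff_def
      by (intro tendsto_intros fourier_coeff_uniform_limit[OF _ lim] sobolev_continuous[OF P(1)])
    show "\<forall>\<^sub>F N in sequentially. L2_set (weighted_coeff r (P N)) F \<le> B"
      by (rule always_eventually, rule allI, rule order_trans[OF L2_set_le_nrm_sobolev[OF P(1) that] P(2)])
  qed simp
  show "f \<in> vecs (sobolev r)" "nrm (sobolev r) f \<le> B"
    using mem_sobolevI[of f r B, OF c p l] by simp_all
qed

text \<open>The constant of \<open>sobolev_mult\<close>. It also dominates
  \<open>sqrt (weight_sum r)\<close>, so it can serve for the embedding into bounded
  functions.\<close>

definition sobolev_const :: "real \<Rightarrow> real" where
  "sobolev_const r = sqrt (2 * 4 powr r * weight_sum r)"

lemma function_algebra_sobolev: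
  assumes r: "r > 1/2"
  shows "function_algebra (sobolev r) (sobolev_const r)"
proof -
  interpret normed_subspace "sobolev r" by (rule normed_subspace_sobolev)
  have W: "1 \<le> weight_sum r" by (rule weight_sum_ge_1[OF r])
  have "1 \<le> (4::real) powr r" using r by (intro ge_one_powr_ge_zero) auto
  then have "weight_sum r \<le> 2 * 4 powr r * weight_sum r"
    using W mult_right_mono[of 1 "2 * 4 powr r" "weight_sum r"] by linarith
  then have K: "sqrt (weight_sum r) \<le> sobolev_const r"
    unfolding sobolev_const_def by (rule real_sqrt_le_mono)
  have K1: "1 \<le> sobolev_const r" using K W real_sqrt_ge_one[OF W] by linarith
  have sup: "\<bar>f x\<bar> \<le> sobolev_const r * nrm (sobolev r) f" if "f \<in> vecs (sobolev r)" for f x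
    using sobolev_sup_bound[OF r that, of x] mult_right_mono[OF K nrm_nonneg[of f]] by linarith
  have series: "(\<lambda>x. \<Sum>k. F k x) \<in> vecs (sobolev r) \<and>
      nrm (sobolev r) (\<lambda>x. \<Sum>k. F k x) \<le> (\<Sum>k. nrm (sobolev r) (F k))"
    if F: "\<And>k::nat. F k \<in> vecs (sobolev r)" and s: "summable (\<lambda>k. nrm (sobolev r) (F k))" for F
  proof -
    define P where "P N = (\<Sum>k<N. F k)" for N
    have P_apply: "P N x = (\<Sum>k<N. F k x)" for N x by (induction N) (auto simp: P_def)
    have "P N \<in> vecs (sobolev r)" for N unfolding P_def by (intro mem_sum F)
    moreover have "nrm (sobolev r) (P N) \<le> (\<Sum>k. nrm (sobolev r) (F k))" for N
      unfolding P_def using nrm_sum[of "{..<N}" F, OF F] sum_le_suminf[OF s, of "{..<N}"] nrm_nonneg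
      by (meson finite_lessThan order_trans)
    moreover have "uniform_limit UNIV P (\<lambda>x. \<Sum>k. F k x) sequentially"
      unfolding P_apply[abs_def]
      by (rule Weierstrass_m_test[where M = "\<lambda>k. sobolev_const r * nrm (sobolev r) (F k)"])
         (auto intro!: sup F summable_mult s)
    ultimately show ?thesis
      using sobolev_uniform_limit[of P r "\<Sum>k. nrm (sobolev r) (F k)" "\<lambda>x. \<Sum>k. F k x"] by simp
  qed
  show ?thesis
  proof
    show "f * g \<in> vecs (sobolev r)" if "f \<in> vecs (sobolev r)" "g \<in> vecs (sobolev r)" for f g
      by (rule sobolev_mult(1)[OF r that])
    show "nrm (sobolev r) (f * g) \<le> sobolev_const r * nrm (sobolev r) f * nrm (sobolev r) g"
      if "f \<in> vecs (sobolev r)" "g \<in> vecs (sobolev r)" for f g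
      using sobolev_mult(2)[OF r that] by (simp add: sobolev_const_def)
    show "(\<lambda>x. \<Sum>k. F k x) \<in> vecs (sobolev r)"
      and "nrm (sobolev r) (\<lambda>x. \<Sum>k. F k x) \<le> (\<Sum>k. nrm (sobolev r) (F k))"
      if "\<And>k::nat. F k \<in> vecs (sobolev r)" "summable (\<lambda>k. nrm (sobolev r) (F k))" for F
      using series[OF that] by simp_all
    show "\<bar>f x\<bar> \<le> sobolev_const r * nrm (sobolev r) f" if "f \<in> vecs (sobolev r)" for f x
      by (rule sup[OF that])
  qed (fact K1 one_mem_sobolev)+
qed

lemma sobolev_mono: "r \<le> r' \<Longrightarrow> f \<in> vecs (sobolev r') \<Longrightarrow> f \<in> vecs (sobolev r)"
  unfolding mem_sobolev_iff
  by (auto elim!: summable_on_comparison_test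
      intro!: mult_right_mono sobolev_weight_mono mult_nonneg_nonneg less_imp_le[OF sobolev_weight_pos])

subsection \<open>Differentiation and integration on the circle\<close>

text \<open>The oriented integral from 0 to x: at most one of the two terms is over a nondegenerate
  interval, the other one vanishes.\<close>

definition antideriv :: "(real \<Rightarrow> real) \<Rightarrow> real \<Rightarrow> real" where
  "antideriv g x = integral {0..x} g - integral {x..0} g"

lemma antideriv_0 [simp]: "antideriv g 0 = 0"
  by (simp add: antideriv_def)

lemma antideriv_has_derivative:
  assumes g: "continuous_on UNIV g"
  shows "(antideriv g has_real_derivative g x) (at x)"
proof -
  \<comment> \<open>An interval with 0 and x inside. From its left end the oriented integral differs
    from an ordinary one by a constant, which removes the case distinction at 0.\<close>
  define a b where "a = min x 0 - 1" and "b = max x 0 + 1"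
  have ab: "a < 0" "a < x" "x < b" by (auto simp: a_def b_def)
  have int: "g integrable_on {u..v}" for u v
    by (intro integrable_continuous_real continuous_on_subset[OF g]) auto
  have eq: "integral {a..y} g - integral {a..0} g = antideriv g y" if "a \<le> y" for y
  proof (cases "y \<ge> 0")
    case True
    then show ?thesis
      using Henstock_Kurzweil_Integration.integral_combine[where a = a and c = 0 and b = y and f = g] int ab by (cases "y = 0") (auto simp: antideriv_def)
  next
    case False
    then show ?thesis
      using Henstock_Kurzweil_Integration.integral_combine[where a = a and c = y and b = 0 and f = g] int that by (auto simp: antideriv_def)
  qed
  have "((\<lambda>y. integral {a..y} g) has_real_derivative g x) (at x within {a..b})"
    using ab by (intro integral_has_real_derivative continuous_on_subset[OF g]) auto
  then have "((\<lambda>y. integral {a..y} g) has_real_derivative g x) (at x)"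
    using ab by (simp add: at_within_Icc_at)
  then have "((\<lambda>y. integral {a..y} g - integral {a..0} g) has_real_derivative g x - 0) (at x)"
    by (intro DERIV_diff DERIV_const)
  then show ?thesis
    by (simp, elim has_field_derivative_transform_within_open[where S = "{a<..<b}"])
       (use ab eq in auto)
qed

lemma DERIV_zero_imp_const:
  assumes "\<And>x. (f has_real_derivative 0) (at x)"
  shows "f x = (f y :: real)"
  using DERIV_isconst_all assms by blast

text \<open>The increment over one period has derivative zero, and at 0 it equals the mean of
  g.\<close>

lemma antideriv_periodic:
  assumes g: "continuous_on UNIV g" and per: "\<And>x. g (x + 1) = g x" and mean: "integral {0..1} g = 0"
  shows "antideriv g (x + 1) = antideriv g x"
proof -
  have "((\<lambda>x. antideriv g (x + 1) - antideriv g x) has_real_derivative 0) (at x)" for x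
    using DERIV_diff[OF DERIV_shift[THEN iffD1, OF antideriv_has_derivative[OF g, of "x + 1"]]
        antideriv_has_derivative[OF g, of x]] per by simp
  from DERIV_zero_imp_const[OF this, of x 0] mean show ?thesis by (simp add: antideriv_def)
qed

lemma fourier_coeff_0_eq:
  assumes "continuous_on UNIV g"
  shows "fourier_coeff g 0 = of_real (integral {0..1} g)"
proof -
  have "((\<lambda>x. complex_of_real (g x)) has_integral of_real (integral {0..1} g)) {0..1}"
    by (intro has_integral_of_real integrable_integral integrable_continuous_real
        continuous_on_subset[OF assms]) auto
  then show ?thesis by (simp add: fourier_coeff_eq integral_unique)
qed

lemma cmod_fourier_coeff_le:
  assumes "continuous_on UNIV f" "\<And>x. \<bar>f x\<bar> \<le> B"
  shows "cmod (fourier_coeff f n) \<le> B"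
proof -
  have "norm (integral {0..1} (\<lambda>x. of_real (f x) * fourier_basis (- n) x)) \<le> integral {0..1} (\<lambda>x::real. B)"
    using assms(2)
    by (intro integral_norm_bound_integral fourier_coeff_integrable assms(1)) (auto simp: norm_mult)
  then show ?thesis by (simp add: fourier_coeff_eq)
qed

text \<open>Elements are known only through coefficients, so differentiability has to be produced.
  The coefficients multiplied by 2 pi i n are summable and synthesize a continuous g; an
  antiderivative of g, adjusted by a constant, has the coefficients of f and therefore is f.\<close>

lemma sobolev_derivative:
  assumes r: "r > 1/2" and f: "f \<in> vecs (sobolev (r + 1))"
  shows "(f has_real_derivative deriv f x) (at x)"
    and "deriv f \<in> vecs (sobolev r)"
    and "nrm (sobolev r) (deriv f) \<le> 2 * pi * nrm (sobolev (r + 1)) f"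
proof -
  define c where "c n = 2 * pi * \<i> * of_int n * fourier_coeff f n" for n
  have c_le: "sobolev_weight r n * (cmod (c n))\<^sup>2 \<le> (2 * pi)\<^sup>2 * (weighted_coeff (r + 1) f n)\<^sup>2" for n
  proof -
    have "sobolev_weight r n * (cmod (c n))\<^sup>2 =
        (2 * pi)\<^sup>2 * (sobolev_weight r n * (of_int n)\<^sup>2 * (cmod (fourier_coeff f n))\<^sup>2)"
      by (simp add: c_def norm_mult power_mult_distrib)
    also have "\<dots> \<le> (2 * pi)\<^sup>2 * (sobolev_weight r n * (1 + (of_int n)\<^sup>2) * (cmod (fourier_coeff f n))\<^sup>2)"
      using sobolev_weight_pos[of r n] by (intro mult_left_mono mult_right_mono) auto
    finally show ?thesis
      by (simp add: weighted_coeff_squared sobolev_weight_add sobolev_weight_1)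
  qed
  have fs: "((\<lambda>n. (2 * pi)\<^sup>2 * (weighted_coeff (r + 1) f n)\<^sup>2) has_sum
      (2 * pi)\<^sup>2 * (nrm (sobolev (r + 1)) f)\<^sup>2) UNIV"
    using f unfolding nrm_sobolev_squared weighted_coeff_squared[symmetric]
    by (intro has_sum_cmult_right has_sum_infsum) (simp add: mem_sobolev_iff')
  have cw: "(\<lambda>n. sobolev_weight r n * (cmod (c n))\<^sup>2) summable_on UNIV"
    by (rule summable_on_comparison_test[OF has_sum_imp_summable[OF fs] c_le])
       (simp add: less_imp_le[OF sobolev_weight_pos])
  have cs: "(\<lambda>n. cmod (c n)) summable_on UNIV" by (rule weighted_summable_imp_summable[OF r cw])
  have cc: "c (- n) = cnj (c n)" for n by (simp add: c_def fourier_coeff_minus)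
  define g where "g x = Re (fourier_series c x)" for x
  have gc: "fourier_coeff g n = c n" for n
    using fourier_coeff_synthesis[OF cs cc] by (simp add: g_def[abs_def])
  have g_cont: "continuous_on UNIV g"
    unfolding g_def by (intro continuous_intros continuous_on_fourier_series cs)
  have g_per: "g (x + 1) = g x" for x by (simp add: g_def fourier_series_periodic)
  have g_mem: "g \<in> vecs (sobolev r)" using g_cont g_per cw by (simp add: mem_sobolev_iff gc)
  have "(nrm (sobolev r) g)\<^sup>2 \<le> (2 * pi)\<^sup>2 * (nrm (sobolev (r + 1)) f)\<^sup>2"
    using infsum_mono[OF cw has_sum_imp_summable[OF fs] c_le] infsumI[OF fs]
    by (simp add: nrm_sobolev_squared gc)
  moreover have "0 \<le> 2 * pi * nrm (sobolev (r + 1)) f" by (simp add: nrm_sobolev_nonneg)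
  ultimately have g_nrm: "nrm (sobolev r) g \<le> 2 * pi * nrm (sobolev (r + 1)) f"
    by (intro power2_le_imp_le[of "nrm (sobolev r) g" "2 * pi * nrm (sobolev (r + 1)) f"])
       (simp_all add: power_mult_distrib)
  have "integral {0..1} g = 0"
    using fourier_coeff_0_eq[OF g_cont] gc[of 0] by (simp add: c_def)
  note G_per = antideriv_periodic[OF g_cont g_per this]
  have G_deriv: "(antideriv g has_real_derivative g x) (at x)" for x
    by (rule antideriv_has_derivative[OF g_cont])
  have G_cont: "continuous_on UNIV (antideriv g)"
    using DERIV_isCont[OF G_deriv] by (simp add: continuous_at_imp_continuous_on)
  have f_cont: "continuous_on UNIV f" by (rule sobolev_continuous[OF f])
  \<comment> \<open>Corrects the coefficient at 0, the only one that the derivative does not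
    determine.\<close>
  define k where "k = integral {0..1} f - integral {0..1} (antideriv g)"
  have f_eq: "f x = (antideriv g + (\<lambda>_. k)) x" for x
  proof (rule fourier_coeff_inject[OF f_cont sobolev_periodic[OF f]])
    show "continuous_on UNIV (antideriv g + (\<lambda>_. k))"
      using continuous_on_add[OF G_cont continuous_on_const[of UNIV k]] by (simp add: plus_fun_def)
    show "(antideriv g + (\<lambda>_. k)) (x + 1) = (antideriv g + (\<lambda>_. k)) x" for x by (simp add: G_per)
    fix n
    have "c n = 2 * pi * \<i> * of_int n * fourier_coeff (antideriv g) n"
      using fourier_coeff_derivative[OF G_per G_deriv g_cont, of n] by (simp add: gc)
    then have "n \<noteq> 0 \<Longrightarrow> fourier_coeff (antideriv g) n = fourier_coeff f n" by (simp add: c_def)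
    then show "fourier_coeff f n = fourier_coeff (antideriv g + (\<lambda>_. k)) n"
      by (simp add: fourier_coeff_add[OF G_cont continuous_on_const] fourier_coeff_const
          fourier_coeff_0_eq f_cont G_cont k_def)
  qed
  have f_deriv: "(f has_real_derivative g x) (at x)" for x
    using DERIV_add[OF G_deriv[of x] DERIV_const[of k]] by (simp add: f_eq[abs_def])
  then have "deriv f = g" by (auto intro: DERIV_imp_deriv)
  then show "(f has_real_derivative deriv f x) (at x)" "deriv f \<in> vecs (sobolev r)"
    "nrm (sobolev r) (deriv f) \<le> 2 * pi * nrm (sobolev (r + 1)) f"
    using f_deriv g_mem g_nrm by auto
qed

text \<open>For n different from 0 the missing weight sqrt (1 + n^2) is at most 2 pi |n|, the factor
  gained by differentiation. The frequency 0 is invisible in the derivative and contributes the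
  separate term.\<close>

lemma sobolev_if_derivative:
  assumes per: "\<And>x. f (x + 1) = f x" and deriv: "\<And>x. (f has_real_derivative g x) (at x)"
    and g: "g \<in> vecs (sobolev r)"
  shows "f \<in> vecs (sobolev (r + 1))"
    and "nrm (sobolev (r + 1)) f \<le> cmod (fourier_coeff f 0) + nrm (sobolev r) g"
proof -
  have cont: "continuous_on UNIV f"
    using DERIV_isCont[OF deriv] by (simp add: continuous_at_imp_continuous_on)
  define d where "d n = (if n = 0 then cmod (fourier_coeff f 0) else 0)" for n :: int
  have le: "weighted_coeff (r + 1) f n \<le> d n + weighted_coeff r g n" for n
  proof (cases "n = 0")
    case True
    then show ?thesis
      using weighted_coeff_nonneg[of r g 0] by (simp add: weighted_coeff_def d_def sobolev_weight_def)
  next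
    case False
    then have n1: "1 \<le> (of_int n :: real)\<^sup>2" by (metis int_one_le_iff_zero_less of_int_1_le_iff of_int_power zero_less_power2)
    have gf: "cmod (fourier_coeff g n) = 2 * pi * \<bar>of_int n\<bar> * cmod (fourier_coeff f n)"
      unfolding fourier_coeff_derivative[OF per deriv sobolev_continuous[OF g]]
      by (simp add: norm_mult)
    have "1 + (of_int n)\<^sup>2 \<le> (2 * pi * \<bar>of_int n :: real\<bar>)\<^sup>2"
    proof -
      have "(2::real)\<^sup>2 \<le> (2 * pi)\<^sup>2" using pi_gt3 by (intro power_mono) auto
      then have "2 \<le> (2 * pi)\<^sup>2" by (rule order_trans[rotated]) simp
      then have "2 * (of_int n :: real)\<^sup>2 \<le> (2 * pi)\<^sup>2 * (of_int n)\<^sup>2" by (intro mult_right_mono) auto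
      then show ?thesis using n1 by (simp add: power_mult_distrib)
    qed
    then have "sqrt (1 + (of_int n)\<^sup>2) \<le> 2 * pi * \<bar>of_int n :: real\<bar>" by (intro real_le_lsqrt) auto
    then have "sqrt (sobolev_weight r n) * sqrt (1 + (of_int n)\<^sup>2) * cmod (fourier_coeff f n) \<le>
        sqrt (sobolev_weight r n) * (2 * pi * \<bar>of_int n :: real\<bar>) * cmod (fourier_coeff f n)"
      using sobolev_weight_pos[of r n] by (intro mult_left_mono mult_right_mono) auto
    then show ?thesis
      using False by (simp add: weighted_coeff_def sobolev_weight_add sobolev_weight_1 real_sqrt_mult gf
          d_def mult_ac)
  qed
  have "L2_set (weighted_coeff (r + 1) f) F \<le> cmod (fourier_coeff f 0) + nrm (sobolev r) g"
    if F: "finite F" for F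
  proof -
    have "L2_set (weighted_coeff (r + 1) f) F \<le> L2_set (\<lambda>n. d n + weighted_coeff r g n) F"
      by (intro L2_set_mono le weighted_coeff_nonneg)
    also have "\<dots> \<le> L2_set d F + L2_set (weighted_coeff r g) F" by (rule L2_set_triangle_ineq)
    also have "L2_set d F \<le> cmod (fourier_coeff f 0)"
    proof -
      have "L2_set d F \<le> (\<Sum>n\<in>F. d n)" by (rule L2_set_le_sum) (simp add: d_def)
      also have "\<dots> \<le> cmod (fourier_coeff f 0)" using F by (simp add: d_def sum.delta)
      finally show ?thesis .
    qed
    also have "L2_set (weighted_coeff r g) F \<le> nrm (sobolev r) g" by (rule L2_set_le_nrm_sobolev[OF g F])
    finally show ?thesis by simp
  qed
  note * = mem_sobolevI[of f "r + 1", OF cont per this]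
  show "f \<in> vecs (sobolev (r + 1))"
    "nrm (sobolev (r + 1)) f \<le> cmod (fourier_coeff f 0) + nrm (sobolev r) g"
    using * by simp_all
qed

subsection \<open>Logarithms of positive Sobolev functions\<close>

definition trig_poly :: "(int \<Rightarrow> complex) \<Rightarrow> int set \<Rightarrow> real \<Rightarrow> real" where
  "trig_poly c F x = Re (\<Sum>n\<in>F. c n * fourier_basis n x)"

lemma trig_poly_has_derivative:
  "(trig_poly c F has_real_derivative trig_poly (\<lambda>n. 2 * pi * \<i> * of_int n * c n) F x) (at x)"
proof -
  have "((\<lambda>x. \<Sum>n\<in>F. c n * fourier_basis n x) has_vector_derivative
      (\<Sum>n\<in>F. c n * (2 * pi * \<i> * of_int n * fourier_basis n x))) (at x)"
    by (intro has_vector_derivative_sum has_vector_derivative_mult_right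
        fourier_basis_has_vector_derivative)
  from bounded_linear.has_vector_derivative[OF bounded_linear_Re this] show ?thesis
    unfolding has_real_derivative_iff_has_vector_derivative trig_poly_def[abs_def]
    by (simp add: mult_ac)
qed

lemma continuous_on_trig_poly: "continuous_on S (trig_poly c F)"
  unfolding trig_poly_def[abs_def] by (intro continuous_intros)

lemma trig_poly_periodic: "trig_poly c F (x + 1) = trig_poly c F x"
  by (simp add: trig_poly_def fourier_basis_periodic)

text \<open>The symmetry of \<open>F\<close> and \<open>c\<close> under n to -n makes the complex
  sum real, so \<open>Re\<close> does not disturb the coefficients.\<close>

lemma fourier_coeff_trig_poly:
  assumes F: "finite F" "\<And>n. - n \<in> F \<longleftrightarrow> n \<in> F" and c: "\<And>n. c (- n) = cnj (c n)"
  shows "fourier_coeff (trig_poly c F) n = (if n \<in> F then c n else 0)"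
proof -
  define c' where "c' n = (if n \<in> F then c n else 0)" for n
  have "((\<lambda>n. c' n * fourier_basis n x) has_sum (\<Sum>n\<in>F. c n * fourier_basis n x)) UNIV" for x
    by (rule has_sum_finite_neutralI[of F]) (auto simp: c'_def F)
  then have "fourier_series c' x = (\<Sum>n\<in>F. c n * fourier_basis n x)" for x
    unfolding fourier_series_def by (rule infsumI)
  then have eq: "trig_poly c F = (\<lambda>x. Re (fourier_series c' x))"
    by (simp add: trig_poly_def[abs_def])
  have "(\<lambda>n. cmod (c' n)) summable_on UNIV"
    by (rule finite_nonzero_values_imp_summable_on) (rule finite_subset[OF _ F(1)], auto simp: c'_def)
  then show ?thesis
    unfolding eq by (subst fourier_coeff_synthesis) (auto simp: c'_def F c)
qed

text \<open>The approximants are partial Fourier sums: the squared distance is the tail of the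
  convergent series for the squared norm.\<close>

lemma sobolev_trig_poly_dense:
  assumes f: "f \<in> vecs (sobolev r)" and e: "e > 0"
  obtains c F where "trig_poly c F \<in> vecs (sobolev r)" "nrm (sobolev r) (f - trig_poly c F) < e"
proof -
  define a where "a n = (weighted_coeff r f n)\<^sup>2" for n
  have as: "(a has_sum (nrm (sobolev r) f)\<^sup>2) UNIV"
    using f unfolding a_def nrm_sobolev_squared weighted_coeff_squared[symmetric]
    by (intro has_sum_infsum) (simp add: mem_sobolev_iff')
  have "\<forall>\<^sub>F X in finite_subsets_at_top UNIV. dist (sum a X) ((nrm (sobolev r) f)\<^sup>2) < e\<^sup>2"
    using as e by (intro tendstoD) (auto simp: has_sum_def)
  then have "\<exists>X. finite X \<and> (\<forall>Y. finite Y \<and> X \<subseteq> Y \<longrightarrow> dist (sum a Y) ((nrm (sobolev r) f)\<^sup>2) < e\<^sup>2)"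
    unfolding eventually_finite_subsets_at_top by simp
  then obtain X where X: "finite X"
    "\<And>Y. finite Y \<Longrightarrow> X \<subseteq> Y \<Longrightarrow> dist (sum a Y) ((nrm (sobolev r) f)\<^sup>2) < e\<^sup>2"
    by metis
  \<comment> \<open>Symmetrizing the index set makes the partial sum real; enlarging it only
    shortens the tail.\<close>
  define F where "F = X \<union> uminus ` X"
  have uminus_image: "n \<in> uminus ` X \<longleftrightarrow> - n \<in> X" for n
    using image_eqI[of n uminus "- n" X] by auto
  have F: "finite F" "\<And>n. - n \<in> F \<longleftrightarrow> n \<in> F"
    using X(1) uminus_image by (auto simp: F_def)
  have FX: "dist (sum a F) ((nrm (sobolev r) f)\<^sup>2) < e\<^sup>2" by (rule X(2)) (auto simp: X(1) F_def)
  define p where "p = trig_poly (fourier_coeff f) F"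
  have pc: "fourier_coeff p n = (if n \<in> F then fourier_coeff f n else 0)" for n
    unfolding p_def by (rule fourier_coeff_trig_poly[of F "fourier_coeff f", OF F fourier_coeff_minus])
  have p: "p \<in> vecs (sobolev r)"
    unfolding mem_sobolev_iff pc
    by (intro conjI allI finite_nonzero_values_imp_summable_on finite_subset[OF _ F(1)])
       (auto simp: p_def continuous_on_trig_poly trig_poly_periodic)
  have "(weighted_coeff r (f - p) n)\<^sup>2 = a n + - (if n \<in> F then a n else 0)" for n
    by (simp add: weighted_coeff_squared a_def pc
        fourier_coeff_diff[OF sobolev_continuous[OF f] sobolev_continuous[OF p]])
  moreover have "((\<lambda>n. if n \<in> F then a n else 0) has_sum sum a F) UNIV"
    by (rule has_sum_finite_neutralI[of F]) (auto simp: F)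
  then have "((\<lambda>n. a n + - (if n \<in> F then a n else 0)) has_sum
      (nrm (sobolev r) f)\<^sup>2 + - sum a F) UNIV"
    by (intro has_sum_add as) (simp add: has_sum_uminus)
  ultimately have "(nrm (sobolev r) (f - p))\<^sup>2 = (nrm (sobolev r) f)\<^sup>2 - sum a F"
    unfolding nrm_sobolev_squared[of r "f - p"] weighted_coeff_squared[symmetric]
    by (simp add: infsumI)
  then have "(nrm (sobolev r) (f - p))\<^sup>2 < e\<^sup>2" using FX by (simp add: dist_real_def)
  then have "nrm (sobolev r) (f - p) < e" using e by (auto intro: power2_less_imp_less)
  with p show thesis using that by (simp add: p_def)
qed

definition third_derivative_const :: real where
  "third_derivative_const = 4 * sqrt (weight_sum (3/2))"

text \<open>Bounds on h and on its third derivative make the coefficients of size M / (1 + |n|^3).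
  Of this decay, a factor (1 + n^2)^(-3/4) pays for the square root of a weight with r \<le> 3/2,
  and an equal factor remains, whose square is summable. This avoids any composition estimate in the
  Sobolev norm itself.\<close>

lemma sobolev_if_third_derivative:
  assumes r: "r \<le> 3/2" and per: "\<And>x. h (x + 1) = h x"
    and d1: "\<And>x. (h has_real_derivative h1 x) (at x)"
    and d2: "\<And>x. (h1 has_real_derivative h2 x) (at x)"
    and d3: "\<And>x. (h2 has_real_derivative h3 x) (at x)"
    and per1: "\<And>x. h1 (x + 1) = h1 x" and per2: "\<And>x. h2 (x + 1) = h2 x"
    and cont: "continuous_on UNIV h3"
    and M: "\<And>x. \<bar>h x\<bar> \<le> M" "\<And>x. \<bar>h3 x\<bar> \<le> M"
  shows "h \<in> vecs (sobolev r)" and "nrm (sobolev r) h \<le> third_derivative_const * M"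
proof -
  have c: "continuous_on UNIV h" "continuous_on UNIV h1" "continuous_on UNIV h2"
    using DERIV_isCont[OF d1] DERIV_isCont[OF d2] DERIV_isCont[OF d3]
    by (simp_all add: continuous_at_imp_continuous_on)
  have M0: "M \<ge> 0" using M(1)[of 0] by linarith
  define b where "b n = 4 * M * (1 / sqrt (sobolev_weight (3/2) n))" for n
  have le: "weighted_coeff r h n \<le> b n" for n
  proof -
    define t where "t = \<bar>of_int n :: real\<bar>"
    have t: "t \<ge> 0" "t\<^sup>2 = (of_int n)\<^sup>2" by (simp_all add: t_def)
    define a where "a = cmod (fourier_coeff h n)"
    have a0: "a \<ge> 0" by (simp add: a_def)
    have "cmod (fourier_coeff h3 n) = (2 * pi * t) ^ 3 * a"
      by (simp add: fourier_coeff_derivative[OF per2 d3 cont] fourier_coeff_derivative[OF per1 d2 c(3)]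
          fourier_coeff_derivative[OF per d1 c(2)] norm_mult a_def t_def power3_eq_cube)
    then have "(2 * pi * t) ^ 3 * a \<le> M" using cmod_fourier_coeff_le[OF cont M(2), of n] by simp
    moreover have "(1 * t) ^ 3 * a \<le> (2 * pi * t) ^ 3 * a"
      using t a0 pi_gt3 by (intro mult_right_mono power_mono) auto
    moreover have "a \<le> M" unfolding a_def by (rule cmod_fourier_coeff_le[OF c(1) M(1)])
    ultimately have "(1 + t ^ 3) * a \<le> 2 * M" by (simp add: algebra_simps)
    then have "((1 + t ^ 3) * a)\<^sup>2 \<le> (2 * M)\<^sup>2" using t a0 by (intro power_mono) auto
    moreover have "(1 + t\<^sup>2) ^ 3 \<le> 4 * (1 + t ^ 3)\<^sup>2"
    proof -
      \<comment> \<open>With the factor 4 the difference of the two sides is visibly a sum of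
        nonnegative terms.\<close>
      have "0 \<le> 3 * ((1 - t\<^sup>2)\<^sup>2 * (1 + t\<^sup>2)) + 8 * t ^ 3" using t by simp
      also have "\<dots> = 4 * (1 + t ^ 3)\<^sup>2 - (1 + t\<^sup>2) ^ 3" by (simp add: power2_eq_square power3_eq_cube algebra_simps)
      finally show ?thesis by simp
    qed
    then have "(1 + t\<^sup>2) ^ 3 * a\<^sup>2 \<le> 4 * (1 + t ^ 3)\<^sup>2 * a\<^sup>2" by (rule mult_right_mono) simp
    ultimately have "(1 + t\<^sup>2) ^ 3 * a\<^sup>2 \<le> 16 * M\<^sup>2" by (simp add: power_mult_distrib)
    moreover have "(1 + t\<^sup>2) ^ 3 = sobolev_weight (3/2) n * sobolev_weight (3/2) n"
    proof -
      have "0 < 1 + t\<^sup>2" by (rule add_pos_nonneg) auto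
      then have "(1 + t\<^sup>2) ^ 3 = sobolev_weight 3 n"
        unfolding sobolev_weight_def t(2)[symmetric] by (simp add: powr_numeral)
      then show ?thesis by (simp flip: sobolev_weight_add)
    qed
    ultimately have "sobolev_weight (3/2) n * a\<^sup>2 \<le> 16 * M\<^sup>2 / sobolev_weight (3/2) n"
      using sobolev_weight_pos[of "3/2" n] by (simp add: field_simps)
    moreover have "sobolev_weight r n * a\<^sup>2 \<le> sobolev_weight (3/2) n * a\<^sup>2"
      by (intro mult_right_mono sobolev_weight_mono r) simp
    ultimately have "(weighted_coeff r h n)\<^sup>2 \<le> (b n)\<^sup>2"
      using sobolev_weight_pos[of "3/2" n]
      by (simp add: weighted_coeff_squared a_def b_def power_mult_distrib power_divide)
    then show ?thesis
      by (rule power2_le_imp_le) (use M0 sobolev_weight_pos[of "3/2" n] in \<open>simp add: b_def\<close>)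
  qed
  have l: "L2_set (weighted_coeff r h) F \<le> third_derivative_const * M" if F: "finite F" for F
  proof -
    have "L2_set (weighted_coeff r h) F \<le> L2_set b F" by (intro L2_set_mono le weighted_coeff_nonneg)
    also have "\<dots> = 4 * M * L2_set (\<lambda>n. 1 / sqrt (sobolev_weight (3/2) n)) F"
      unfolding b_def using M0 by (subst L2_set_right_distrib) auto
    also have "\<dots> \<le> 4 * M * sqrt (weight_sum (3/2))"
    proof (intro mult_left_mono)
      have "(1 / sqrt (sobolev_weight (3/2) n))\<^sup>2 = 1 / sobolev_weight (3/2) n" for n
        using sobolev_weight_pos[of "3/2" n] by (simp add: power_divide)
      then show "L2_set (\<lambda>n. 1 / sqrt (sobolev_weight (3/2) n)) F \<le> sqrt (weight_sum (3/2))"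
        using L2_set_le_infsum[of "\<lambda>n. 1 / sqrt (sobolev_weight (3/2) n)" F]
          summable_inverse_sobolev_weight[of "3/2"] F
        by (simp add: weight_sum_def)
    qed (use M0 in simp)
    finally show ?thesis using M0 by (simp add: third_derivative_const_def mult_ac)
  qed
  show "h \<in> vecs (sobolev r)" "nrm (sobolev r) h \<le> third_derivative_const * M"
    using mem_sobolevI[of h r, OF c(1) per l] by simp_all
qed

text \<open>
  As in Newman's proof of Wiener's lemma: the norms of the powers of \<open>1 / p\<close> grow, up to a
  polynomial factor, only like those of its supremum.
\<close>

lemma trig_poly_inverse_powers:
  assumes r: "r \<le> 3/2" and mu: "\<mu> > 0" and p: "\<And>x. 1 / \<mu> \<le> trig_poly c F x"
  obtains C where "C \<ge> 0" "\<And>k. (\<lambda>x. (1 / trig_poly c F x) ^ k) \<in> vecs (sobolev r)"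
    "\<And>k. nrm (sobolev r) (\<lambda>x. (1 / trig_poly c F x) ^ k) \<le> C * (3/2 * \<mu>) ^ k"
    and "(\<lambda>x. ln (trig_poly c F x)) \<in> vecs (sobolev r)"
proof -
  define D where "D c n = 2 * pi * \<i> * of_int n * c n" for c :: "int \<Rightarrow> complex" and n
  define q where "q = trig_poly c F"
  define q1 where "q1 = trig_poly (D c) F"
  define q2 where "q2 = trig_poly (D (D c)) F"
  define q3 where "q3 = trig_poly (D (D (D c))) F"
  have per: "q (x + 1) = q x" "q1 (x + 1) = q1 x" "q2 (x + 1) = q2 x" "q3 (x + 1) = q3 x" for x
    by (simp_all add: q_def q1_def q2_def q3_def trig_poly_periodic)
  have cont: "continuous_on UNIV q" "continuous_on UNIV q1" "continuous_on UNIV q2" "continuous_on UNIV q3"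
    by (simp_all add: q_def q1_def q2_def q3_def continuous_on_trig_poly)
  have dq: "(q has_real_derivative q1 x) (at x)" "(q1 has_real_derivative q2 x) (at x)"
    "(q2 has_real_derivative q3 x) (at x)" for x
    unfolding q_def q1_def q2_def q3_def D_def by (rule trig_poly_has_derivative)+
  have qpos: "q x > 0" for x
    using p[of x] mu less_le_trans[of 0 "1 / \<mu>" "q x"] by (simp add: q_def)
  define i where "i x = 1 / q x" for x
  have i: "0 < i x" "i x \<le> \<mu>" for x
    using p[of x] mu qpos[of x] by (simp_all add: i_def q_def field_simps)
  have iper: "i (x + 1) = i x" for x by (simp add: i_def per)
  have icont: "continuous_on UNIV i"
    unfolding i_def[abs_def] using qpos by (intro continuous_intros cont) (simp add: less_imp_neq[symmetric])
  define I where "I k x = i x ^ k" for k x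
  have Iper: "I k (x + 1) = I k x" for k x by (simp add: I_def iper)
  have Icont: "continuous_on UNIV (I k)" for k
    unfolding I_def[abs_def] by (intro continuous_intros icont)
  have di: "(I k has_real_derivative - real k * q1 x * I (k + 1) x) (at x)" for k x
  proof (cases k)
    case (Suc j)
    have "(i has_real_derivative - q1 x * (i x)\<^sup>2) (at x)"
      unfolding i_def[abs_def] using qpos[of x]
      by (auto intro!: derivative_eq_intros dq simp: power2_eq_square divide_simps)
    from DERIV_power[OF this, of k] show ?thesis
      unfolding I_def[abs_def]
      by (rule DERIV_cong) (simp add: Suc power2_eq_square algebra_simps)
  qed (simp add: I_def[abs_def])
  obtain b1 b2 b3 where b': "b1 \<ge> 0" "\<And>x. \<bar>q1 x\<bar> \<le> b1" "b2 \<ge> 0" "\<And>x. \<bar>q2 x\<bar> \<le> b2"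
    "b3 \<ge> 0" "\<And>x. \<bar>q3 x\<bar> \<le> b3"
    using periodic_bounded[OF cont(2) per(2)] periodic_bounded[OF cont(3) per(3)]
      periodic_bounded[OF cont(4) per(4)] by metis
  define b where "b = b1 + b2 + b3"
  have b: "\<bar>q1 x\<bar> \<le> b" "\<bar>q2 x\<bar> \<le> b" "\<bar>q3 x\<bar> \<le> b" for x
    using b'(1,3,5) b'(2,4,6)[of x] by (simp_all add: b_def)
  have b0: "b \<ge> 0" using b'(1,3,5) by (simp add: b_def)
  \<comment> \<open>\<open>B - 1\<close> collects the constants of the three terms in the third
    derivative of (1/q)^k after \<mu>^k is taken out; the extra 1 covers (1/q)^k itself.\<close>
  define B where "B = 1 + b * \<mu> + 3 * b * b * \<mu> * \<mu> + b * b * b * \<mu> * \<mu> * \<mu>"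
  have B: "B \<ge> 1" using b0 mu by (simp add: B_def)
  \<comment> \<open>\<open>h1\<close>, \<open>h2\<close>, \<open>h3\<close> are the successive
    derivatives of \<open>I k\<close>, that is of (1/q)^k. The power of 1/q rises by at most 3,
    however large k is.\<close>
  define h1 where "h1 k x = - real k * q1 x * I (k + 1) x" for k x
  define h2 where "h2 k x = - real k * (q2 x * I (k + 1) x - real (k + 1) * q1 x * q1 x * I (k + 2) x)" for k x
  define h3 where "h3 k x = - real k * (q3 x * I (k + 1) x - 3 * real (k + 1) * q1 x * q2 x * I (k + 2) x
      + real (k + 1) * real (k + 2) * q1 x * q1 x * q1 x * I (k + 3) x)" for k x
  have dh1: "(h1 k has_real_derivative h2 k x) (at x)" for k x
    unfolding h1_def[abs_def] h2_def
    by (rule derivative_eq_intros di dq refl | simp add: algebra_simps)+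
  have dh2: "(h2 k has_real_derivative h3 k x) (at x)" for k x
    unfolding h2_def[abs_def] h3_def
    by (rule derivative_eq_intros di dq refl | simp add: algebra_simps eval_nat_numeral)+
  have ik: "I k x \<le> \<mu> ^ k" for k x using i[of x] unfolding I_def by (intro power_mono) auto
  have I0: "0 \<le> I k x" for k x using i[of x] by (simp add: I_def)
  \<comment> \<open>Bernoulli gives k + 2 \<le> 8 * (9/8)^(k+2). Cubing and (9/8)^3 = 729/512 \<le>
    3/2 lead to 512 * (3/2)^(k+2) = 1152 * (3/2)^k; a ratio above 1 is the price for absorbing the
    cubic factor.\<close>
  have growth: "B * (real k + 2) ^ 3 * \<mu> ^ k \<le> B * 1152 * (3/2 * \<mu>) ^ k" for k
  proof -
    define t :: real where "t = (9/8) ^ (k + 2)"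
    have "1 + (real k + 2) / 8 \<le> t"
      unfolding t_def using Bernoulli_inequality[of "1/8" "k + 2"] by (simp add: add.commute)
    then have "real k + 2 \<le> 8 * t" by (simp add: field_simps)
    then have "(real k + 2) ^ 3 \<le> (8 * t) ^ 3" by (intro power_mono) auto
    also have "\<dots> = 512 * t ^ 3" by (simp add: power_mult_distrib)
    also have "t ^ 3 = ((9/8) ^ 3) ^ (k + 2)"
      unfolding t_def by (simp only: power_mult[symmetric] mult.commute)
    also have "((9/8) ^ 3 :: real) ^ (k + 2) \<le> (3/2) ^ (k + 2)" by (intro power_mono) (auto simp: eval_nat_numeral)
    also have "512 * (3/2 :: real) ^ (k + 2) = 1152 * (3/2) ^ k" by (simp add: eval_nat_numeral)
    finally have "(real k + 2) ^ 3 \<le> 1152 * (3/2) ^ k" by simp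
    then have "B * (real k + 2) ^ 3 * \<mu> ^ k \<le> B * (1152 * (3/2) ^ k) * \<mu> ^ k"
      using B mu by (intro mult_right_mono mult_left_mono) auto
    then show ?thesis by (simp only: power_mult_distrib mult.assoc)
  qed
  have h_le: "\<bar>I k x\<bar> \<le> B * (real k + 2) ^ 3 * \<mu> ^ k" for k x
  proof -
    have "1 \<le> (real k + 2) ^ 3" by (rule one_le_power) simp
    then have "1 * 1 \<le> B * (real k + 2) ^ 3" using B by (intro mult_mono) auto
    then have "1 * \<mu> ^ k \<le> B * (real k + 2) ^ 3 * \<mu> ^ k" using mu by (intro mult_right_mono) auto
    moreover have "\<bar>I k x\<bar> = I k x" using I0 by simp
    ultimately show ?thesis using ik[of k x] by linarith
  qed
  have h3_le: "\<bar>h3 k x\<bar> \<le> B * (real k + 2) ^ 3 * \<mu> ^ k" for k x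
  proof -
    let ?s = "real k + 2"
    have s: "0 \<le> ?s" "real k \<le> ?s" "real (k + 1) \<le> ?s" "real (k + 2) \<le> ?s" "1 \<le> ?s" by auto
    have A1: "\<bar>q3 x * I (k + 1) x\<bar> \<le> ?s * ?s * (b * \<mu> ^ (k + 1))"
    proof -
      have "\<bar>q3 x\<bar> * I (k + 1) x \<le> b * \<mu> ^ (k + 1)"
        using b[of x] b0 i[of x] I0[of _ x] by (intro mult_mono ik) auto
      also have "1 * (b * \<mu> ^ (k + 1)) \<le> ?s * ?s * (b * \<mu> ^ (k + 1))"
        using b0 mu s mult_mono[of 1 ?s 1 ?s] by (intro mult_right_mono) auto
      finally show ?thesis using I0[of "k + 1" x] by (simp add: abs_mult)
    qed
    have A2: "\<bar>3 * real (k + 1) * q1 x * q2 x * I (k + 2) x\<bar> \<le> ?s * ?s * (3 * b * b * \<mu> ^ (k + 2))"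
    proof -
      have "\<bar>q1 x\<bar> * \<bar>q2 x\<bar> * I (k + 2) x \<le> b * b * \<mu> ^ (k + 2)"
        using b[of x] b0 i[of x] I0[of _ x] by (intro mult_mono ik) auto
      moreover have "real (k + 1) \<le> ?s * ?s" using mult_mono[of "real (k + 1)" ?s 1 ?s] by simp
      ultimately have "real (k + 1) * (\<bar>q1 x\<bar> * \<bar>q2 x\<bar> * I (k + 2) x) \<le> (?s * ?s) * (b * b * \<mu> ^ (k + 2))"
        using I0[of "k + 2" x] by (elim mult_mono[rotated]) auto
      then have "3 * (real (k + 1) * (\<bar>q1 x\<bar> * \<bar>q2 x\<bar> * I (k + 2) x)) \<le> 3 * ((?s * ?s) * (b * b * \<mu> ^ (k + 2)))"
        by (rule mult_left_mono) simp
      then show ?thesis using I0[of "k + 2" x] by (simp only: abs_mult mult_ac abs_numeral abs_of_nat abs_of_nonneg)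
    qed
    have A3: "\<bar>real (k + 1) * real (k + 2) * q1 x * q1 x * q1 x * I (k + 3) x\<bar>
        \<le> ?s * ?s * (b * b * b * \<mu> ^ (k + 3))"
    proof -
      have "\<bar>q1 x\<bar> * \<bar>q1 x\<bar> * \<bar>q1 x\<bar> * I (k + 3) x \<le> b * b * b * \<mu> ^ (k + 3)"
        using b[of x] b0 i[of x] I0[of _ x] by (intro mult_mono ik) auto
      moreover have "real (k + 1) * real (k + 2) \<le> ?s * ?s" by (intro mult_mono) auto
      ultimately have "(real (k + 1) * real (k + 2)) * (\<bar>q1 x\<bar> * \<bar>q1 x\<bar> * \<bar>q1 x\<bar> * I (k + 3) x)
          \<le> (?s * ?s) * (b * b * b * \<mu> ^ (k + 3))"
        using I0[of "k + 3" x] by (elim mult_mono[rotated]) auto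
      then show ?thesis using I0[of "k + 3" x] by (simp only: abs_mult mult_ac abs_of_nat abs_of_nonneg)
    qed
    \<comment> \<open>The outer factor k and the two factors k + 2 account for the cubic
      growth.\<close>
    have "\<bar>h3 k x\<bar> \<le> real k * (?s * ?s * (b * \<mu> ^ (k + 1)) + ?s * ?s * (3 * b * b * \<mu> ^ (k + 2))
        + ?s * ?s * (b * b * b * \<mu> ^ (k + 3)))"
      unfolding h3_def abs_mult abs_minus_cancel abs_of_nat
      using A1 A2 A3 by (intro mult_left_mono[OF _ of_nat_0_le_iff]) linarith
    also have "\<dots> = real k * (?s * ?s) * ((B - 1) * \<mu> ^ k)"
      by (simp add: B_def power_add algebra_simps power2_eq_square power3_eq_cube)
    also have "\<dots> \<le> ?s * (?s * ?s) * (B * \<mu> ^ k)"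
      using B mu s by (intro mult_mono mult_right_mono) auto
    also have "\<dots> = B * ?s ^ 3 * \<mu> ^ k" by (simp add: power3_eq_cube)
    finally show ?thesis .
  qed
  have pow: "(\<lambda>x. I k x) \<in> vecs (sobolev r)"
    "nrm (sobolev r) (\<lambda>x. I k x) \<le> third_derivative_const * (B * (real k + 2) ^ 3 * \<mu> ^ k)" for k
  proof -
    have "continuous_on UNIV (h3 k)"
      unfolding h3_def[abs_def] by (intro continuous_intros cont Icont)
    note * = sobolev_if_third_derivative[OF r _ di[folded h1_def] dh1 dh2 _ _ this h_le h3_le]
    show "(\<lambda>x. I k x) \<in> vecs (sobolev r)"
      by (rule *(1)) (simp_all add: Iper h1_def h2_def per)
    show "nrm (sobolev r) (\<lambda>x. I k x) \<le> third_derivative_const * (B * (real k + 2) ^ 3 * \<mu> ^ k)"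
      by (rule *(2)) (simp_all add: Iper h1_def h2_def per)
  qed
  have tdc: "third_derivative_const \<ge> 0"
    using weight_sum_ge_1[of "3/2"] by (simp add: third_derivative_const_def)
  have lnmem: "(\<lambda>x. ln (q x)) \<in> vecs (sobolev r)"
  proof -
    \<comment> \<open>The third derivative of ln q. The logarithm of the polynomial is smooth and
      periodic, so the same criterion applies to it, without any need to track constants.\<close>
    define l3 where "l3 x = q3 x * I 1 x - 3 * q1 x * q2 x * I 2 x + 2 * q1 x * q1 x * q1 x * I 3 x" for x
    have l3c: "continuous_on UNIV l3"
      unfolding l3_def[abs_def] by (intro continuous_intros cont Icont)
    have l3p: "l3 (x + 1) = l3 x" for x by (simp add: l3_def per Iper)
    have lc: "continuous_on UNIV (\<lambda>x. ln (q x))"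
      using qpos by (intro continuous_intros cont) (simp add: less_imp_neq[symmetric])
    obtain M1 M2 where M: "M1 \<ge> 0" "\<And>x. \<bar>ln (q x)\<bar> \<le> M1" "M2 \<ge> 0" "\<And>x. \<bar>l3 x\<bar> \<le> M2"
      using periodic_bounded[OF lc] periodic_bounded[OF l3c l3p] per(1) by metis
    have e1: "((\<lambda>x. ln (q x)) has_real_derivative q1 x * I 1 x) (at x)" for x
      using qpos[of x] by (auto intro!: derivative_eq_intros dq simp: i_def I_def)
    have e2: "((\<lambda>x. q1 x * I 1 x) has_real_derivative q2 x * I 1 x - q1 x * q1 x * I 2 x) (at x)" for x
      by (rule derivative_eq_intros di dq refl | simp add: algebra_simps eval_nat_numeral)+
    have e3: "((\<lambda>x. q2 x * I 1 x - q1 x * q1 x * I 2 x) has_real_derivative l3 x) (at x)" for x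
      unfolding l3_def
      by (rule derivative_eq_intros di dq refl | simp add: algebra_simps eval_nat_numeral)+
    show ?thesis
    proof (rule sobolev_if_third_derivative(1)[OF r _ e1 e2 e3 _ _ l3c, of "M1 + M2"])
      show "\<bar>ln (q x)\<bar> \<le> M1 + M2" "\<bar>l3 x\<bar> \<le> M1 + M2" for x using M(1,3) M(2,4)[of x] by simp_all
    qed (simp_all add: per Iper)
  qed
  have I_eq: "I k = (\<lambda>x. (1 / trig_poly c F x) ^ k)" for k
    unfolding I_def[abs_def] i_def q_def ..
  show thesis
  proof (rule that[of "third_derivative_const * (B * 1152)"])
    show "0 \<le> third_derivative_const * (B * 1152)" using tdc B by simp
    show "(\<lambda>x. (1 / trig_poly c F x) ^ k) \<in> vecs (sobolev r)" for k
      using pow(1)[of k] unfolding I_eq .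
    have "nrm (sobolev r) (I k) \<le> third_derivative_const * (B * 1152) * (3/2 * \<mu>) ^ k" for k
      using pow(2)[of k] mult_left_mono[OF growth[of k] tdc] by (simp add: mult.assoc)
    then show "nrm (sobolev r) (\<lambda>x. (1 / trig_poly c F x) ^ k) \<le>
        third_derivative_const * (B * 1152) * (3/2 * \<mu>) ^ k" for k
      unfolding I_eq .
    show "(\<lambda>x. ln (trig_poly c F x)) \<in> vecs (sobolev r)" using lnmem by (simp add: q_def)
  qed
qed

lemma DERIV_ln_compose:
  assumes "(f has_real_derivative f') (at x)" "f x > 0"
  shows "((\<lambda>x. ln (f x)) has_real_derivative f' * (1 / f x)) (at x)"
  using assms by (auto intro!: derivative_eq_intros)

text \<open>With f = p + g, ln f = ln p + ln (1 + g / p). The norm of g / p need not be small, since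
  the norm of 1 / p depends on the p chosen. The series converges because g^(k+1) and p^(-(k+1)) are
  estimated separately, the latter by the supremum of 1 / p.\<close>

lemma ln_mem_sobolev_base:
  assumes r: "r > 1/2" "r \<le> 3/2" and f: "f \<in> vecs (sobolev r)" and pos: "\<And>x. f x > 0"
  shows "(\<lambda>x. ln (f x)) \<in> vecs (sobolev r)"
proof -
  define K where "K = sobolev_const r"
  interpret function_algebra "sobolev r" K unfolding K_def by (rule function_algebra_sobolev[OF r(1)])
  have "continuous_on {0..1} f" by (rule sobolev_continuous[OF f])
  then have "\<exists>x\<in>{0..1}. \<forall>y\<in>{0..1}. f x \<le> f y" by (intro continuous_attains_inf) auto
  then obtain x0 where x0: "\<And>x. x \<in> {0..1} \<Longrightarrow> f x0 \<le> f x" by blast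
  define m where "m = f x0"
  have m: "m > 0" "m \<le> f x" for x
    using pos x0[of "frac x"] periodic_frac[of f x] sobolev_periodic[OF f] frac_ge_0[of x] frac_lt_1[of x]
    by (auto simp: m_def)
  define \<mu> where "\<mu> = 2 / m"
  have mu: "\<mu> > 0" using m(1) by (simp add: \<mu>_def)
  \<comment> \<open>The accuracy m / (6 K) gives K |g| \<le> m / 6. Hence p \<ge> m / 2 = 1 / \<mu>,
    and the ratio of the series, 3/2 * \<mu> * K |g|, is at most 1/2.\<close>
  have "m / (6 * K) > 0" using m(1) K_ge_1 by simp
  from sobolev_trig_poly_dense[OF f this] obtain c F where p: "trig_poly c F \<in> vecs (sobolev r)"
    "nrm (sobolev r) (f - trig_poly c F) < m / (6 * K)" by blast
  define p where "p = trig_poly c F"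
  define g where "g = f - p"
  have g: "g \<in> vecs (sobolev r)" using mem_diff[OF f p(1)] by (simp add: g_def p_def)
  have Kg: "K * nrm (sobolev r) g \<le> m / 6"
    using p(2) K_ge_1 by (simp add: g_def p_def field_simps)
  have g_le: "\<bar>g x\<bar> \<le> m / 6" for x using abs_le_nrm[OF g, of x] Kg by linarith
  have p_ge: "1 / \<mu> \<le> p x" for x
  proof -
    have "g x \<le> m / 6" by (rule order_trans[OF abs_ge_self g_le])
    then have "f x - p x \<le> m / 6" by (simp add: g_def)
    moreover have "1 / \<mu> = m / 2" by (simp add: \<mu>_def)
    ultimately show ?thesis using m(1) m(2)[of x] by linarith
  qed
  have p_pos: "p x > 0" for x using p_ge[of x] mu less_le_trans[of 0 "1 / \<mu>" "p x"] by simp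
  obtain C where C: "C \<ge> 0" "\<And>k. (\<lambda>x. (1 / p x) ^ k) \<in> vecs (sobolev r)"
    "\<And>k. nrm (sobolev r) (\<lambda>x. (1 / p x) ^ k) \<le> C * (3/2 * \<mu>) ^ k"
    and lnp: "(\<lambda>x. ln (p x)) \<in> vecs (sobolev r)"
    using trig_poly_inverse_powers[OF r(2) mu p_ge[unfolded p_def]] unfolding p_def by metis
  define y where "y x = g x * (1 / p x)" for x
  define s where "s k = (-1) ^ k * (1 / real (k + 1))" for k :: nat
  define T where "T k = s k *\<^sub>R (g ^ Suc k * (\<lambda>x. (1 / p x) ^ Suc k))" for k
  have s: "\<bar>s k\<bar> \<le> 1" for k by (simp add: s_def abs_mult power_abs)
  have T_mem: "T k \<in> vecs (sobolev r)" for k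
    unfolding T_def by (intro mem_scaleR mem_mult mem_power g C(2))
  have T_nrm: "nrm (sobolev r) (T k) \<le> K * C * (1/2) ^ k" for k
  proof -
    have Ck: "g ^ Suc k * (\<lambda>x. (1 / p x) ^ Suc k) \<in> vecs (sobolev r)"
      by (intro mem_mult mem_power g C(2))
    have "nrm (sobolev r) (T k) \<le> 1 * nrm (sobolev r) (g ^ Suc k * (\<lambda>x. (1 / p x) ^ Suc k))"
      unfolding T_def nrm_scaleR[OF Ck] by (rule mult_right_mono[OF s nrm_nonneg])
    also have "\<dots> \<le> K * nrm (sobolev r) (g ^ Suc k) * nrm (sobolev r) (\<lambda>x. (1 / p x) ^ Suc k)"
      using nrm_mult[OF mem_power[OF g] C(2), of "Suc k" "Suc k"] by (simp only: mult_1_left)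
    also have "\<dots> \<le> K * (K ^ k * nrm (sobolev r) g ^ Suc k) * (C * (3/2 * \<mu>) ^ Suc k)"
      using K_ge_1 C(1) mu nrm_nonneg
      by (intro mult_mono mult_left_mono nrm_power_Suc g C(3) mult_nonneg_nonneg) auto
    also have "\<dots> = C * (3/2 * \<mu> * (K * nrm (sobolev r) g)) ^ Suc k"
      unfolding power_mult_distrib by (simp only: power_Suc mult_ac)
    also have "\<dots> \<le> C * (1/2) ^ Suc k"
    proof (intro mult_left_mono power_mono C(1))
      have "3/2 * \<mu> * (K * nrm (sobolev r) g) \<le> 3/2 * \<mu> * (m / 6)"
        using mu Kg by (intro mult_left_mono) auto
      then show "3/2 * \<mu> * (K * nrm (sobolev r) g) \<le> 1/2" using m(1) by (simp add: \<mu>_def)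
      show "0 \<le> 3/2 * \<mu> * (K * nrm (sobolev r) g)" using mu K_ge_1 nrm_nonneg by simp
    qed
    also have "\<dots> \<le> K * C * (1/2) ^ k"
      unfolding mult.assoc using K_ge_1 C(1) mult_mono[of 1 K "C * (1/2) ^ Suc k" "C * (1/2) ^ k"]
      by (simp add: mult_left_mono)
    finally show ?thesis .
  qed
  have T_sum: "summable (\<lambda>k. nrm (sobolev r) (T k))"
    by (rule summable_comparison_test_ev[OF always_eventually
        summable_mult[OF summable_geometric[of "1/2 :: real"]]])
       (use T_nrm nrm_nonneg in auto)
  have "(\<lambda>x. ln (p x)) + (\<lambda>x. \<Sum>k. T k x) \<in> vecs (sobolev r)"
    by (intro mem_add lnp series_mem T_mem T_sum)
  moreover have "ln (f x) = ln (p x) + (\<Sum>k. T k x)" for x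
  proof -
    have "m / 2 \<le> p x" using p_ge[of x] by (simp add: \<mu>_def)
    then have "\<bar>g x\<bar> < p x" using g_le[of x] m(1) by linarith
    then have y1: "\<bar>y x\<bar> < 1" using p_pos[of x] by (simp add: y_def abs_mult field_simps)
    have "f x = p x * (1 + y x)" using p_pos[of x] by (simp add: y_def g_def field_simps)
    then have "ln (f x) = ln (p x) + ln (1 + y x)"
      using p_pos[of x] y1 by (simp add: ln_mult abs_less_iff)
    also have "ln (1 + y x) = (\<Sum>k. (-1) ^ k * (1 / real (k + 1)) * ((1 + y x) - 1) ^ Suc k)"
      using y1 by (intro ln_series) (auto simp: abs_less_iff)
    also have "\<dots> = (\<Sum>k. T k x)"
    proof (rule suminf_cong)
      fix k
      have "T k x = s k * (g x ^ Suc k * (1 / p x) ^ Suc k)"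
        unfolding T_def scaleR_fun_def times_fun_apply power_fun_apply by simp
      also have "g x ^ Suc k * (1 / p x) ^ Suc k = y x ^ Suc k"
        unfolding y_def by (rule power_mult_distrib[symmetric])
      finally show "(-1) ^ k * (1 / real (k + 1)) * ((1 + y x) - 1) ^ Suc k = T k x"
        by (simp add: s_def)
    qed
    finally show ?thesis .
  qed
  ultimately show ?thesis by (simp add: plus_fun_def)
qed

text \<open>For r > 3/2 the exponent r - 1 is still above 1/2, so H^(r-1) is an algebra and the
  induction hypothesis places f in its \<open>log_domain\<close>. The base case up to 3/2 therefore
  leaves no gap.\<close>

lemma ln_mem_sobolev:
  assumes "r > 1/2" "f \<in> vecs (sobolev r)" "\<And>x. f x > 0"
  shows "(\<lambda>x. ln (f x)) \<in> vecs (sobolev r)"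
proof -
  obtain n :: nat where "r \<le> real n" using real_arch_simple by blast
  then have "r \<le> real n + 3/2" by simp
  then show ?thesis
    using assms
  proof (induction n arbitrary: r)
    case 0
    then show ?case by (intro ln_mem_sobolev_base) auto
  next
    case (Suc n)
    show ?case
    proof (cases "r \<le> 3/2")
      case True
      then show ?thesis using Suc.prems by (intro ln_mem_sobolev_base) auto
    next
      case False
      define t where "t = r - 1"
      have t: "t > 1/2" "t \<le> real n + 3/2" "r = t + 1" using False Suc.prems by (auto simp: t_def)
      interpret function_algebra "sobolev t" "sobolev_const t" by (rule function_algebra_sobolev[OF t(1)])
      have fr: "f \<in> vecs (sobolev (t + 1))" and pos: "f x > 0" for x using Suc.prems t by auto
      have ft: "f \<in> vecs (sobolev t)" by (rule sobolev_mono[OF _ fr]) simp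
      have "(\<lambda>x. ln (f x)) \<in> vecs (sobolev t)" using Suc.IH[OF t(2,1) ft pos] .
      then have "f \<in> log_domain" using ft pos by (simp add: log_domain_def)
      then have inv: "(\<lambda>x. 1 / f x) \<in> vecs (sobolev t)" by (rule inverse_mem)
      have "deriv f * (\<lambda>x. 1 / f x) \<in> vecs (sobolev t)"
        by (intro mem_mult sobolev_derivative(2)[OF t(1) fr] inv)
      moreover have "((\<lambda>x. ln (f x)) has_real_derivative (deriv f * (\<lambda>x. 1 / f x)) x) (at x)" for x
        using DERIV_ln_compose[OF sobolev_derivative(1)[OF t(1) fr] pos] by simp
      moreover have "ln (f (x + 1)) = ln (f x)" for x using sobolev_periodic[OF fr] by simp
      ultimately show ?thesis unfolding t(3) using sobolev_if_derivative(1)[of "\<lambda>x. ln (f x)"] by blast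
    qed
  qed
qed

subsection \<open>Differentiating exponentials of combinations\<close>

lemma bounded_linear_map_zero:
  assumes "normed_subspace F"
  shows "bounded_linear_map E F (\<lambda>_. 0)"
  using normed_subspace.mem_0[OF assms] normed_subspace.nrm_0[OF assms]
  by (auto simp: bounded_linear_map_def intro!: exI[of _ 0])

lemma has_frechet_derivative_const:
  assumes "normed_subspace E" "normed_subspace F"
  shows "has_frechet_derivative E F (\<lambda>_. c) (\<lambda>_. 0) x"
  by (rule has_frechet_derivative_affine[OF bounded_linear_map_zero _ assms]) (simp_all add: assms)

lemma bounded_linear_map_Pair:
  assumes L: "bounded_linear_map E F L" and M: "bounded_linear_map E H M"
    and E: "normed_subspace E" and F: "normed_subspace F" and H: "normed_subspace H"
  shows "bounded_linear_map E (prod_space F H) (\<lambda>h. (L h, M h))"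
proof -
  obtain B where B: "\<And>h. h \<in> vecs E \<Longrightarrow> nrm F (L h) \<le> B * nrm E h"
    using bounded_linear_map_bound[OF L E] by metis
  obtain C where C: "\<And>h. h \<in> vecs E \<Longrightarrow> nrm H (M h) \<le> C * nrm E h"
    using bounded_linear_map_bound[OF M E] by metis
  show ?thesis
    unfolding bounded_linear_map_def
  proof (intro conjI ballI allI exI)
    show "(L h, M h) \<in> vecs (prod_space F H)" if "h \<in> vecs E" for h
      using bounded_linear_map_mem[OF L that] bounded_linear_map_mem[OF M that]
      by (simp add: vecs_prod_space)
    show "(L (h + c *\<^sub>R k), M (h + c *\<^sub>R k)) = (L h, M h) + c *\<^sub>R (L k, M k)"
      if "h \<in> vecs E" "k \<in> vecs E" for h k c
      using L M that by (simp add: bounded_linear_map_def)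
    show "nrm (prod_space F H) (L h, M h) \<le> (B + C) * nrm E h" if "h \<in> vecs E" for h
      using nrm_prod_space_le[OF F H, of "L h" "M h"] B[OF that] C[OF that]
      by (simp add: algebra_simps)
  qed
qed

lemma has_frechet_derivative_Pair:
  assumes f: "has_frechet_derivative E F f L x" and g: "has_frechet_derivative E H g M x"
    and E: "normed_subspace E" and F: "normed_subspace F" and H: "normed_subspace H"
  shows "has_frechet_derivative E (prod_space F H) (\<lambda>x. (f x, g x)) (\<lambda>h. (L h, M h)) x"
  unfolding has_frechet_derivative_def
proof (intro conjI allI impI)
  show "bounded_linear_map E (prod_space F H) (\<lambda>h. (L h, M h))"
    using f g by (intro bounded_linear_map_Pair E F H) (auto simp: has_frechet_derivative_def)
  fix e :: real assume "e > 0"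
  then have e: "e/2 > 0" by simp
  obtain d1 where d1: "d1 > 0" "\<And>h. h \<in> vecs E \<Longrightarrow> nrm E h < d1 \<Longrightarrow>
      f (x + h) - f x \<in> vecs F \<and> nrm F (f (x + h) - f x - L h) \<le> e/2 * nrm E h"
    using f e unfolding has_frechet_derivative_def by metis
  obtain d2 where d2: "d2 > 0" "\<And>h. h \<in> vecs E \<Longrightarrow> nrm E h < d2 \<Longrightarrow>
      g (x + h) - g x \<in> vecs H \<and> nrm H (g (x + h) - g x - M h) \<le> e/2 * nrm E h"
    using g e unfolding has_frechet_derivative_def by metis
  show "\<exists>d>0. \<forall>h\<in>vecs E. nrm E h < d \<longrightarrow>
      (f (x + h), g (x + h)) - (f x, g x) \<in> vecs (prod_space F H) \<and>
      nrm (prod_space F H) ((f (x + h), g (x + h)) - (f x, g x) - (L h, M h)) \<le> e * nrm E h"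
  proof (intro exI[of _ "min d1 d2"] conjI ballI impI)
    fix h assume h: "h \<in> vecs E" "nrm E h < min d1 d2"
    note a = d1(2)[OF h(1)] d2(2)[OF h(1)]
    show "(f (x + h), g (x + h)) - (f x, g x) \<in> vecs (prod_space F H)"
      using a h by (simp add: vecs_prod_space)
    show "nrm (prod_space F H) ((f (x + h), g (x + h)) - (f x, g x) - (L h, M h)) \<le> e * nrm E h"
      unfolding diff_Pair
      using nrm_prod_space_le[OF F H, of "f (x + h) - f x - L h" "g (x + h) - g x - M h"] a h
      by linarith
  qed (use d1 d2 in auto)
qed

context function_algebra
begin

lemma has_frechet_derivative_exp_comb:
  assumes E: "normed_subspace E"
    and U: "has_frechet_derivative E A U L x" and V: "has_frechet_derivative E A V M x"
    and mem: "U x \<in> vecs A" "V x \<in> vecs A"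
  shows "has_frechet_derivative E A (\<lambda>x t. c * exp (p * U x t + q * V x t))
    (\<lambda>h. (\<lambda>t. c * p * exp (p * U x t + q * V x t)) * L h +
         (\<lambda>t. c * q * exp (p * U x t + q * V x t)) * M h) x"
proof -
  note A = normed_subspace_A
  \<comment> \<open>The summand 0 presents each scaling as an instance of the rule for f + c
    g.\<close>
  define w where "w x = (0 + p *\<^sub>R U x) + q *\<^sub>R V x" for x
  have w: "has_frechet_derivative E A w (\<lambda>h. (0 + p *\<^sub>R L h) + q *\<^sub>R M h) x"
    unfolding w_def[abs_def]
    by (intro has_frechet_derivative_add_scaleR has_frechet_derivative_const U V E A)
  have "w x \<in> vecs A" unfolding w_def by (intro mem_add mem_scaleR mem mem_0)
  from has_frechet_derivative_chain[OF w has_frechet_derivative_exp[OF this] E A A]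
  have "has_frechet_derivative E A (\<lambda>x. 0 + c *\<^sub>R (\<lambda>t. exp (w x t)))
      (\<lambda>h. 0 + c *\<^sub>R ((\<lambda>t. exp (w x t)) * ((0 + p *\<^sub>R L h) + q *\<^sub>R M h))) x"
    by (intro has_frechet_derivative_add_scaleR has_frechet_derivative_const E A)
  moreover have "(\<lambda>x. 0 + c *\<^sub>R (\<lambda>t. exp (w x t))) = (\<lambda>x t. c * exp (p * U x t + q * V x t))"
    by (simp add: w_def fun_eq_iff scaleR_fun_def)
  moreover have "(\<lambda>h. 0 + c *\<^sub>R ((\<lambda>t. exp (w x t)) * ((0 + p *\<^sub>R L h) + q *\<^sub>R M h))) =
      (\<lambda>h. (\<lambda>t. c * p * exp (p * U x t + q * V x t)) * L h +
         (\<lambda>t. c * q * exp (p * U x t + q * V x t)) * M h)"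
    by (simp add: w_def fun_eq_iff scaleR_fun_def algebra_simps)
  ultimately show ?thesis by (simp only:)
qed

lemma exp_comb_mem: "f \<in> vecs A \<Longrightarrow> g \<in> vecs A \<Longrightarrow> (\<lambda>t. c * exp (p * f t + q * g t)) \<in> vecs A"
  using mem_scaleR[OF exp_mem[OF mem_add[OF mem_scaleR mem_scaleR]], of f g c p q]
  by (simp add: scaleR_fun_def)

lemma has_frechet_derivative_ln_affine:
  assumes E: "normed_subspace E" and L: "bounded_linear_map E A L"
    and u: "\<And>h. h \<in> vecs E \<Longrightarrow> u (x + h) - u x = L h" and pos: "u x \<in> log_domain"
  shows "has_frechet_derivative E A (\<lambda>x t. ln (u x t)) (\<lambda>h. (\<lambda>t. 1 / u x t) * L h) x"
  by (rule has_frechet_derivative_chain[OF has_frechet_derivative_affine[OF L u E normed_subspace_A]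
        has_frechet_derivative_ln[OF pos] E normed_subspace_A normed_subspace_A])

lemma log_domain_open_affine:
  assumes E: "normed_subspace E" and L: "bounded_linear_map E A L" and f: "f \<in> log_domain"
  obtains d where "d > 0" "\<And>h. h \<in> vecs E \<Longrightarrow> nrm E h < d \<Longrightarrow> f + L h \<in> log_domain"
proof -
  obtain d where d: "d > 0" "\<And>h. h \<in> vecs A \<Longrightarrow> nrm A h < d \<Longrightarrow> f + h \<in> log_domain"
    using log_domain_perturb[OF f] by metis
  obtain C where C: "C \<ge> 0" "\<And>h. h \<in> vecs E \<Longrightarrow> nrm A (L h) \<le> C * nrm E h"
    using bounded_linear_map_bound[OF L E] by metis
  show thesis
  proof (rule that[of "d / (C + 1)"])
    show "0 < d / (C + 1)" using d C by simp
    fix h assume h: "h \<in> vecs E" "nrm E h < d / (C + 1)"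
    have "nrm A (L h) \<le> (C + 1) * nrm E h"
      using C(2)[OF h(1)] normed_subspace.nrm_nonneg[OF E, of h] by (simp add: algebra_simps)
    also have "\<dots> < d" using h(2) C(1) by (simp add: field_simps)
    finally show "f + L h \<in> log_domain" by (rule d(2)[OF bounded_linear_map_mem[OF L h(1)]])
  qed
qed

end

subsection \<open>The diffeomorphism group\<close>

lemma normed_subspace_sobolev0: "normed_subspace (sobolev0 r)"
proof -
  interpret normed_subspace "sobolev r" by (rule normed_subspace_sobolev)
  have v: "vecs (sobolev0 r) = vecs (sobolev r) \<inter> {u. u 0 = 0}" "nrm (sobolev0 r) = nrm (sobolev r)"
    by (auto simp: sobolev0_def)
  show ?thesis
  proof
    show "subspace (vecs (sobolev0 r))"
      unfolding v
      by (intro real_vector.subspace_inter subspace real_vector.subspaceI) (auto simp: scaleR_fun_def)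
    show "nrm (sobolev0 r) (x + y) \<le> nrm (sobolev0 r) x + nrm (sobolev0 r) y"
      if "x \<in> vecs (sobolev0 r)" "y \<in> vecs (sobolev0 r)" for x y
      using that unfolding v by (intro nrm_triangle) auto
    show "nrm (sobolev0 r) (c *\<^sub>R x) = \<bar>c\<bar> * nrm (sobolev0 r) x" if "x \<in> vecs (sobolev0 r)" for c x
      using that unfolding v by (intro nrm_scaleR) auto
  qed (simp add: v nrm_sobolev_nonneg)
qed

lemma mem_sobolev0_iff: "u \<in> vecs (sobolev0 r) \<longleftrightarrow> u \<in> vecs (sobolev r) \<and> u 0 = 0"
  by (simp add: sobolev0_def)

lemma bounded_linear_map_deriv:
  assumes r: "r > 1/2"
  shows "bounded_linear_map (sobolev0 (r + 1)) (sobolev r) deriv"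
  unfolding bounded_linear_map_def
proof (intro conjI ballI allI exI)
  show "deriv h \<in> vecs (sobolev r)" if "h \<in> vecs (sobolev0 (r + 1))" for h
    using that by (intro sobolev_derivative(2) r) (simp add: mem_sobolev0_iff)
  show "nrm (sobolev r) (deriv h) \<le> 2 * pi * nrm (sobolev0 (r + 1)) h"
    if "h \<in> vecs (sobolev0 (r + 1))" for h
    using that sobolev_derivative(3)[OF r, of h] by (simp add: sobolev0_def)
  show "deriv (h + c *\<^sub>R k) = deriv h + c *\<^sub>R deriv k"
    if "h \<in> vecs (sobolev0 (r + 1))" "k \<in> vecs (sobolev0 (r + 1))" for h k c
  proof
    fix x
    have "((\<lambda>x. h x + c * k x) has_real_derivative deriv h x + c * deriv k x) (at x)"
      using that by (intro DERIV_add DERIV_cmult sobolev_derivative(1)[OF r]) (auto simp: mem_sobolev0_iff)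
    then show "deriv (h + c *\<^sub>R k) x = (deriv h + c *\<^sub>R deriv k) x"
      by (simp add: plus_fun_def scaleR_fun_def DERIV_imp_deriv)
  qed
qed

text \<open>A lift is the identity plus a periodic function u, so its derivative is 1 + u' and,
  unlike the lift, is periodic.\<close>

lemma lift_has_derivative:
  assumes r: "r > 1/2" and u: "(\<lambda>x. \<phi> x - x) \<in> vecs (sobolev (r + 1))"
  shows "(\<phi> has_real_derivative deriv \<phi> x) (at x)" and "deriv \<phi> \<in> vecs (sobolev r)"
proof -
  interpret normed_subspace "sobolev r" by (rule normed_subspace_sobolev)
  let ?u = "\<lambda>x. \<phi> x - x"
  have d: "(\<phi> has_real_derivative deriv ?u x + 1) (at x)" for x
    using DERIV_add[OF sobolev_derivative(1)[OF r u, of x] DERIV_ident] by simp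
  then have eq: "deriv \<phi> = deriv ?u + 1" by (auto simp: fun_eq_iff intro!: DERIV_imp_deriv)
  show "(\<phi> has_real_derivative deriv \<phi> x) (at x)" using d[of x] by (simp add: eq)
  show "deriv \<phi> \<in> vecs (sobolev r)"
    unfolding eq by (intro mem_add sobolev_derivative(2)[OF r u] one_mem_sobolev)
qed

lemma lift_shift: "(\<lambda>x. \<phi> x - x) \<in> vecs (sobolev r) \<Longrightarrow> \<phi> (x + 1) = \<phi> x + 1"
  using sobolev_periodic[of "\<lambda>x. \<phi> x - x" r x] by simp

text \<open>Reduces the diffeomorphism conditions to positivity of the density. Forwards, the chain
  rule for \<open>inv \<phi>\<close> after \<phi> excludes a zero derivative and monotonicity a
  negative one. Backwards, \<phi> stays within bounded distance of the identity, hence is onto by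
  the intermediate value theorem, and the inverse rule gives a continuous derivative of the
  inverse.\<close>

lemma Diff0_iff:
  assumes r: "r > 1/2"
  shows "\<phi> \<in> Diff0 (r + 1) \<longleftrightarrow>
    (\<lambda>x. \<phi> x - x) \<in> vecs (sobolev (r + 1)) \<and> \<phi> 0 = 0 \<and> (\<forall>x. deriv \<phi> x > 0)"
proof (intro iffI)
  assume \<phi>: "\<phi> \<in> Diff0 (r + 1)"
  then have u: "(\<lambda>x. \<phi> x - x) \<in> vecs (sobolev (r + 1))" and "\<phi> 0 = 0" and mono: "strict_mono \<phi>"
    and bij: "bij \<phi>" and inv: "inv \<phi> C1_differentiable_on UNIV"
    by (auto simp: Diff0_def)
  note d = lift_has_derivative(1)[OF r u]
  have "deriv \<phi> x > 0" for x
  proof -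
    obtain D where "(inv \<phi> has_vector_derivative D) (at (\<phi> x))"
      using inv unfolding C1_differentiable_on_def by blast
    then have "(inv \<phi> has_real_derivative D) (at (\<phi> x))"
      by (simp add: has_real_derivative_iff_has_vector_derivative)
    from DERIV_chain2[OF this d[of x]]
    have "((\<lambda>x. x) has_real_derivative D * deriv \<phi> x) (at x)"
      using bij by (simp add: bij_is_inj)
    then have "D * deriv \<phi> x = 1" using DERIV_unique[OF _ DERIV_ident] by blast
    then have ne: "deriv \<phi> x \<noteq> 0" by auto
    have "\<not> deriv \<phi> x < 0"
    proof
      assume "deriv \<phi> x < 0"
      from DERIV_neg_dec_right[OF d this] obtain e where "e > 0" "\<And>h. 0 < h \<Longrightarrow> h < e \<Longrightarrow> \<phi> (x + h) < \<phi> x"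
        by auto
      from this(1) this(2)[of "e/2"] show False using strict_monoD[OF mono, of x "x + e/2"] by simp
    qed
    with ne show ?thesis by simp
  qed
  then show "(\<lambda>x. \<phi> x - x) \<in> vecs (sobolev (r + 1)) \<and> \<phi> 0 = 0 \<and> (\<forall>x. deriv \<phi> x > 0)"
    using u \<open>\<phi> 0 = 0\<close> by blast
next
  assume *: "(\<lambda>x. \<phi> x - x) \<in> vecs (sobolev (r + 1)) \<and> \<phi> 0 = 0 \<and> (\<forall>x. deriv \<phi> x > 0)"
  then have u: "(\<lambda>x. \<phi> x - x) \<in> vecs (sobolev (r + 1))" and pos: "\<And>x. deriv \<phi> x > 0" by auto
  note d = lift_has_derivative[OF r u]
  have cont: "isCont \<phi> x" for x by (rule DERIV_isCont[OF d(1)])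
  have dcont: "continuous_on UNIV (deriv \<phi>)" by (rule sobolev_continuous[OF d(2)])
  have mono: "strict_mono \<phi>"
    by (rule strict_monoI, rule DERIV_pos_imp_increasing) (use d(1) pos in auto)
  obtain B where B: "\<And>x. \<bar>\<phi> x - x\<bar> \<le> B"
    using periodic_bounded[OF sobolev_continuous[OF u] sobolev_periodic[OF u]] by metis
  have "surj \<phi>"
    unfolding surj_def
  proof
    fix y
    have "\<phi> (y - B) \<le> y" "y \<le> \<phi> (y + B)" "y - B \<le> y + B"
      using B[of "y - B"] B[of "y + B"] by (auto simp: abs_le_iff)
    then obtain x where "\<phi> x = y" using IVT[of \<phi> "y - B" y "y + B"] cont by auto
    then show "\<exists>x. y = \<phi> x" by blast
  qed
  then have bij: "bij \<phi>" using mono by (simp add: bij_def strict_mono_imp_inj_on)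
  have inv: "inv \<phi> (\<phi> x) = x" "\<phi> (inv \<phi> x) = x" for x
    using bij by (simp_all add: bij_is_inj bij_is_surj surj_f_inv_f)
  have icont: "isCont (inv \<phi>) y" for y
    using isCont_inverse_function[of 1 "inv \<phi> y" "inv \<phi>" \<phi>] inv cont by simp
  have idiff: "(inv \<phi> has_real_derivative inverse (deriv \<phi> (inv \<phi> y))) (at y)" for y
    by (rule DERIV_inverse_function[where f = \<phi> and a = "y - 1" and b = "y + 1"])
       (use d(1) pos[of "inv \<phi> y"] inv icont in auto)
  have "continuous_on UNIV (\<lambda>y. inverse (deriv \<phi> (inv \<phi> y)))"
    using pos icont
    by (intro continuous_on_inverse continuous_on_compose2[OF dcont] continuous_at_imp_continuous_on)
       (auto simp: less_imp_neq[symmetric])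
  then have "inv \<phi> C1_differentiable_on UNIV"
    unfolding C1_differentiable_on_def
    using idiff
    by (intro exI[of _ "\<lambda>y. inverse (deriv \<phi> (inv \<phi> y))"])
       (auto simp: has_real_derivative_iff_has_vector_derivative[symmetric])
  moreover have "\<phi> C1_differentiable_on UNIV"
    unfolding C1_differentiable_on_def
    using d(1) dcont by (auto simp: has_real_derivative_iff_has_vector_derivative[symmetric])
  ultimately show "\<phi> \<in> Diff0 (r + 1)" using * mono bij by (simp add: Diff0_def)
qed

subsection \<open>Integration of densities\<close>

text \<open>Subtracting the mean makes the antiderivative periodic for every y. So this is a linear
  map on all of H^r, an inverse of differentiation only on the functions of mean zero.\<close>

definition mean_free_antideriv :: "(real \<Rightarrow> real) \<Rightarrow> real \<Rightarrow> real" where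
  "mean_free_antideriv y x = antideriv y x - x * integral {0..1} y"

lemma mean_free_antideriv_has_derivative:
  "continuous_on UNIV y \<Longrightarrow>
    (mean_free_antideriv y has_real_derivative y x - integral {0..1} y) (at x)"
  unfolding mean_free_antideriv_def[abs_def]
  by (auto intro!: derivative_eq_intros antideriv_has_derivative)

lemma antiderivative_unique:
  assumes "\<And>x. (f has_real_derivative f' x) (at x)" "\<And>x. (g has_real_derivative f' x) (at x)" "f 0 = g 0"
  shows "f x = (g x :: real)"
proof -
  have "((\<lambda>x. f x - g x) has_real_derivative 0) (at x)" for x
    using DERIV_diff[OF assms(1,2)] by simp
  from DERIV_zero_imp_const[OF this, of x 0] show ?thesis using assms(3) by simp
qed

lemma integral_deriv_period:
  assumes "\<And>x. (f has_real_derivative f' x) (at x)"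
  shows "(f' has_integral f 1 - f 0) {0..1::real}"
  using assms by (intro fundamental_theorem_of_calculus)
    (auto simp: has_real_derivative_iff_has_vector_derivative[symmetric] intro: DERIV_subset)

text \<open>The derivative is z, that is y minus its mean, and it controls all frequencies except 0.
  The coefficient at 0 is bounded by the supremum, which the mean value theorem on one period,
  starting from the value 0, bounds by that of z.\<close>

lemma bounded_linear_map_mean_free_antideriv:
  assumes r: "r > 1/2"
  shows "bounded_linear_map (sobolev r) (sobolev0 (r + 1)) mean_free_antideriv"
proof -
  interpret function_algebra "sobolev r" "sobolev_const r" by (rule function_algebra_sobolev[OF r])
  define K where "K = sobolev_const r"
  define z where "z y = y - integral {0..1} y *\<^sub>R 1" for y :: "real \<Rightarrow> real"
  have z_mem: "z y \<in> vecs (sobolev r)" if "y \<in> vecs (sobolev r)" for y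
    unfolding z_def by (intro mem_diff mem_scaleR one_mem that)
  have d: "(mean_free_antideriv y has_real_derivative z y x) (at x)" if "y \<in> vecs (sobolev r)" for y x
    using mean_free_antideriv_has_derivative[OF sobolev_continuous[OF that]]
    by (simp add: z_def scaleR_fun_def)
  have int: "y integrable_on {0..1}" if "y \<in> vecs (sobolev r)" for y
    by (intro integrable_continuous_real sobolev_continuous[OF that])
  have per: "mean_free_antideriv y (x + 1) = mean_free_antideriv y x" if y: "y \<in> vecs (sobolev r)" for y x
  proof -
    have "mean_free_antideriv y x = antideriv (z y) x" for x
      by (rule antiderivative_unique[OF d[OF y] antideriv_has_derivative[OF sobolev_continuous[OF z_mem[OF y]]]])
         (simp add: mean_free_antideriv_def)
    moreover have "integral {0..1} (z y) = 0"
      using integral_diff[OF int[OF y] integrable_continuous_real[OF continuous_on_const[of _ "integral {0..1} y"]]]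
      by (simp add: z_def fun_diff_def scaleR_fun_def)
    ultimately show ?thesis
      using antideriv_periodic[of "z y" x] sobolev_continuous[OF z_mem[OF y]] sobolev_periodic[OF z_mem[OF y]]
      by simp
  qed
  have mean: "\<bar>integral {0..1} y\<bar> \<le> K * nrm (sobolev r) y" if y: "y \<in> vecs (sobolev r)" for y
  proof -
    have "norm (integral {0..1} y) \<le> integral {0..1} (\<lambda>x::real. K * nrm (sobolev r) y)"
      using abs_le_nrm[OF y] int[OF y]
      by (intro integral_norm_bound_integral) (auto simp: K_def)
    then show ?thesis by simp
  qed
  have K1: "K \<ge> 1" using K_ge_1 by (simp add: K_def)
  define C where "C = 1 + K * nrm (sobolev r) 1"
  have z_nrm: "nrm (sobolev r) (z y) \<le> C * nrm (sobolev r) y" if y: "y \<in> vecs (sobolev r)" for y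
  proof -
    have "nrm (sobolev r) (z y) \<le> nrm (sobolev r) y + \<bar>integral {0..1} y\<bar> * nrm (sobolev r) 1"
      unfolding z_def using nrm_diff[OF y mem_scaleR[OF one_mem]] nrm_scaleR[OF one_mem] by metis
    also have "\<dots> \<le> nrm (sobolev r) y + (K * nrm (sobolev r) y) * nrm (sobolev r) 1"
      by (intro add_left_mono mult_right_mono mean y nrm_nonneg)
    finally show ?thesis by (simp add: C_def algebra_simps)
  qed
  have sup: "\<bar>mean_free_antideriv y x\<bar> \<le> K * nrm (sobolev r) (z y)" if y: "y \<in> vecs (sobolev r)" for y x
  proof -
    have *: "\<bar>mean_free_antideriv y x\<bar> \<le> K * nrm (sobolev r) (z y)" if x: "0 < x" "x < 1" for x
    proof -
      obtain t where "mean_free_antideriv y x - mean_free_antideriv y 0 = (x - 0) * z y t"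
        using MVT2[OF x(1), of "mean_free_antideriv y" "z y"] d[OF y] by metis
      then have "\<bar>mean_free_antideriv y x\<bar> = \<bar>x\<bar> * \<bar>z y t\<bar>"
        by (simp add: mean_free_antideriv_def abs_mult)
      also have "\<dots> \<le> 1 * \<bar>z y t\<bar>" using x by (intro mult_right_mono) auto
      finally show ?thesis using abs_le_nrm[OF z_mem[OF y], of t] by (simp add: K_def)
    qed
    have "\<bar>mean_free_antideriv y (frac x)\<bar> \<le> K * nrm (sobolev r) (z y)"
    proof (cases "frac x = 0")
      case True
      then show ?thesis using K1 nrm_nonneg by (simp only: True) (simp add: mean_free_antideriv_def)
    next
      case False
      then show ?thesis using * frac_ge_0[of x] frac_lt_1[of x] by (simp add: order_less_le)
    qed
    then show ?thesis using periodic_frac[of "mean_free_antideriv y" x] per[OF y] by simp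
  qed
  have mem: "mean_free_antideriv y \<in> vecs (sobolev (r + 1))" if y: "y \<in> vecs (sobolev r)" for y
    by (rule sobolev_if_derivative(1)[OF per[OF y] d[OF y] z_mem[OF y]])
  show ?thesis
    unfolding bounded_linear_map_def
  proof (intro conjI ballI allI exI)
    show "mean_free_antideriv y \<in> vecs (sobolev0 (r + 1))" if "y \<in> vecs (sobolev r)" for y
      using mem[OF that] by (simp add: mem_sobolev0_iff mean_free_antideriv_def)
    fix y assume y: "y \<in> vecs (sobolev r)"
    have "nrm (sobolev (r + 1)) (mean_free_antideriv y) \<le>
        cmod (fourier_coeff (mean_free_antideriv y) 0) + nrm (sobolev r) (z y)"
      by (rule sobolev_if_derivative(2)[OF per[OF y] d[OF y] z_mem[OF y]])
    also have "cmod (fourier_coeff (mean_free_antideriv y) 0) \<le> K * nrm (sobolev r) (z y)"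
      by (rule cmod_fourier_coeff_le[OF sobolev_continuous[OF mem[OF y]] sup[OF y]])
    also have "K * nrm (sobolev r) (z y) + nrm (sobolev r) (z y) \<le> (K + 1) * (C * nrm (sobolev r) y)"
      using mult_left_mono[OF z_nrm[OF y], of "K + 1"] K1 by (simp add: algebra_simps)
    finally show "nrm (sobolev0 (r + 1)) (mean_free_antideriv y) \<le> (K + 1) * C * nrm (sobolev r) y"
      by (simp add: sobolev0_def mult.assoc)
    fix k c assume k: "k \<in> vecs (sobolev r)"
    show "mean_free_antideriv (y + c *\<^sub>R k) = mean_free_antideriv y + c *\<^sub>R mean_free_antideriv k"
    proof
      fix x
      have yk: "y + c *\<^sub>R k \<in> vecs (sobolev r)" by (intro mem_add mem_scaleR y k)
      have "integral {0..1} (y + c *\<^sub>R k) = integral {0..1} y + c * integral {0..1} k"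
        using integral_add[OF int[OF y] int[OF mem_scaleR[OF k, of c]]]
        by (simp add: plus_fun_def scaleR_fun_def)
      then have "z (y + c *\<^sub>R k) x = z y x + c * z k x" for x
        by (simp add: z_def scaleR_fun_def algebra_simps)
      then have 1: "(mean_free_antideriv (y + c *\<^sub>R k) has_real_derivative z y x + c * z k x) (at x)" for x
        using d[OF yk, of x] by simp
      have 2: "(mean_free_antideriv y + c *\<^sub>R mean_free_antideriv k has_real_derivative z y x + c * z k x) (at x)" for x
        using DERIV_add[OF d[OF y, of x] DERIV_cmult[OF d[OF k, of x], of c]]
        by (simp add: plus_fun_def scaleR_fun_def)
      show "mean_free_antideriv (y + c *\<^sub>R k) x = (mean_free_antideriv y + c *\<^sub>R mean_free_antideriv k) x"
        by (rule antiderivative_unique[OF 1 2]) (simp add: mean_free_antideriv_def scaleR_fun_def)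
    qed
  qed
qed

subsection \<open>The map and its inverse\<close>

lemma G_model_eq: "G_model (r + 1) = prod_space (sobolev0 (r + 1)) (sobolev r)"
  by (simp add: G_model_def)

lemma normed_subspace_G_model: "normed_subspace (G_model (r + 1))"
  unfolding G_model_eq
  by (intro normed_subspace_prod_space normed_subspace_sobolev0 normed_subspace_sobolev)

lemma normed_subspace_S_ambient: "normed_subspace (S_ambient r)"
  unfolding S_ambient_def by (intro normed_subspace_prod_space normed_subspace_sobolev)

section \<open>The semidirect product as an open set, and smoothness of the map\<close>

lemma G_iff:
  assumes r: "r > 1/2"
  shows "p \<in> G (r + 1) \<longleftrightarrow> (\<lambda>x. fst p x - x) \<in> vecs (sobolev (r + 1)) \<and> fst p 0 = 0 \<and>
    (\<forall>x. deriv (fst p) x > 0) \<and> snd p \<in> vecs (sobolev r)"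
  by (cases p) (simp add: G_def Diff0_iff[OF r])

lemma bounded_linear_map_G_fst:
  assumes r: "r > 1/2"
  shows "bounded_linear_map (G_model (r + 1)) (sobolev r) (\<lambda>h. deriv (fst h))"
  unfolding G_model_eq
  by (rule bounded_linear_map_compose[OF bounded_linear_map_fst bounded_linear_map_deriv[OF r]])
     (intro normed_subspace_prod_space normed_subspace_sobolev0 normed_subspace_sobolev)+

lemma bounded_linear_map_G_snd: "bounded_linear_map (G_model (r + 1)) (sobolev r) snd"
  unfolding G_model_eq by (rule bounded_linear_map_snd[OF normed_subspace_sobolev0])

lemma deriv_add_G_model:
  assumes r: "r > 1/2" and p: "p \<in> G (r + 1)" and h: "h \<in> vecs (G_model (r + 1))"
  shows "deriv (fst (p + h)) = deriv (fst p) + deriv (fst h)"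
proof
  fix x
  have "fst h \<in> vecs (sobolev (r + 1))"
    using h by (auto simp: G_model_eq vecs_prod_space mem_sobolev0_iff)
  from DERIV_add[OF lift_has_derivative(1)[OF r] sobolev_derivative(1)[OF r this]] p
  have "((\<lambda>x. fst p x + fst h x) has_real_derivative deriv (fst p) x + deriv (fst h) x) (at x)"
    by (simp add: G_iff[OF r])
  then show "deriv (fst (p + h)) x = (deriv (fst p) + deriv (fst h)) x"
    by (simp add: plus_fun_def DERIV_imp_deriv)
qed

text \<open>Here the global logarithm lemma enters on the side of the group: ln \<phi>_x has to lie
  in H^r for the exponential formulas to be expressions in the algebra.\<close>

lemma density_mem_log_domain:
  assumes r: "r > 1/2" and p: "p \<in> G (r + 1)"
  shows "deriv (fst p) \<in> function_algebra.log_domain (sobolev r)"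
proof -
  interpret function_algebra "sobolev r" "sobolev_const r" by (rule function_algebra_sobolev[OF r])
  have "deriv (fst p) \<in> vecs (sobolev r)" "\<And>x. deriv (fst p) x > 0"
    using p lift_has_derivative(2)[OF r] by (auto simp: G_iff[OF r])
  then show ?thesis using ln_mem_sobolev[OF r] by (simp add: log_domain_def)
qed

text \<open>Positivity of the density is an open condition because \<open>log_domain\<close> is open
  and p to \<phi>_x is affine and continuous; the remaining conditions are preserved by every
  increment in the model space.\<close>

lemma open_in_G:
  assumes r: "r > 1/2"
  shows "open_in (G_model (r + 1)) (G (r + 1))"
  unfolding open_in_def
proof
  interpret function_algebra "sobolev r" "sobolev_const r" by (rule function_algebra_sobolev[OF r])
  interpret S: normed_subspace "sobolev (r + 1)" by (rule normed_subspace_sobolev)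
  fix p assume p: "p \<in> G (r + 1)"
  obtain d where d: "d > 0" "\<And>h. h \<in> vecs (G_model (r + 1)) \<Longrightarrow> nrm (G_model (r + 1)) h < d \<Longrightarrow>
      deriv (fst p) + deriv (fst h) \<in> log_domain"
    using log_domain_open_affine[OF normed_subspace_G_model bounded_linear_map_G_fst[OF r]
        density_mem_log_domain[OF r p]] by metis
  show "\<exists>d>0. \<forall>h\<in>vecs (G_model (r + 1)). nrm (G_model (r + 1)) h < d \<longrightarrow> p + h \<in> G (r + 1)"
  proof (intro exI[of _ d] conjI ballI impI d(1))
    fix h assume h: "h \<in> vecs (G_model (r + 1))" "nrm (G_model (r + 1)) h < d"
    then have hm: "fst h \<in> vecs (sobolev (r + 1))" "fst h 0 = 0" "snd h \<in> vecs (sobolev r)"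
      by (auto simp: G_model_eq vecs_prod_space mem_sobolev0_iff)
    have pm: "(\<lambda>x. fst p x - x) \<in> vecs (sobolev (r + 1))" "fst p 0 = 0" "snd p \<in> vecs (sobolev r)"
      using p by (auto simp: G_iff[OF r])
    have "(\<lambda>x. fst p x - x) + fst h = (\<lambda>x. fst (p + h) x - x)" by (simp add: fun_eq_iff)
    then have "(\<lambda>x. fst (p + h) x - x) \<in> vecs (sobolev (r + 1))"
      using S.mem_add[OF pm(1) hm(1)] by simp
    moreover have "\<forall>x. deriv (fst (p + h)) x > 0"
      using d(2)[OF h] unfolding deriv_add_G_model[OF r p h(1)] by (simp add: log_domain_def)
    ultimately show "p + h \<in> G (r + 1)"
      using hm pm mem_add[OF pm(3) hm(3)] by (simp add: G_iff[OF r])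
  qed
qed

text \<open>These are the functions c * \<phi>_x^a * exp (b * \<alpha>). The family contains its
  partials: varying \<phi>_x leads from (c, a, b) to (c a, a - 1, b), varying \<alpha> to (c b, a,
  b).\<close>

definition density_family ::
    "real \<times> real \<times> real \<Rightarrow> (real \<Rightarrow> real) \<times> (real \<Rightarrow> real) \<Rightarrow> real \<Rightarrow> real" where
  "density_family = (\<lambda>(c, a, b) p t. c * exp (a * ln (deriv (fst p) t) + b * snd p t))"

lemma density_family_has_derivative:
  assumes r: "r > 1/2" and p: "p \<in> G (r + 1)"
  shows "has_frechet_derivative (G_model (r + 1)) (sobolev r) (density_family (c, a, b))
    (\<lambda>h. density_family (c * a, a - 1, b) p * deriv (fst h) + density_family (c * b, a, b) p * snd h) p"
proof -
  interpret function_algebra "sobolev r" "sobolev_const r" by (rule function_algebra_sobolev[OF r])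
  note E = normed_subspace_G_model[of r]
  have pos: "deriv (fst p) \<in> log_domain" by (rule density_mem_log_domain[OF r p])
  have U: "has_frechet_derivative (G_model (r + 1)) (sobolev r) (\<lambda>p t. ln (deriv (fst p) t))
      (\<lambda>h. (\<lambda>t. 1 / deriv (fst p) t) * deriv (fst h)) p"
    by (rule has_frechet_derivative_ln_affine[where u = "\<lambda>p. deriv (fst p)" and x = p,
          OF E bounded_linear_map_G_fst[OF r] _ pos])
       (simp add: deriv_add_G_model[OF r p, unfolded fst_add])
  have V: "has_frechet_derivative (G_model (r + 1)) (sobolev r) snd snd p"
    by (rule has_frechet_derivative_affine[OF bounded_linear_map_G_snd _ E normed_subspace_A]) simp
  have "has_frechet_derivative (G_model (r + 1)) (sobolev r)
      (\<lambda>p t. c * exp (a * ln (deriv (fst p) t) + b * snd p t))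
      (\<lambda>h. (\<lambda>t. c * a * exp (a * ln (deriv (fst p) t) + b * snd p t)) *
          ((\<lambda>t. 1 / deriv (fst p) t) * deriv (fst h)) +
        (\<lambda>t. c * b * exp (a * ln (deriv (fst p) t) + b * snd p t)) * snd h) p"
    using p pos by (intro has_frechet_derivative_exp_comb[OF E U V]) (auto simp: log_domain_def G_iff[OF r])
  moreover have "exp ((a - 1) * ln (deriv (fst p) t) + b * snd p t) =
      exp (a * ln (deriv (fst p) t) + b * snd p t) * (1 / deriv (fst p) t)" for t
  proof -
    have "deriv (fst p) t > 0" using p by (simp add: G_iff[OF r])
    then show ?thesis by (simp add: left_diff_distrib exp_diff exp_add field_simps)
  qed
  ultimately show ?thesis
    by (simp add: density_family_def times_fun_def mult.assoc)
qed

lemma density_family_mem: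
  assumes r: "r > 1/2" and p: "p \<in> G (r + 1)"
  shows "density_family i p \<in> vecs (sobolev r)"
proof -
  interpret function_algebra "sobolev r" "sobolev_const r" by (rule function_algebra_sobolev[OF r])
  obtain c a b where i: "i = (c, a, b)" by (metis prod_cases3)
  show ?thesis
    using density_mem_log_domain[OF r p] p exp_comb_mem[of "\<lambda>t. ln (deriv (fst p) t)" "snd p" c a b]
    by (auto simp: i density_family_def log_domain_def G_iff[OF r])
qed

lemma density_family_smooth:
  assumes r: "r > 1/2"
  shows "smooth_on_open (G_model (r + 1)) (sobolev r) (G (r + 1)) (density_family i)"
proof -
  interpret function_algebra "sobolev r" "sobolev_const r" by (rule function_algebra_sobolev[OF r])
  show ?thesis
  \<comment> \<open>The Booleans index the two directions: \<open>True\<close> varies the density,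
    \<open>False\<close> varies \<alpha>.\<close>
  proof (rule smooth_on_open_family[where T = UNIV
        and l = "\<lambda>t h. if t then deriv (fst h) else snd h"
        and pd = "\<lambda>t (c, a, b). if t then (c * a, a - 1, b) else (c * b, a, b)"])
    fix i :: "real \<times> real \<times> real" and p assume p: "p \<in> G (r + 1)"
    obtain c a b where i: "i = (c, a, b)" by (metis prod_cases3)
    show "density_family i p \<in> vecs (sobolev r)" by (rule density_family_mem[OF r p])
    show "has_frechet_derivative (G_model (r + 1)) (sobolev r) (density_family i)
        (\<lambda>h. \<Sum>t\<in>UNIV. density_family ((\<lambda>(c, a, b). if t then (c * a, a - 1, b) else (c * b, a, b)) i) p *
          (if t then deriv (fst h) else snd h)) p"
      using density_family_has_derivative[OF r p, of c a b] by (simp add: i UNIV_bool add.commute)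
  next
    fix t
    show "bounded_linear_map (G_model (r + 1)) (sobolev r) (\<lambda>h. if t then deriv (fst h) else snd h)"
      using bounded_linear_map_G_fst[OF r] bounded_linear_map_G_snd by (cases t) simp_all
  qed (simp_all add: normed_subspace_G_model open_in_G[OF r])
qed

text \<open>Returns from the null coordinates to (f_1, f_2). The form with 0 matches the rule for
  linear maps L + c M.\<close>

definition half_sum_diff ::
    "(real \<Rightarrow> real) \<times> (real \<Rightarrow> real) \<Rightarrow> (real \<Rightarrow> real) \<times> (real \<Rightarrow> real)" where
  "half_sum_diff p = ((0 + (1/2) *\<^sub>R fst p) + (1/2) *\<^sub>R snd p, (0 + (1/2) *\<^sub>R fst p) + (-1/2) *\<^sub>R snd p)"

lemma bounded_linear_map_half_sum_diff:
  "bounded_linear_map (S_ambient r) (S_ambient r) half_sum_diff"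
  unfolding half_sum_diff_def[abs_def] S_ambient_def
  by (intro bounded_linear_map_Pair bounded_linear_map_add_scaleR bounded_linear_map_zero
      bounded_linear_map_fst bounded_linear_map_snd normed_subspace_prod_space normed_subspace_sobolev)

lemma sqrt_eq_exp:
  assumes "x > 0"
  shows "sqrt x = exp (ln x / 2)"
proof -
  have "ln x / 2 = ln (sqrt x)" using assms by (simp add: ln_sqrt)
  then show ?thesis using assms by (simp only: exp_ln real_sqrt_gt_zero)
qed

lemma Phi_eq:
  assumes r: "r > 1/2" and p: "p \<in> G (r + 1)"
  shows "Phi p = half_sum_diff (density_family (1, 1/2, 1/2) p, density_family (1, 1/2, -1/2) p)"
proof -
  have "sqrt (deriv (fst p) x) = exp (ln (deriv (fst p) x) / 2)" for x
    using p by (intro sqrt_eq_exp) (simp add: G_iff[OF r])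
  then show ?thesis
    by (cases p) (simp add: Phi_def half_sum_diff_def density_family_def fun_eq_iff
        scaleR_fun_def cosh_def sinh_def exp_add exp_diff exp_minus field_simps)
qed

lemma Phi_smooth:
  assumes r: "r > 1/2"
  shows "smooth_on_open (G_model (r + 1)) (S_ambient r) (G (r + 1)) Phi"
proof (rule smooth_on_open_affine_compose[OF _ bounded_linear_map_half_sum_diff])
  show "smooth_on_open (G_model (r + 1)) (S_ambient r) (G (r + 1))
      (\<lambda>p. (density_family (1, 1/2, 1/2) p, density_family (1, 1/2, -1/2) p))"
    unfolding S_ambient_def
    by (intro smooth_on_open_Pair density_family_smooth[OF r] normed_subspace_G_model normed_subspace_sobolev)
  show "Phi q - Phi p = half_sum_diff
      ((density_family (1, 1/2, 1/2) q, density_family (1, 1/2, -1/2) q) -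
       (density_family (1, 1/2, 1/2) p, density_family (1, 1/2, -1/2) p))"
    if "p \<in> G (r + 1)" "q \<in> G (r + 1)" for p q
    unfolding Phi_eq[OF r that(1)] Phi_eq[OF r that(2)] half_sum_diff_def
    by (simp add: fun_eq_iff scaleR_fun_def algebra_simps)
qed (intro normed_subspace_G_model normed_subspace_S_ambient)+

text \<open>The region f_1 > |f_2| of the ambient space, without the normalization of the integral.
  It is open there and contains \<open>U_set r\<close>, so it can carry the smooth extension of the
  inverse.\<close>

definition null_cone :: "real \<Rightarrow> ((real \<Rightarrow> real) \<times> (real \<Rightarrow> real)) set" where
  "null_cone r = {f \<in> vecs (S_ambient r). \<forall>x. fst f x + snd f x > 0 \<and> fst f x - snd f x > 0}"

lemma bounded_linear_map_null_coords:
  "bounded_linear_map (S_ambient r) (sobolev r) (\<lambda>f. fst f + snd f)"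
  "bounded_linear_map (S_ambient r) (sobolev r) (\<lambda>f. fst f - snd f)"
proof -
  have *: "bounded_linear_map (S_ambient r) (sobolev r) (\<lambda>f. fst f + c *\<^sub>R snd f)" for c
    unfolding S_ambient_def
    by (intro bounded_linear_map_add_scaleR bounded_linear_map_fst bounded_linear_map_snd
        normed_subspace_prod_space normed_subspace_sobolev)
  show "bounded_linear_map (S_ambient r) (sobolev r) (\<lambda>f. fst f + snd f)"
    "bounded_linear_map (S_ambient r) (sobolev r) (\<lambda>f. fst f - snd f)"
    using *[of 1] *[of "-1"] by simp_all
qed

lemma null_cone_log_domain:
  assumes r: "r > 1/2" and f: "f \<in> null_cone r"
  shows "fst f + snd f \<in> function_algebra.log_domain (sobolev r)"
    and "fst f - snd f \<in> function_algebra.log_domain (sobolev r)"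
proof -
  interpret function_algebra "sobolev r" "sobolev_const r" by (rule function_algebra_sobolev[OF r])
  have m: "fst f + snd f \<in> vecs (sobolev r)" "fst f - snd f \<in> vecs (sobolev r)"
    using f by (auto simp: null_cone_def S_ambient_def vecs_prod_space intro: mem_add mem_diff)
  have "(fst f + snd f) x > 0" "(fst f - snd f) x > 0" for x
    using f by (auto simp: null_cone_def)
  then show "fst f + snd f \<in> log_domain" "fst f - snd f \<in> log_domain"
    using m ln_mem_sobolev[OF r m(1)] ln_mem_sobolev[OF r m(2)] unfolding log_domain_def by blast+
qed

lemma open_in_null_cone:
  assumes r: "r > 1/2"
  shows "open_in (S_ambient r) (null_cone r)"
  unfolding open_in_def
proof
  interpret function_algebra "sobolev r" "sobolev_const r" by (rule function_algebra_sobolev[OF r])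
  interpret S: normed_subspace "S_ambient r" by (rule normed_subspace_S_ambient)
  fix f assume f: "f \<in> null_cone r"
  obtain d1 where d1: "d1 > 0" "\<And>h. h \<in> vecs (S_ambient r) \<Longrightarrow> nrm (S_ambient r) h < d1 \<Longrightarrow>
      (fst f + snd f) + (fst h + snd h) \<in> log_domain"
    using log_domain_open_affine[OF normed_subspace_S_ambient bounded_linear_map_null_coords(1)
        null_cone_log_domain(1)[OF r f]] by metis
  obtain d2 where d2: "d2 > 0" "\<And>h. h \<in> vecs (S_ambient r) \<Longrightarrow> nrm (S_ambient r) h < d2 \<Longrightarrow>
      (fst f - snd f) + (fst h - snd h) \<in> log_domain"
    using log_domain_open_affine[OF normed_subspace_S_ambient bounded_linear_map_null_coords(2)
        null_cone_log_domain(2)[OF r f]] by metis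
  show "\<exists>d>0. \<forall>h\<in>vecs (S_ambient r). nrm (S_ambient r) h < d \<longrightarrow> f + h \<in> null_cone r"
  proof (intro exI[of _ "min d1 d2"] conjI ballI impI)
    fix h assume h: "h \<in> vecs (S_ambient r)" "nrm (S_ambient r) h < min d1 d2"
    have "((fst f + snd f) + (fst h + snd h)) x > 0" "((fst f - snd f) + (fst h - snd h)) x > 0" for x
      using d1(2)[OF h(1)] d2(2)[OF h(1)] h(2) unfolding log_domain_def by auto
    then have "fst (f + h) x + snd (f + h) x > 0" "fst (f + h) x - snd (f + h) x > 0" for x
      by (simp_all add: algebra_simps)
    then show "f + h \<in> null_cone r"
      using f h S.mem_add by (simp add: null_cone_def)
  qed (use d1 d2 in auto)
qed

text \<open>With u = f_1 + f_2 and v = f_1 - f_2, \<open>None\<close> is the component \<alpha> = ln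
  u - ln v of the inverse and \<open>Some (c, a, b)\<close> is c * u^a * v^b. The partials 1/u and
  -1/v of the former belong to the latter kind, so the whole is closed under
  differentiation.\<close>

definition null_family ::
    "(real \<times> real \<times> real) option \<Rightarrow> (real \<Rightarrow> real) \<times> (real \<Rightarrow> real) \<Rightarrow> real \<Rightarrow> real" where
  "null_family i f t = (case i of
     None \<Rightarrow> ln ((fst f + snd f) t) - ln ((fst f - snd f) t)
   | Some (c, a, b) \<Rightarrow> c * exp (a * ln ((fst f + snd f) t) + b * ln ((fst f - snd f) t)))"

lemma null_family_simps:
  "null_family None f = (\<lambda>t. ln ((fst f + snd f) t) - ln ((fst f - snd f) t))"
  "null_family (Some (c, a, b)) f =
    (\<lambda>t. c * exp (a * ln ((fst f + snd f) t) + b * ln ((fst f - snd f) t)))"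
  by (simp_all add: null_family_def fun_eq_iff)

definition null_partial ::
    "bool \<Rightarrow> (real \<times> real \<times> real) option \<Rightarrow> (real \<times> real \<times> real) option" where
  "null_partial t i = (case i of
     None \<Rightarrow> if t then Some (1, -1, 0) else Some (-1, 0, -1)
   | Some (c, a, b) \<Rightarrow> if t then Some (c * a, a - 1, b) else Some (c * b, a, b - 1))"

lemma null_family_smooth:
  assumes r: "r > 1/2"
  shows "smooth_on_open (S_ambient r) (sobolev r) (null_cone r) (null_family i)"
proof -
  interpret function_algebra "sobolev r" "sobolev_const r" by (rule function_algebra_sobolev[OF r])
  note E = normed_subspace_S_ambient[of r] and A = normed_subspace_A
  show ?thesis
  proof (rule smooth_on_open_family[where T = UNIV
        and l = "\<lambda>t h. if t then fst h + snd h else fst h - snd h" and pd = null_partial])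
    fix i f assume f: "f \<in> null_cone r"
    note pos = null_cone_log_domain[OF r f]
    have ln_mem: "(\<lambda>t. ln ((fst f + snd f) t)) \<in> vecs (sobolev r)"
      "(\<lambda>t. ln ((fst f - snd f) t)) \<in> vecs (sobolev r)"
      using pos unfolding log_domain_def by auto
    have ne: "fst f t + snd f t > 0" "fst f t - snd f t > 0" for t using f by (auto simp: null_cone_def)
    have U: "has_frechet_derivative (S_ambient r) (sobolev r) (\<lambda>f t. ln ((fst f + snd f) t))
        (\<lambda>h. (\<lambda>t. 1 / (fst f + snd f) t) * (fst h + snd h)) f"
      by (rule has_frechet_derivative_ln_affine[where u = "\<lambda>f. fst f + snd f" and x = f,
            OF E bounded_linear_map_null_coords(1) _ pos(1)])
         (simp add: fun_eq_iff)
    have V: "has_frechet_derivative (S_ambient r) (sobolev r) (\<lambda>f t. ln ((fst f - snd f) t))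
        (\<lambda>h. (\<lambda>t. 1 / (fst f - snd f) t) * (fst h - snd h)) f"
      by (rule has_frechet_derivative_ln_affine[where u = "\<lambda>f. fst f - snd f" and x = f,
            OF E bounded_linear_map_null_coords(2) _ pos(2)])
         (simp add: fun_eq_iff)
    show "null_family i f \<in> vecs (sobolev r)"
    proof (cases i)
      case None
      then show ?thesis using mem_diff[OF ln_mem] by (simp add: null_family_simps fun_diff_def)
    next
      case (Some cab)
      then show ?thesis using exp_comb_mem[OF ln_mem] by (cases cab) (simp add: null_family_simps)
    qed
    have "(\<lambda>h. \<Sum>t\<in>UNIV. null_family (null_partial t i) f * (if t then fst h + snd h else fst h - snd h)) =
        (\<lambda>h. null_family (null_partial True i) f * (fst h + snd h) +
          null_family (null_partial False i) f * (fst h - snd h))"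
      by (simp add: UNIV_bool add.commute)
    moreover have "has_frechet_derivative (S_ambient r) (sobolev r) (null_family i)
        (\<lambda>h. null_family (null_partial True i) f * (fst h + snd h) +
          null_family (null_partial False i) f * (fst h - snd h)) f"
    proof (cases i)
      case None
      have "has_frechet_derivative (S_ambient r) (sobolev r)
          (\<lambda>f. (\<lambda>t. ln ((fst f + snd f) t)) + (-1) *\<^sub>R (\<lambda>t. ln ((fst f - snd f) t)))
          (\<lambda>h. (\<lambda>t. 1 / (fst f + snd f) t) * (fst h + snd h) +
            (-1) *\<^sub>R ((\<lambda>t. 1 / (fst f - snd f) t) * (fst h - snd h))) f"
        by (rule has_frechet_derivative_add_scaleR[OF U V E A])
      moreover have "(\<lambda>f. (\<lambda>t. ln ((fst f + snd f) t)) + (-1) *\<^sub>R (\<lambda>t. ln ((fst f - snd f) t))) =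
          null_family i"
        by (simp add: None null_family_def fun_eq_iff scaleR_fun_def)
      moreover have "(\<lambda>h. (\<lambda>t. 1 / (fst f + snd f) t) * (fst h + snd h) +
            (-1) *\<^sub>R ((\<lambda>t. 1 / (fst f - snd f) t) * (fst h - snd h))) =
          (\<lambda>h. null_family (null_partial True i) f * (fst h + snd h) +
            null_family (null_partial False i) f * (fst h - snd h))"
        using ne by (simp add: None null_family_def null_partial_def fun_eq_iff scaleR_fun_def exp_minus field_simps)
      ultimately show ?thesis by (simp only:)
    next
      case (Some cab)
      obtain c a b where i: "i = Some (c, a, b)" using Some by (cases cab) auto
      have "has_frechet_derivative (S_ambient r) (sobolev r)
          (\<lambda>f t. c * exp (a * ln ((fst f + snd f) t) + b * ln ((fst f - snd f) t)))
          (\<lambda>h. (\<lambda>t. c * a * exp (a * ln ((fst f + snd f) t) + b * ln ((fst f - snd f) t))) *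
              ((\<lambda>t. 1 / (fst f + snd f) t) * (fst h + snd h)) +
            (\<lambda>t. c * b * exp (a * ln ((fst f + snd f) t) + b * ln ((fst f - snd f) t))) *
              ((\<lambda>t. 1 / (fst f - snd f) t) * (fst h - snd h))) f"
        by (rule has_frechet_derivative_exp_comb[OF E U V ln_mem])
      moreover have "(\<lambda>f t. c * exp (a * ln ((fst f + snd f) t) + b * ln ((fst f - snd f) t))) = null_family i"
        by (simp add: i null_family_def fun_eq_iff)
      moreover have "(\<lambda>h. (\<lambda>t. c * a * exp (a * ln ((fst f + snd f) t) + b * ln ((fst f - snd f) t))) *
              ((\<lambda>t. 1 / (fst f + snd f) t) * (fst h + snd h)) +
            (\<lambda>t. c * b * exp (a * ln ((fst f + snd f) t) + b * ln ((fst f - snd f) t))) *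
              ((\<lambda>t. 1 / (fst f - snd f) t) * (fst h - snd h))) =
          (\<lambda>h. null_family (null_partial True i) f * (fst h + snd h) +
            null_family (null_partial False i) f * (fst h - snd h))"
      proof -
        have "exp ((a - 1) * ln (fst f t + snd f t) + w) = exp (a * ln (fst f t + snd f t) + w) * (1 / (fst f t + snd f t))"
          "exp (w + (b - 1) * ln (fst f t - snd f t)) = exp (w + b * ln (fst f t - snd f t)) * (1 / (fst f t - snd f t))" for t w
          using ne[of t] by (simp_all add: left_diff_distrib exp_add exp_diff)
        then show ?thesis
          by (simp add: i null_family_def null_partial_def fun_eq_iff mult_ac)
      qed
      ultimately show ?thesis by (simp only:)
    qed
    ultimately show "has_frechet_derivative (S_ambient r) (sobolev r) (null_family i)
        (\<lambda>h. \<Sum>t\<in>UNIV. null_family (null_partial t i) f * (if t then fst h + snd h else fst h - snd h)) f"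
      by (simp only:)
  next
    fix t
    show "bounded_linear_map (S_ambient r) (sobolev r) (\<lambda>h. if t then fst h + snd h else fst h - snd h)"
      using bounded_linear_map_null_coords by (cases t) simp_all
  qed (simp_all add: normed_subspace_S_ambient open_in_null_cone[OF r])
qed

text \<open>Where the product u v has mean 1, the subtracted mean x cancels the identity and the
  first component is simply the antiderivative of u v. Elsewhere on the cone the first component is
  still the identity plus a periodic function, so differences lie in the model space.\<close>

definition Phi_inverse ::
    "(real \<Rightarrow> real) \<times> (real \<Rightarrow> real) \<Rightarrow> (real \<Rightarrow> real) \<times> (real \<Rightarrow> real)" where
  "Phi_inverse f = (\<lambda>x. x + mean_free_antideriv ((fst f + snd f) * (fst f - snd f)) x, null_family None f)"

lemma null_family_mult:
  "f \<in> null_cone r \<Longrightarrow> null_family (Some (1, 1, 1)) f = (fst f + snd f) * (fst f - snd f)"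
  by (simp add: null_cone_def null_family_def fun_eq_iff exp_add)

text \<open>The identity drops out of increments, which are a linear image of increments of members
  of \<open>null_family\<close>.\<close>

lemma Phi_inverse_smooth:
  assumes r: "r > 1/2"
  shows "smooth_on_open (S_ambient r) (G_model (r + 1)) (null_cone r) Phi_inverse"
proof (rule smooth_on_open_affine_compose)
  let ?L = "\<lambda>y. (mean_free_antideriv (fst y), snd y)"
  show "smooth_on_open (S_ambient r) (prod_space (sobolev r) (sobolev r)) (null_cone r)
      (\<lambda>f. (null_family (Some (1, 1, 1)) f, null_family None f))"
    by (intro smooth_on_open_Pair null_family_smooth[OF r] normed_subspace_S_ambient normed_subspace_sobolev)
  show L: "bounded_linear_map (prod_space (sobolev r) (sobolev r)) (G_model (r + 1)) ?L"
    unfolding G_model_eq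
    by (intro bounded_linear_map_Pair bounded_linear_map_snd normed_subspace_prod_space
        normed_subspace_sobolev normed_subspace_sobolev0
        bounded_linear_map_compose[OF bounded_linear_map_fst bounded_linear_map_mean_free_antideriv[OF r]])
  fix f g assume fg: "f \<in> null_cone r" "g \<in> null_cone r"
  interpret function_algebra "sobolev r" "sobolev_const r" by (rule function_algebra_sobolev[OF r])
  have m: "null_family i h \<in> vecs (sobolev r)" if h: "h \<in> null_cone r" and "i = Some (1, 1, 1)" for h i
  proof -
    have "(fst h + snd h) * (fst h - snd h) \<in> vecs (sobolev r)"
      using null_cone_log_domain[OF r h] by (auto simp: log_domain_def intro: mem_mult)
    then show ?thesis using null_family_mult[OF h] that by simp
  qed
  have "mean_free_antideriv (null_family (Some (1, 1, 1)) g - null_family (Some (1, 1, 1)) f) =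
      mean_free_antideriv (null_family (Some (1, 1, 1)) g) - mean_free_antideriv (null_family (Some (1, 1, 1)) f)"
    by (intro bounded_linear_map_diff[OF bounded_linear_map_mean_free_antideriv[OF r]] m fg refl)
  then show "Phi_inverse g - Phi_inverse f = ?L ((null_family (Some (1, 1, 1)) g, null_family None g) -
      (null_family (Some (1, 1, 1)) f, null_family None f))"
    by (simp add: Phi_inverse_def null_family_mult[OF fg(1)] null_family_mult[OF fg(2)] fun_eq_iff)
qed (intro normed_subspace_S_ambient normed_subspace_G_model normed_subspace_prod_space normed_subspace_sobolev)+

subsection \<open>Bijectivity\<close>

lemma U_set_iff:
  "f \<in> U_set r \<longleftrightarrow> f \<in> vecs (S_ambient r) \<and>
    integral {0..1} (\<lambda>x. (fst f x)\<^sup>2 - (snd f x)\<^sup>2) = 1 \<and>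
    (\<forall>x. fst f x > 0 \<and> (fst f x)\<^sup>2 - (snd f x)\<^sup>2 > 0)"
  by (cases f) (auto simp: U_set_def pseudosphere_H_def pseudosphere_def S_ambient_def
      vecs_prod_space sobolev_def)

text \<open>The null coordinates have a positive product and the positive sum 2 f_1, so both are
  positive.\<close>

lemma U_set_subset_null_cone: "U_set r \<subseteq> null_cone r"
proof
  fix f assume f: "f \<in> U_set r"
  have "fst f x + snd f x > 0 \<and> fst f x - snd f x > 0" for x
  proof -
    have "fst f x > 0" "(fst f x + snd f x) * (fst f x - snd f x) > 0"
      using f by (auto simp: U_set_iff power2_eq_square algebra_simps)
    then show ?thesis by (auto simp: zero_less_mult_iff)
  qed
  then show "f \<in> null_cone r" using f by (simp add: null_cone_def U_set_iff)
qed

lemma null_coords_mult: "(fst f + snd f) * (fst f - snd f) = (\<lambda>x. (fst f x)\<^sup>2 - (snd f x)\<^sup>2 :: real)"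
  by (simp add: fun_eq_iff power2_eq_square algebra_simps)

text \<open>By cosh^2 - sinh^2 = 1 the pseudonorm density of the image is \<phi>_x, whose integral
  over a period is \<phi>(1) - \<phi>(0) = 1.\<close>

lemma Phi_mem:
  assumes r: "r > 1/2" and p: "p \<in> G (r + 1)"
  shows "Phi p \<in> U_set r"
proof -
  have pos: "deriv (fst p) x > 0" for x using p by (simp add: G_iff[OF r])
  have u: "(\<lambda>x. fst p x - x) \<in> vecs (sobolev (r + 1))" "fst p 0 = 0"
    using p by (auto simp: G_iff[OF r])
  have "(density_family (1, 1/2, 1/2) p, density_family (1, 1/2, -1/2) p) \<in> vecs (S_ambient r)"
    by (simp add: S_ambient_def vecs_prod_space density_family_mem[OF r p])
  then have "Phi p \<in> vecs (S_ambient r)"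
    unfolding Phi_eq[OF r p] by (rule bounded_linear_map_mem[OF bounded_linear_map_half_sum_diff])
  moreover have sq: "(fst (Phi p) x)\<^sup>2 - (snd (Phi p) x)\<^sup>2 = deriv (fst p) x" for x
  proof -
    have "(fst (Phi p) x)\<^sup>2 - (snd (Phi p) x)\<^sup>2 =
        deriv (fst p) x * ((cosh (snd p x / 2))\<^sup>2 - (sinh (snd p x / 2))\<^sup>2)"
      using pos[of x] by (cases p) (simp add: Phi_def power_mult_distrib right_diff_distrib)
    then show ?thesis by (simp add: cosh_square_eq)
  qed
  moreover have "integral {0..1} (deriv (fst p)) = 1"
    using integral_deriv_period[OF lift_has_derivative(1)[OF r u(1)]] lift_shift[OF u(1), of 0] u(2)
    by (simp add: integral_unique)
  moreover have "fst (Phi p) x > 0" for x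
    using pos[of x] by (cases p) (simp add: Phi_def)
  ultimately show ?thesis using pos by (simp add: U_set_iff)
qed

text \<open>On the pseudosphere the subtracted mean is 1 and cancels the derivative of the
  identity.\<close>

lemma Phi_inverse_deriv:
  assumes r: "r > 1/2" and f: "f \<in> U_set r"
  shows "(fst (Phi_inverse f) has_real_derivative (fst f x + snd f x) * (fst f x - snd f x)) (at x)"
    and "(\<lambda>x. fst (Phi_inverse f) x - x) \<in> vecs (sobolev0 (r + 1))"
proof -
  interpret function_algebra "sobolev r" "sobolev_const r" by (rule function_algebra_sobolev[OF r])
  define y where "y = (fst f + snd f) * (fst f - snd f)"
  have y: "y \<in> vecs (sobolev r)"
    using f by (auto simp: y_def U_set_iff S_ambient_def vecs_prod_space intro!: mem_mult mem_add mem_diff)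
  have yx: "y x = (fst f x + snd f x) * (fst f x - snd f x)" for x by (simp add: y_def)
  have mean: "integral {0..1} y = 1" using f by (simp add: y_def null_coords_mult U_set_iff)
  have eq: "fst (Phi_inverse f) = (\<lambda>x. x + mean_free_antideriv y x)"
    by (simp add: Phi_inverse_def y_def)
  show "(fst (Phi_inverse f) has_real_derivative (fst f x + snd f x) * (fst f x - snd f x)) (at x)"
    using DERIV_add[OF DERIV_ident mean_free_antideriv_has_derivative[OF sobolev_continuous[OF y], of x]]
    by (simp add: eq mean yx)
  show "(\<lambda>x. fst (Phi_inverse f) x - x) \<in> vecs (sobolev0 (r + 1))"
    using bounded_linear_map_mem[OF bounded_linear_map_mean_free_antideriv[OF r] y] by (simp add: eq)
qed

lemma Phi_inverse_mem:
  assumes r: "r > 1/2" and f: "f \<in> U_set r"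
  shows "Phi_inverse f \<in> G (r + 1)"
proof -
  interpret function_algebra "sobolev r" "sobolev_const r" by (rule function_algebra_sobolev[OF r])
  have nc: "f \<in> null_cone r" using f U_set_subset_null_cone by blast
  have "snd (Phi_inverse f) \<in> vecs (sobolev r)"
    using null_cone_log_domain[OF r nc] mem_diff[of "\<lambda>t. ln ((fst f + snd f) t)" "\<lambda>t. ln ((fst f - snd f) t)"]
    by (simp add: Phi_inverse_def null_family_simps log_domain_def fun_diff_def)
  moreover have "deriv (fst (Phi_inverse f)) x > 0" for x
    using nc DERIV_imp_deriv[OF Phi_inverse_deriv(1)[OF r f, of x]] by (simp add: null_cone_def)
  ultimately show ?thesis
    using Phi_inverse_deriv(2)[OF r f] by (simp add: G_iff[OF r] mem_sobolev0_iff)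
qed

lemma Phi_Phi_inverse:
  assumes r: "r > 1/2" and f: "f \<in> U_set r"
  shows "Phi (Phi_inverse f) = f"
proof -
  have pos: "fst f x + snd f x > 0" "fst f x - snd f x > 0" for x
    using f U_set_subset_null_cone[of r] by (auto simp: null_cone_def)
  have d: "deriv (fst (Phi_inverse f)) x = (fst f x + snd f x) * (fst f x - snd f x)" for x
    by (rule DERIV_imp_deriv[OF Phi_inverse_deriv(1)[OF r f]])
  have s: "snd (Phi_inverse f) x = ln (fst f x + snd f x) - ln (fst f x - snd f x)" for x
    by (simp add: Phi_inverse_def null_family_simps)
  have l: "ln ((fst f x + snd f x) * (fst f x - snd f x)) = ln (fst f x + snd f x) + ln (fst f x - snd f x)" for x
    using pos[of x] by (simp add: ln_mult)
  have "1/2 * ln (deriv (fst (Phi_inverse f)) x) + 1/2 * snd (Phi_inverse f) x = ln (fst f x + snd f x)"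
    "1/2 * ln (deriv (fst (Phi_inverse f)) x) + -1/2 * snd (Phi_inverse f) x = ln (fst f x - snd f x)" for x
    unfolding d s l by (simp_all add: field_simps)
  then have c: "density_family (1, 1/2, 1/2) (Phi_inverse f) = fst f + snd f"
    "density_family (1, 1/2, -1/2) (Phi_inverse f) = fst f - snd f"
    unfolding density_family_def split_conv using pos by (simp_all only: exp_ln) (simp_all add: fun_eq_iff)
  show ?thesis
    unfolding Phi_eq[OF r Phi_inverse_mem[OF r f]] c
    by (simp add: half_sum_diff_def prod_eq_iff fun_eq_iff scaleR_fun_def field_simps)
qed

lemma density_family_mult:
  assumes r: "r > 1/2" and p: "p \<in> G (r + 1)"
  shows "density_family (1, 1/2, 1/2) p x * density_family (1, 1/2, -1/2) p x = deriv (fst p) x"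
proof -
  have "deriv (fst p) x > 0" using p by (simp add: G_iff[OF r])
  then show ?thesis by (simp add: density_family_def flip: exp_add)
qed

text \<open>The first components have the same derivative \<phi>_x and both vanish at 0; the second
  is the difference of the two logarithms.\<close>

lemma Phi_inverse_Phi:
  assumes r: "r > 1/2" and p: "p \<in> G (r + 1)"
  shows "Phi_inverse (Phi p) = p"
proof (rule prod_eqI)
  have u: "(\<lambda>x. fst p x - x) \<in> vecs (sobolev (r + 1))" "fst p 0 = 0"
    using p by (auto simp: G_iff[OF r])
  have sum: "fst (Phi p) + snd (Phi p) = density_family (1, 1/2, 1/2) p"
    and diff: "fst (Phi p) - snd (Phi p) = density_family (1, 1/2, -1/2) p"
    by (simp_all add: Phi_eq[OF r p] half_sum_diff_def fun_eq_iff scaleR_fun_def)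
  show "snd (Phi_inverse (Phi p)) = snd p"
    unfolding Phi_inverse_def snd_conv null_family_simps sum diff
    by (simp add: density_family_def fun_eq_iff)
  have d: "(fst (Phi_inverse (Phi p)) has_real_derivative deriv (fst p) x) (at x)" for x
  proof -
    have "fst (Phi p) x + snd (Phi p) x = density_family (1, 1/2, 1/2) p x"
      "fst (Phi p) x - snd (Phi p) x = density_family (1, 1/2, -1/2) p x"
      using fun_cong[OF sum, of x] fun_cong[OF diff, of x] by simp_all
    then show ?thesis
      using Phi_inverse_deriv(1)[OF r Phi_mem[OF r p], of x] density_family_mult[OF r p, of x] by simp
  qed
  show "fst (Phi_inverse (Phi p)) = fst p"
  proof
    fix x
    show "fst (Phi_inverse (Phi p)) x = fst p x"
      by (rule antiderivative_unique[OF d lift_has_derivative(1)[OF r u(1)]])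
         (simp add: u(2) Phi_inverse_def mean_free_antideriv_def)
  qed
qed

lemma Phi_bij_betw:
  assumes r: "r > 1/2"
  shows "bij_betw Phi (G (r + 1)) (U_set r)"
  by (rule bij_betw_byWitness[where f' = Phi_inverse])
     (auto simp: Phi_inverse_Phi[OF r] Phi_Phi_inverse[OF r] Phi_mem[OF r] Phi_inverse_mem[OF r])

lemma Phi_diffeomorphism:
  assumes r: "r > 1/2"
  shows "diffeomorphism_between (G_model (r + 1)) (S_ambient r) (G (r + 1)) (U_set r) Phi"
  unfolding diffeomorphism_between_def
proof (intro conjI Phi_bij_betw[OF r])
  show "smooth_map (G_model (r + 1)) (S_ambient r) (G (r + 1)) Phi"
    unfolding smooth_map_def using Phi_smooth[OF r] by blast
  have "inv_into (G (r + 1)) Phi f = Phi_inverse f" if "f \<in> U_set r" for f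
    by (rule inv_into_f_eq[OF bij_betw_imp_inj_on[OF Phi_bij_betw[OF r]]])
       (use that in \<open>simp_all add: Phi_inverse_mem[OF r] Phi_Phi_inverse[OF r]\<close>)
  then show "smooth_map (S_ambient r) (G_model (r + 1)) (U_set r) (inv_into (G (r + 1)) Phi)"
    unfolding smooth_map_def
    using Phi_inverse_smooth[OF r] U_set_subset_null_cone[of r]
    by (intro ballI exI[of _ "null_cone r"] exI[of _ Phi_inverse]) auto
qed

subsection \<open>The isometry\<close>

text \<open>The exponential formula for \<open>Phi\<close> holds on \<open>G\<close> only, and
  openness of \<open>G\<close> lets its derivative be transferred.\<close>

lemma has_frechet_derivative_cong_open:
  assumes g: "has_frechet_derivative E F g L x" and W: "open_in E W" "x \<in> W"
    and eq: "\<And>y. y \<in> W \<Longrightarrow> f y = g y"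
  shows "has_frechet_derivative E F f L x"
  unfolding has_frechet_derivative_def
proof (intro conjI allI impI)
  show "bounded_linear_map E F L" using g by (simp add: has_frechet_derivative_def)
  fix e :: real assume "e > 0"
  then obtain d1 where d1: "d1 > 0" "\<And>h. h \<in> vecs E \<Longrightarrow> nrm E h < d1 \<Longrightarrow>
      g (x + h) - g x \<in> vecs F \<and> nrm F (g (x + h) - g x - L h) \<le> e * nrm E h"
    using g unfolding has_frechet_derivative_def by metis
  obtain d2 where d2: "d2 > 0" "\<And>h. h \<in> vecs E \<Longrightarrow> nrm E h < d2 \<Longrightarrow> x + h \<in> W"
    using W unfolding open_in_def by metis
  show "\<exists>d>0. \<forall>h\<in>vecs E. nrm E h < d \<longrightarrow> f (x + h) - f x \<in> vecs F \<and>
      nrm F (f (x + h) - f x - L h) \<le> e * nrm E h"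
  proof (intro exI[of _ "min d1 d2"] conjI[of "_ < _"] ballI impI)
    fix h assume h: "h \<in> vecs E" "nrm E h < min d1 d2"
    have "f (x + h) = g (x + h)" "f x = g x" using eq d2(2)[OF h(1)] h(2) W(2) by auto
    then show "f (x + h) - f x \<in> vecs F \<and> nrm F (f (x + h) - f x - L h) \<le> e * nrm E h"
      using d1(2)[OF h(1)] h(2) by simp
  qed (use d1 d2 in auto)
qed

text \<open>The parameters are left unevaluated so that they agree literally with the instances of
  \<open>density_family_has_derivative\<close>.\<close>

definition Phi_derivative ::
    "(real \<Rightarrow> real) \<times> (real \<Rightarrow> real) \<Rightarrow> (real \<Rightarrow> real) \<times> (real \<Rightarrow> real) \<Rightarrow>
      (real \<Rightarrow> real) \<times> (real \<Rightarrow> real)" where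
  "Phi_derivative p U = half_sum_diff
     (density_family (1 * (1/2), 1/2 - 1, 1/2) p * deriv (fst U) + density_family (1 * (1/2), 1/2, 1/2) p * snd U,
      density_family (1 * (1/2), 1/2 - 1, -1/2) p * deriv (fst U) + density_family (1 * (-1/2), 1/2, -1/2) p * snd U)"

lemma Phi_has_derivative:
  assumes r: "r > 1/2" and p: "p \<in> G (r + 1)"
  shows "has_frechet_derivative (G_model (r + 1)) (S_ambient r) Phi (Phi_derivative p) p"
proof (rule has_frechet_derivative_cong_open[OF _ open_in_G[OF r] p])
  note E = normed_subspace_G_model and A = normed_subspace_sobolev and F = normed_subspace_S_ambient
  have half: "has_frechet_derivative (S_ambient r) (S_ambient r) half_sum_diff half_sum_diff q" for q
    by (rule has_frechet_derivative_affine[OF bounded_linear_map_half_sum_diff _ F F])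
       (simp add: half_sum_diff_def fun_eq_iff scaleR_fun_def algebra_simps)
  have "has_frechet_derivative (G_model (r + 1)) (S_ambient r)
      (\<lambda>p. (density_family (1, 1/2, 1/2) p, density_family (1, 1/2, -1/2) p))
      (\<lambda>U. (density_family (1 * (1/2), 1/2 - 1, 1/2) p * deriv (fst U) + density_family (1 * (1/2), 1/2, 1/2) p * snd U,
      density_family (1 * (1/2), 1/2 - 1, -1/2) p * deriv (fst U) + density_family (1 * (-1/2), 1/2, -1/2) p * snd U)) p"
    unfolding S_ambient_def
    by (rule has_frechet_derivative_Pair[OF density_family_has_derivative[OF r p]
          density_family_has_derivative[OF r p] E A A])
  from has_frechet_derivative_chain[OF this half E F F]
  show "has_frechet_derivative (G_model (r + 1)) (S_ambient r)
      (\<lambda>p. half_sum_diff (density_family (1, 1/2, 1/2) p, density_family (1, 1/2, -1/2) p))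
      (Phi_derivative p) p"
    unfolding Phi_derivative_def[abs_def] .
qed (rule Phi_eq[OF r])

text \<open>Logarithmic derivatives: with a = U_1' / \<phi>_x, the null coordinates A and B vary by
  A (a + U_2) / 2 and B (a - U_2) / 2.\<close>

lemma Phi_derivative_null_coords:
  assumes r: "r > 1/2" and p: "p \<in> G (r + 1)"
  defines "A \<equiv> density_family (1, 1/2, 1/2) p" and "B \<equiv> density_family (1, 1/2, -1/2) p"
  shows "fst (Phi_derivative p U) x = (A x * (deriv (fst U) x / deriv (fst p) x + snd U x) +
      B x * (deriv (fst U) x / deriv (fst p) x - snd U x)) / 4"
    and "snd (Phi_derivative p U) x = (A x * (deriv (fst U) x / deriv (fst p) x + snd U x) -
      B x * (deriv (fst U) x / deriv (fst p) x - snd U x)) / 4"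
proof -
  have pos: "deriv (fst p) x > 0" using p by (simp add: G_iff[OF r])
  have "density_family (1/2, -1/2, b) p x = density_family (1, 1/2, b) p x / deriv (fst p) x / 2"
    "density_family (1/2, 1/2, b) p x = density_family (1, 1/2, b) p x / 2"
    "density_family (-1/2, 1/2, b) p x = - density_family (1, 1/2, b) p x / 2" for b
  proof -
    have "- 1/2 * ln (deriv (fst p) x) + w = (1/2 * ln (deriv (fst p) x) + w) - ln (deriv (fst p) x)" for w
      by (simp add: field_simps)
    then have "exp (- 1/2 * ln (deriv (fst p) x) + w) = exp (1/2 * ln (deriv (fst p) x) + w) / deriv (fst p) x" for w
      using pos by (simp only: exp_diff exp_ln)
    then show "density_family (1/2, -1/2, b) p x = density_family (1, 1/2, b) p x / deriv (fst p) x / 2"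
      by (simp add: density_family_def)
  qed (simp_all add: density_family_def)
  then show "fst (Phi_derivative p U) x = (A x * (deriv (fst U) x / deriv (fst p) x + snd U x) +
      B x * (deriv (fst U) x / deriv (fst p) x - snd U x)) / 4"
    "snd (Phi_derivative p U) x = (A x * (deriv (fst U) x / deriv (fst p) x + snd U x) -
      B x * (deriv (fst U) x / deriv (fst p) x - snd U x)) / 4"
    by (simp_all add: Phi_derivative_def half_sum_diff_def scaleR_fun_def A_def B_def algebra_simps)
qed

text \<open>In null coordinates the indefinite form is half the sum of the two mixed products, so A
  and B enter only through A B = \<phi>_x. The factors (a + U_2) (b - V_2) and (a - U_2) (b + V_2)
  add up to 2 (a b - U_2 V_2), which is the integrand of the metric on the group.\<close>

lemma Phi_isometric:
  assumes r: "r > 1/2"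
  shows "isometric_map (G_model (r + 1)) (S_ambient r) (G (r + 1)) (U_set r)
    (S_tangent r) G_metric (\<lambda>_. pseudo_inner) Phi"
  unfolding isometric_map_def
proof (intro ballI conjI exI)
  fix p assume p: "p \<in> G (r + 1)"
  show "Phi p \<in> U_set r" by (rule Phi_mem[OF r p])
  show D: "has_frechet_derivative (G_model (r + 1)) (S_ambient r) Phi (Phi_derivative p) p"
    by (rule Phi_has_derivative[OF r p])
  define A where "A = density_family (1, 1/2, 1/2) p"
  define B where "B = density_family (1, 1/2, -1/2) p"
  have AB: "A x * B x = deriv (fst p) x" for x
    unfolding A_def B_def by (rule density_family_mult[OF r p])
  have pos: "deriv (fst p) x > 0" for x using p by (simp add: G_iff[OF r])
  note L = Phi_derivative_null_coords[OF r p, folded A_def B_def]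
  have P: "fst (Phi p) x = (A x + B x) / 2" "snd (Phi p) x = (A x - B x) / 2" for x
    by (simp_all add: Phi_eq[OF r p] half_sum_diff_def scaleR_fun_def A_def B_def add_divide_distrib
        diff_divide_distrib)
  have inner: "pseudo_inner f g = integral {0..1} (\<lambda>x. fst f x * fst g x - snd f x * snd g x)" for f g
    by (cases f; cases g) (simp add: pseudo_inner_def)
  show "Phi_derivative p U \<in> S_tangent r (Phi p)" if U: "U \<in> vecs (G_model (r + 1))" for U
  proof -
    \<comment> \<open>This is half the variation of f_1^2 - f_2^2 = \<phi>_x, hence U_1' / 2, which
      integrates to 0 by periodicity.\<close>
    have h: "fst (Phi p) x * fst (Phi_derivative p U) x - snd (Phi p) x * snd (Phi_derivative p U) x =
        1/2 * deriv (fst U) x" for x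
    proof -
      define a where "a = deriv (fst U) x / deriv (fst p) x"
      have "fst (Phi p) x * fst (Phi_derivative p U) x - snd (Phi p) x * snd (Phi_derivative p U) x =
          (A x * B x) * a / 2"
        unfolding L P a_def[symmetric] by (simp add: field_simps)
      then show ?thesis using pos[of x] by (simp add: AB a_def)
    qed
    have "Phi_derivative p U \<in> vecs (S_ambient r)"
      using D U by (auto simp: has_frechet_derivative_def intro: bounded_linear_map_mem)
    moreover have "pseudo_inner (Phi p) (Phi_derivative p U) = 1/2 * integral {0..1} (deriv (fst U))"
      unfolding inner h by simp
    moreover have "integral {0..1} (deriv (fst U)) = 0"
    proof -
      have m: "fst U \<in> vecs (sobolev (r + 1))" using U by (auto simp: G_model_eq vecs_prod_space mem_sobolev0_iff)
      show ?thesis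
        using integral_deriv_period[OF sobolev_derivative(1)[OF r m]] sobolev_periodic[OF m, of 0]
        by (simp add: integral_unique)
    qed
    ultimately show ?thesis by (simp add: S_tangent_def)
  qed
  show "pseudo_inner (Phi_derivative p U) (Phi_derivative p V) = G_metric p U V" for U V
  proof -
    have h: "fst (Phi_derivative p U) x * fst (Phi_derivative p V) x -
        snd (Phi_derivative p U) x * snd (Phi_derivative p V) x =
        1/4 * (deriv (fst U) x * deriv (fst V) x / deriv (fst p) x - snd U x * snd V x * deriv (fst p) x)" for x
    proof -
      define a where "a = deriv (fst U) x / deriv (fst p) x"
      define b where "b = deriv (fst V) x / deriv (fst p) x"
      have e: "fst (Phi_derivative p U) x * fst (Phi_derivative p V) x -
          snd (Phi_derivative p U) x * snd (Phi_derivative p V) x =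
          (A x * B x) * (a * b - snd U x * snd V x) / 4"
        unfolding L a_def[symmetric] b_def[symmetric] by (simp add: field_simps)
      show ?thesis
        unfolding e AB a_def b_def using pos[of x] by (simp add: field_simps)
    qed
    show ?thesis
      unfolding inner h by (cases p; cases U; cases V) (simp add: G_metric_def)
  qed
qed

theorem theorem3p1:
  fixes s :: real
  assumes "s > 5/2"
  shows "diffeomorphism_between (G_model s) (S_ambient (s - 1)) (G s) (U_set (s - 1)) Phi \<and>
         isometric_map (G_model s) (S_ambient (s - 1)) (G s) (U_set (s - 1))
           (S_tangent (s - 1)) G_metric (\<lambda>_. pseudo_inner) Phi"
  \<comment> \<open>The preceding results are stated with r = s - 1, so that H^s appears as
    \<open>sobolev (r + 1)\<close>.\<close>
  using Phi_diffeomorphism[of "s - 1"] Phi_isometric[of "s - 1"] assms by simp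

end
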